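(* Let $\gamma\in(0,1/2)\setminus\mathbb Q$ have continued fraction expansion $\gamma=[a_1,a_2,a_3,\ldots]$ with convergents $p_n/q_n=[a_1,\ldots,a_n]$. Let $\ell>1$ and let $f\in\mathcal S_\gamma^\ell$. There exists a constant $\Lambda_f>1$, depending on $f$, such that if $$\sum_{n\ge1}a_{2n+1}(q_{2n}-p_{2n})\Lambda_f^{-q_{2n}}=+\infty,$$ then $f$ has no absolutely continuous (with respect to Lebesgue measure) invariant probability measure.
   Context: $\mathbb N$ is the set of positive integers, $\mathbb N_0=\mathbb N\cup\{0\}$, and $[a,b]$ denotes the closed interval with endpoints $a,b$ in whichever order. Continued fractions: $[a_1,a_2,\ldots]=1/(a_1+1/(a_2+\cdots))$, with $p_0=0,q_0=1,p_1=1,q_1=a_1$, $p_{n+1}=a_{n+1}p_n+p_{n-1}$, $q_{n+1}=a_{n+1}q_n+q_{n-1}$. Unimodal map: a continuous noninjective map $f:I\to I$ of a compact interval $I$ with $f(\partial I)\subset\partial I$, having a unique turning point $c\in\mathrm{int}(I)$, which is a maximum: $f$ is strictly increasing to the left of $c$ and strictly decreasing to the right. Write $c_n=f^n(c)$. Standing normalization: $c_2<c<c_1$ and $c_2<c_3$. Kneading map: let $D_1=[c,c_1]$ and, for $n\ge2$, $D_n=f(D_{n-1})$ if $c\notin D_{n-1}$, $D_n=[c_n,c_1]$ if $c\in D_{n-1}$. An integer $n\ge1$ is a cutting time if $c\in D_n$; cutting times are enumerated as $1=S_0<S_1=2<S_2<\cdots$. The difference of consecutive cutting times is a cutting time, and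 the kneading map $Q:\mathbb N\to\mathbb N_0$ is defined by $S_k-S_{k-1}=S_{Q(k)}$. $S$-unimodal map of critical order $\ell>1$: a $C^1$ unimodal map which is $C^3$ away from $c$, whose unique critical point is $c$, such that (i) $c$ is non-flat of order $\ell$: there are $C^3$ diffeomorphisms $\phi,\psi$ of $\mathbb R$ with $\phi(c)=0=\psi(f(c))$ and $|\psi(f(x))|=|\phi(x)|^\ell$ near $c$; (ii) $f$ has negative Schwarzian derivative: $\frac{f'''(x)}{f'(x)}-\frac32\left(\frac{f''(x)}{f'(x)}\right)^2<0$ wherever $f'\ne0$. All $S$-unimodal maps are assumed to have no attracting or parabolic periodic orbit. For $\gamma\in(0,1/2)\setminus\mathbb Q$ put $\omega_\gamma=\gamma/(1-\gamma)$ and $Q_\gamma(k)=\lfloor k\omega_\gamma\rfloor-\lfloor(k-1)\omega_\gamma\rfloor$, $k\ge1$. $\mathcal S_\gamma$ is the set of unimodal maps with kneading map $Q_\gamma$, and $\mathcal S_\gamma^\ell$ is the set of $S$-unimodal maps of critical order $\ell$ in $\mathcal S_\gamma$. *)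

theory Defs
  imports "HOL-Probability.Probability"
begin

section \<open>Continued fractions\<close>

definition cfrac_finite :: "(nat \<Rightarrow> nat) \<Rightarrow> nat \<Rightarrow> real" where
  "cfrac_finite a n = foldr (\<lambda>k t. 1 / (real (a k) + t)) [1..<Suc n] 0"

text \<open>Only the partial quotients with index at least 1 matter; \<open>a 0\<close> is never used.\<close>

definition has_cfrac_expansion :: "real \<Rightarrow> (nat \<Rightarrow> nat) \<Rightarrow> bool" where
  "has_cfrac_expansion \<gamma> a \<longleftrightarrow>
     (\<forall>n\<ge>1. a n \<ge> 1) \<and> (\<lambda>n. cfrac_finite a n) \<longlonglongrightarrow> \<gamma>"

fun cfrac_p :: "(nat \<Rightarrow> nat) \<Rightarrow> nat \<Rightarrow> nat" where
  "cfrac_p a 0 = 0"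
| "cfrac_p a (Suc 0) = 1"
| "cfrac_p a (Suc (Suc n)) = a (Suc (Suc n)) * cfrac_p a (Suc n) + cfrac_p a n"

fun cfrac_q :: "(nat \<Rightarrow> nat) \<Rightarrow> nat \<Rightarrow> nat" where
  "cfrac_q a 0 = 1"
| "cfrac_q a (Suc 0) = a 1"
| "cfrac_q a (Suc (Suc n)) = a (Suc (Suc n)) * cfrac_q a (Suc n) + cfrac_q a n"

lemma cfrac_q_pos:
  assumes "\<forall>n\<ge>1. a n \<ge> 1"
  shows "cfrac_q a n > 0"
  using assms by (induction a n rule: cfrac_q.induct) (auto simp: Suc_le_eq)

lemma cfrac_tail:
  fixes t :: real
  assumes "\<forall>n\<ge>1. a n \<ge> 1" "t \<ge> 0"
  shows "foldr (\<lambda>k t. 1 / (real (a k) + t)) [1..<Suc (Suc n)] t =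
    (cfrac_p a (Suc n) + t * cfrac_p a n) / (cfrac_q a (Suc n) + t * cfrac_q a n)"
  using assms(2)
proof (induction n arbitrary: t)
  case 0
  then show ?case by simp
next
  case (Suc n)
  define s where "s = real (a (Suc (Suc n))) + t"
  have s: "s > 0"
    using assms(1) Suc.prems by (simp add: s_def add_pos_nonneg Suc_le_eq)
  have "foldr (\<lambda>k t. 1 / (real (a k) + t)) [1..<Suc (Suc (Suc n))] t =
      foldr (\<lambda>k t. 1 / (real (a k) + t)) [1..<Suc (Suc n)] (1 / s)"
    by (simp add: s_def)
  also have "\<dots> = (cfrac_p a (Suc n) + 1 / s * cfrac_p a n) / (cfrac_q a (Suc n) + 1 / s * cfrac_q a n)"
    using Suc.IH[of "1 / s"] s by (simp del: foldr.simps upt_Suc cfrac_p.simps cfrac_q.simps)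
  also have "\<dots> = (s * (cfrac_p a (Suc n) + 1 / s * cfrac_p a n)) /
      (s * (cfrac_q a (Suc n) + 1 / s * cfrac_q a n))"
    using s by simp
  also have "\<dots> = (s * cfrac_p a (Suc n) + cfrac_p a n) / (s * cfrac_q a (Suc n) + cfrac_q a n)"
    using s by (simp add: distrib_left)
  finally show ?case by (simp add: s_def algebra_simps)
qed

lemma cfrac_finite_eq_convergent:
  assumes "\<forall>n\<ge>1. a n \<ge> 1"
  shows "cfrac_finite a n = real (cfrac_p a n) / real (cfrac_q a n)"
proof (cases n)
  case 0
  then show ?thesis by (simp add: cfrac_finite_def)
next
  case (Suc m)
  show ?thesis
    using cfrac_tail[OF assms, of 0 m] by (simp add: Suc cfrac_finite_def)
qed


section \<open>Unimodal maps and kneading maps\<close>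

text \<open>A map of the interval \<open>{lo..hi}\<close> is represented by a total function on the reals of which
  only the values on \<open>{lo..hi}\<close> matter. The definition includes the standing normalization
  \<open>c\<^sub>2 < c < c\<^sub>1\<close> and \<open>c\<^sub>2 < c\<^sub>3\<close>, where \<open>c\<^sub>n = (f ^^ n) c\<close>.\<close>

definition unimodal :: "real \<Rightarrow> real \<Rightarrow> real \<Rightarrow> (real \<Rightarrow> real) \<Rightarrow> bool" where
  "unimodal lo hi c f \<longleftrightarrow>
     continuous_on {lo..hi} f \<and> f ` {lo..hi} \<subseteq> {lo..hi} \<and> \<not> inj_on f {lo..hi} \<and>
     f ` {lo, hi} \<subseteq> {lo, hi} \<and>
     lo < c \<and> c < hi \<and> strict_mono_on {lo..c} f \<and> strict_antimono_on {c..hi} f \<and>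
     (f ^^ 2) c < c \<and> c < f c \<and> (f ^^ 2) c < (f ^^ 3) c"

text \<open>The sets \<open>D\<^sub>n\<close> start at \<open>n = 1\<close>; the value at \<open>0\<close> is a dummy.\<close>

fun cut_interval :: "real \<Rightarrow> (real \<Rightarrow> real) \<Rightarrow> nat \<Rightarrow> real set" where
  "cut_interval c f 0 = {}"
| "cut_interval c f (Suc 0) = closed_segment c (f c)"
| "cut_interval c f (Suc (Suc n)) =
     (if c \<in> cut_interval c f (Suc n)
      then closed_segment ((f ^^ Suc (Suc n)) c) (f c)
      else f ` cut_interval c f (Suc n))"

definition cutting_times :: "real \<Rightarrow> (real \<Rightarrow> real) \<Rightarrow> nat set" where
  "cutting_times c f = {n. n \<ge> 1 \<and> c \<in> cut_interval c f n}"

definition cutting_time :: "real \<Rightarrow> (real \<Rightarrow> real) \<Rightarrow> nat \<Rightarrow> nat" where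
  "cutting_time c f k = enumerate (cutting_times c f) k"

text \<open>The kneading map is total on the positive integers only if there are infinitely many cutting
  times; it is then determined by the equation below, since the enumeration of the cutting times
  is injective. The value \<open>Q 0\<close> is irrelevant.\<close>

definition has_kneading_map :: "real \<Rightarrow> (real \<Rightarrow> real) \<Rightarrow> (nat \<Rightarrow> nat) \<Rightarrow> bool" where
  "has_kneading_map c f Q \<longleftrightarrow>
     infinite (cutting_times c f) \<and>
     (\<forall>k\<ge>1. cutting_time c f k - cutting_time c f (k - 1) = cutting_time c f (Q k))"

definition sturmian_omega :: "real \<Rightarrow> real" where
  "sturmian_omega \<gamma> = \<gamma> / (1 - \<gamma>)"

definition Q_sturmian :: "real \<Rightarrow> nat \<Rightarrow> nat" where
  "Q_sturmian \<gamma> k =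
     nat (\<lfloor>real k * sturmian_omega \<gamma>\<rfloor> - \<lfloor>(real k - 1) * sturmian_omega \<gamma>\<rfloor>)"


section \<open>S-unimodal maps\<close>

text \<open>Derivatives are taken within the domain, hence are one-sided at the endpoints of an interval.\<close>

definition nth_deriv_on :: "real set \<Rightarrow> nat \<Rightarrow> (real \<Rightarrow> real) \<Rightarrow> real \<Rightarrow> real" where
  "nth_deriv_on X k f = ((\<lambda>g x. vector_derivative g (at x within X)) ^^ k) f"

definition Ck_on :: "nat \<Rightarrow> real set \<Rightarrow> (real \<Rightarrow> real) \<Rightarrow> bool" where
  "Ck_on k X f \<longleftrightarrow>
     (\<forall>i<k. nth_deriv_on X i f differentiable_on X) \<and> continuous_on X (nth_deriv_on X k f)"

definition Ck_diffeo :: "nat \<Rightarrow> (real \<Rightarrow> real) \<Rightarrow> bool" where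
  "Ck_diffeo k \<phi> \<longleftrightarrow> bij \<phi> \<and> Ck_on k UNIV \<phi> \<and> Ck_on k UNIV (inv \<phi>)"

definition nonflat_of_order :: "real \<Rightarrow> real \<Rightarrow> (real \<Rightarrow> real) \<Rightarrow> bool" where
  "nonflat_of_order l c f \<longleftrightarrow>
     (\<exists>\<phi> \<psi>. Ck_diffeo 3 \<phi> \<and> Ck_diffeo 3 \<psi> \<and> \<phi> c = 0 \<and> \<psi> (f c) = 0 \<and>
        (\<forall>\<^sub>F x in nhds c. \<bar>\<psi> (f x)\<bar> = \<bar>\<phi> x\<bar> powr l))"

definition schwarzian_on :: "real set \<Rightarrow> (real \<Rightarrow> real) \<Rightarrow> real \<Rightarrow> real" where
  "schwarzian_on X f x =
     nth_deriv_on X 3 f x / nth_deriv_on X 1 f x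
       - 3 / 2 * (nth_deriv_on X 2 f x / nth_deriv_on X 1 f x)\<^sup>2"

text \<open>\<open>n\<close> need not be the least period: passing to a multiple of the period replaces the multiplier
  by a power of it, so the two properties do not depend on the choice.\<close>

definition attracting_periodic :: "real set \<Rightarrow> (real \<Rightarrow> real) \<Rightarrow> real \<Rightarrow> bool" where
  "attracting_periodic X f x \<longleftrightarrow>
     (\<exists>n\<ge>1. (f ^^ n) x = x \<and> \<bar>nth_deriv_on X 1 (f ^^ n) x\<bar> < 1)"

definition parabolic_periodic :: "real set \<Rightarrow> (real \<Rightarrow> real) \<Rightarrow> real \<Rightarrow> bool" where
  "parabolic_periodic X f x \<longleftrightarrow>
     (\<exists>n\<ge>1. (f ^^ n) x = x \<and> \<bar>nth_deriv_on X 1 (f ^^ n) x\<bar> = 1)"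

text \<open>The Schwarzian derivative is required to be negative on \<open>{lo..hi} - {c}\<close>, which is exactly where
  the first derivative does not vanish.\<close>

definition S_unimodal :: "real \<Rightarrow> real \<Rightarrow> real \<Rightarrow> real \<Rightarrow> (real \<Rightarrow> real) \<Rightarrow> bool" where
  "S_unimodal l lo hi c f \<longleftrightarrow>
     unimodal lo hi c f \<and>
     Ck_on 1 {lo..hi} f \<and> Ck_on 3 ({lo..hi} - {c}) f \<and>
     (\<forall>x\<in>{lo..hi}. nth_deriv_on {lo..hi} 1 f x = 0 \<longleftrightarrow> x = c) \<and>
     nonflat_of_order l c f \<and>
     (\<forall>x\<in>{lo..hi} - {c}. schwarzian_on ({lo..hi} - {c}) f x < 0) \<and>
     (\<forall>x\<in>{lo..hi}. \<not> attracting_periodic {lo..hi} f x \<and> \<not> parabolic_periodic {lo..hi} f x)"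

text \<open>\<open>sturmian_unimodal\<close> is membership in \<open>\<S>\<^sub>\<gamma>\<close> and \<open>sturmian_S_unimodal\<close> is membership
  in the class of S-unimodal maps of critical order \<open>l\<close> in \<open>\<S>\<^sub>\<gamma>\<close>.\<close>

definition sturmian_unimodal ::
    "real \<Rightarrow> real \<Rightarrow> real \<Rightarrow> real \<Rightarrow> (real \<Rightarrow> real) \<Rightarrow> bool" where
  "sturmian_unimodal \<gamma> lo hi c f \<longleftrightarrow>
     unimodal lo hi c f \<and> has_kneading_map c f (Q_sturmian \<gamma>)"

definition sturmian_S_unimodal ::
    "real \<Rightarrow> real \<Rightarrow> real \<Rightarrow> real \<Rightarrow> real \<Rightarrow> (real \<Rightarrow> real) \<Rightarrow> bool" where
  "sturmian_S_unimodal \<gamma> l lo hi c f \<longleftrightarrow>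
     sturmian_unimodal \<gamma> lo hi c f \<and> S_unimodal l lo hi c f"


section \<open>Absolutely continuous invariant probability measures\<close>

definition is_acip :: "real \<Rightarrow> real \<Rightarrow> (real \<Rightarrow> real) \<Rightarrow> real measure \<Rightarrow> bool" where
  "is_acip lo hi f \<mu> \<longleftrightarrow>
     prob_space \<mu> \<and> sets \<mu> = sets (restrict_space borel {lo..hi}) \<and>
     f \<in> measurable \<mu> \<mu> \<and> distr \<mu> \<mu> f = \<mu> \<and>
     absolutely_continuous (restrict_space lborel {lo..hi}) \<mu>"

end

theory Submission
  imports Defs
begin

text \<open>The constant \<open>\<Lambda>\<close> may depend on \<open>f\<close>, so it suffices to show that the existence of an absolutely
  continuous invariant probability measure \<open>\<mu>\<close> forces \<open>a\<^bsub>2n+1\<^esub> \<le> C ^ q\<^bsub>2n\<^esub>\<close> for some \<open>C\<close>. Put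
  \<open>q = q\<^bsub>2n\<^esub>\<close>. The kneading map makes the orbit of \<open>c\<close> follow the rotation by \<open>\<gamma>\<close>, and \<open>q\<gamma>\<close> is
  slightly larger than an integer, so \<open>f\<^sup>q\<close> moves \<open>c\<close> monotonically to the right \<open>a\<^bsub>2n+1\<^esub>\<close> times. The images of
  \<open>[c, c\<^sub>q)\<close> under the iterates of \<open>f\<^sup>q\<close> are therefore disjoint, and \<open>a\<^bsub>2n+1\<^esub> \<mu>[c, c\<^sub>q) \<le> 1\<close> by invariance.
  Non-flatness bounds \<open>c\<^sub>q - c\<close> below by \<open>B\<close> to the power \<open>-q\<close>, as otherwise there would be an attracting
  orbit of period \<open>q\<close>.

  It remains to bound the density of \<open>\<mu>\<close> from below near \<open>c\<close>. Since the kneading map is bounded, the images of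
  the monotone branches of all \<open>f\<^sup>n\<close> contain one of two fixed intervals, and their endpoints lie in a set \<open>K\<close>
  which omits a one-sided neighbourhood of \<open>c\<close>. Negative Schwarzian derivative gives bounded distortion away
  from the endpoints; with a Vitali covering this shows that \<open>K\<close> is \<open>\<mu>\<close>-null. Hence most of the mass of a
  set on which the density is at least \<open>t\<close> is mapped away from \<open>K\<close>, and distortion spreads it evenly over one
  of the two intervals.\<close>

text \<open>Distortion of a branch is not controlled near the ends of its image, and these ends run
  along the orbit of \<open>c\<close>. One neighbourhood of \<open>K\<close> covers the ends for all
  iterates at once, and by invariance its preimages all have the same small \<mu>-mass; so the
  estimates do not depend on the iterate. Distortion is expressed by cross ratios because their
  expansion survives composition and extends to the turning point, where the derivative vanishes. A
  second obstacle is that branches shrink to a point only if no interval at that point has all its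
  iterates monotone. Such intervals are not ruled out. Since every periodic orbit is repelling,
  their iterated images are pairwise disjoint, so they have \<mu>-mass zero, which is all that the
  measure-theoretic part requires. The lower density bound is first found on the interval from
  \<open>f (f c)\<close> to \<open>c\<close>, because every branch image covers it at the current or
  at the next time. It is then carried by \<open>f\<close> to the right side of \<open>c\<close>,
  where the escape takes place.\<close>

section \<open>Cross-ratio expansion\<close>

text \<open>With T = [a, b], J = [x, y] and the two components of T outside J, the cross ratio |T|
  |J| / (|left| |right|) does not decrease under \<open>g\<close>. The form without division passes
  to limits, as in \<open>expands_cross_ratio_closure\<close>.\<close>

definition expands_cross_ratio :: "real set \<Rightarrow> (real \<Rightarrow> real) \<Rightarrow> bool" where
  "expands_cross_ratio S g \<longleftrightarrow>
     (\<forall>a\<in>S. \<forall>x\<in>S. \<forall>y\<in>S. \<forall>b\<in>S. a < x \<and> x < y \<and> y < b \<longrightarrow>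
        (b - a) * (y - x) * (\<bar>g x - g a\<bar> * \<bar>g b - g y\<bar>)
          \<le> \<bar>g b - g a\<bar> * \<bar>g y - g x\<bar> * ((x - a) * (b - y)))"

lemma expands_cross_ratioD:
  assumes "expands_cross_ratio S g" "a \<in> S" "x \<in> S" "y \<in> S" "b \<in> S" "a < x" "x < y" "y < b"
  shows "(b - a) * (y - x) * (\<bar>g x - g a\<bar> * \<bar>g b - g y\<bar>)
          \<le> \<bar>g b - g a\<bar> * \<bar>g y - g x\<bar> * ((x - a) * (b - y))"
  using assms unfolding expands_cross_ratio_def by blast

lemma expands_cross_ratio_subset:
  "expands_cross_ratio S g \<Longrightarrow> S' \<subseteq> S \<Longrightarrow> expands_cross_ratio S' g"
  unfolding expands_cross_ratio_def by blast

lemma expands_cross_ratio_uminus: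
  "expands_cross_ratio S g \<Longrightarrow> expands_cross_ratio S (\<lambda>x. - g x)"
  unfolding expands_cross_ratio_def by (simp add: abs_minus_commute)

text \<open>The two inequalities are multiplied and the factors of the intermediate points cancel;
  strict monotonicity makes them positive. A decreasing \<open>g\<close> reverses the four points,
  and the cross ratio is symmetric under this.\<close>

lemma expands_cross_ratio_compose:
  assumes g: "expands_cross_ratio S g" and h: "expands_cross_ratio T h"
    and gS: "g ` S \<subseteq> T" and mono: "strict_mono_on S g \<or> strict_antimono_on S g"
  shows "expands_cross_ratio S (h \<circ> g)"
  unfolding expands_cross_ratio_def
proof (intro ballI impI, elim conjE)
  fix a x y b
  assume S: "a \<in> S" "x \<in> S" "y \<in> S" "b \<in> S" and less: "a < x" "x < y" "y < b"
  have T: "g a \<in> T" "g x \<in> T" "g y \<in> T" "g b \<in> T"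
    using S gS by auto
  define r where "r = \<bar>g b - g a\<bar> * \<bar>g y - g x\<bar>"
  define r' where "r' = \<bar>g x - g a\<bar> * \<bar>g b - g y\<bar>"
  define H where "H = \<bar>h (g b) - h (g a)\<bar> * \<bar>h (g y) - h (g x)\<bar>"
  define H' where "H' = \<bar>h (g x) - h (g a)\<bar> * \<bar>h (g b) - h (g y)\<bar>"
  define s where "s = (b - a) * (y - x)"
  define s' where "s' = (x - a) * (b - y)"
  have 1: "s * r' \<le> r * s'"
    using expands_cross_ratioD[OF g S less] by (simp add: s_def r'_def r_def s'_def)
  have 2: "r * H' \<le> H * r'" and r: "r > 0" "r' > 0"
  proof -
    consider "g a < g x" "g x < g y" "g y < g b" | "g b < g y" "g y < g x" "g x < g a"
      using mono S less unfolding monotone_on_def by blast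
    then have "r * H' \<le> H * r' \<and> r > 0 \<and> r' > 0"
    proof cases
      case 1
      then show ?thesis
        using expands_cross_ratioD[OF h T 1] by (simp add: r_def H'_def H_def r'_def)
    next
      case 2
      then show ?thesis
        using expands_cross_ratioD[OF h T(4,3,2,1) 2]
        by (simp add: r_def H'_def H_def r'_def abs_minus_commute mult_ac)
    qed
    then show "r * H' \<le> H * r'" "r > 0" "r' > 0" by auto
  qed
  have "s * H' * (r * r') = (s * r') * (r * H')" by simp
  also have "\<dots> \<le> (r * s') * (H * r')"
  proof (rule mult_mono[OF 1 2])
    show "0 \<le> r * s'" "0 \<le> r * H'"
      using less r by (auto simp: s'_def H'_def)
  qed
  also have "\<dots> = (H * s') * (r * r')" by simp
  finally have "s * H' \<le> H * s'"
    using r by (simp add: mult_le_cancel_right)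
  then show "(b - a) * (y - x) * (\<bar>(h \<circ> g) x - (h \<circ> g) a\<bar> * \<bar>(h \<circ> g) b - (h \<circ> g) y\<bar>)
      \<le> \<bar>(h \<circ> g) b - (h \<circ> g) a\<bar> * \<bar>(h \<circ> g) y - (h \<circ> g) x\<bar> * ((x - a) * (b - y))"
    by (simp add: s_def H'_def H_def s'_def)
qed

text \<open>The differential argument needs a nonzero derivative, while the monotone pieces of
  \<open>f\<close> end at the turning point. Only \<open>a\<close> and \<open>b\<close> can be
  endpoints, so it is enough to move them slightly towards \<open>x\<close> and \<open>y\<close> and
  take limits.\<close>

lemma expands_cross_ratio_closure:
  assumes g: "expands_cross_ratio {p<..<q} g" and cont: "continuous_on {p..q} g"
  shows "expands_cross_ratio {p..q} g"
  unfolding expands_cross_ratio_def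
proof (intro ballI impI, elim conjE)
  fix a x y b
  assume S: "a \<in> {p..q}" "x \<in> {p..q}" "y \<in> {p..q}" "b \<in> {p..q}" and less: "a < x" "x < y" "y < b"
  define A where "A e = a + e * (x - a)" for e
  define B where "B e = b - e * (b - y)" for e
  have A: "A e \<in> {p<..<q} \<and> A e < x" and B: "B e \<in> {p<..<q} \<and> y < B e" if "0 < e" "e < 1" for e
  proof -
    have 1: "0 < e * (x - a)" "0 < e * (b - y)" using that less by simp_all
    have 2: "e * (x - a) < x - a" "e * (b - y) < b - y"
      using that less mult_strict_right_mono[of e 1 "x - a"] mult_strict_right_mono[of e 1 "b - y"]
      by simp_all
    have "p \<le> a" "b \<le> q" using S by auto
    with 1 2 less show "A e \<in> {p<..<q} \<and> A e < x" "B e \<in> {p<..<q} \<and> y < B e"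
      unfolding A_def B_def greaterThanLessThan_iff by linarith+
  qed
  have ev: "\<forall>\<^sub>F e in at_right 0. 0 < e \<and> e < (1::real)"
    using eventually_at_right_real[of "0::real" 1] by (auto elim: eventually_mono)
  have lim: "((\<lambda>e. g (A e)) \<longlongrightarrow> g a) (at_right 0)" "((\<lambda>e. g (B e)) \<longlongrightarrow> g b) (at_right 0)"
    "(A \<longlongrightarrow> a) (at_right 0)" "(B \<longlongrightarrow> b) (at_right 0)"
  proof -
    show "(A \<longlongrightarrow> a) (at_right 0)" "(B \<longlongrightarrow> b) (at_right 0)"
      unfolding A_def B_def by (auto intro!: tendsto_eq_intros)
    then have "filterlim A (at a within {p..q}) (at_right 0)" "filterlim B (at b within {p..q}) (at_right 0)"
      unfolding filterlim_at using A B S less ev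
      by (auto elim!: eventually_mono simp: A_def B_def less_imp_le)
    then show "((\<lambda>e. g (A e)) \<longlongrightarrow> g a) (at_right 0)" "((\<lambda>e. g (B e)) \<longlongrightarrow> g b) (at_right 0)"
      using cont S filterlim_compose unfolding continuous_on_def by blast+
  qed
  have "\<forall>\<^sub>F e in at_right 0. (B e - A e) * (y - x) * (\<bar>g x - g (A e)\<bar> * \<bar>g (B e) - g y\<bar>)
      \<le> \<bar>g (B e) - g (A e)\<bar> * \<bar>g y - g x\<bar> * ((x - A e) * (B e - y))"
    using ev
  proof eventually_elim
    case (elim e)
    have xy: "x \<in> {p<..<q}" "y \<in> {p<..<q}" using S less by auto
    show ?case
      using expands_cross_ratioD[OF g _ xy] A[of e] B[of e] elim less by auto
  qed
  moreover have "((\<lambda>e. (B e - A e) * (y - x) * (\<bar>g x - g (A e)\<bar> * \<bar>g (B e) - g y\<bar>)) \<longlongrightarrow>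
     (b - a) * (y - x) * (\<bar>g x - g a\<bar> * \<bar>g b - g y\<bar>)) (at_right 0)"
    "((\<lambda>e. \<bar>g (B e) - g (A e)\<bar> * \<bar>g y - g x\<bar> * ((x - A e) * (B e - y))) \<longlongrightarrow>
     \<bar>g b - g a\<bar> * \<bar>g y - g x\<bar> * ((x - a) * (b - y))) (at_right 0)"
    by (intro tendsto_intros lim)+
  ultimately show "(b - a) * (y - x) * (\<bar>g x - g a\<bar> * \<bar>g b - g y\<bar>)
      \<le> \<bar>g b - g a\<bar> * \<bar>g y - g x\<bar> * ((x - a) * (b - y))"
    by (intro tendsto_le[where F = "at_right (0::real)"]) auto
qed

text \<open>The function \<open>u = 1 / sqrt g'\<close> satisfies \<open>u'' = - S(g) u / 2\<close>, hence is convex.\<close>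

lemma negative_schwarzian_slope:
  fixes g g1 g2 g3 :: "real \<Rightarrow> real"
  assumes d0: "\<And>x. p < x \<Longrightarrow> x < q \<Longrightarrow> (g has_real_derivative g1 x) (at x)"
    and d1: "\<And>x. p < x \<Longrightarrow> x < q \<Longrightarrow> (g1 has_real_derivative g2 x) (at x)"
    and d2: "\<And>x. p < x \<Longrightarrow> x < q \<Longrightarrow> (g2 has_real_derivative g3 x) (at x)"
    and pos: "\<And>x. p < x \<Longrightarrow> x < q \<Longrightarrow> g1 x > 0"
    and S: "\<And>x. p < x \<Longrightarrow> x < q \<Longrightarrow> g3 x / g1 x - 3 / 2 * (g2 x / g1 x)\<^sup>2 \<le> 0"
    and xt: "p < x" "x < t" "t < q"
  shows "g1 x * g1 t * (t - x)\<^sup>2 \<le> (g t - g x)\<^sup>2"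
proof -
  define u where "u x = g1 x powr (-1/2)" for x
  define u1 where "u1 x = (-1/2) * g1 x powr (-3/2) * g2 x" for x
  define u2 where "u2 x = (-1/2) * g1 x powr (-3/2) * g3 x + 3/4 * g1 x powr (-5/2) * (g2 x)\<^sup>2" for x
  have u_pos: "u z > 0" if "p < z" "z < q" for z
    using pos[OF that] by (simp add: u_def)
  have usq: "u z * u z = 1 / g1 z" if "p < z" "z < q" for z
    using pos[OF that] by (simp add: u_def powr_add[symmetric] powr_minus_divide)
  have du: "(u has_real_derivative u1 z) (at z)" if "p < z" "z < q" for z
    unfolding u_def u1_def using pos[OF that]
    by (auto intro!: derivative_eq_intros d1[OF that] simp: field_simps)
  have du1: "(u1 has_real_derivative u2 z) (at z)" if "p < z" "z < q" for z
    unfolding u2_def u1_def using pos[OF that]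
    by (auto intro!: derivative_eq_intros d1[OF that] d2[OF that] simp: field_simps power2_eq_square)
  have u2: "u2 z \<ge> 0" if "p < z" "z < q" for z
  proof -
    note g = pos[OF that]
    have e1: "g1 z powr (-3/2) = g1 z powr (-1/2) / g1 z"
      using g powr_diff[of "g1 z" "-1/2" 1] by (simp)
    have e2: "g1 z powr (-5/2) = g1 z powr (-1/2) / (g1 z)\<^sup>2"
      using g powr_diff[of "g1 z" "-1/2" 2] by (simp add: powr_numeral)
    have "u2 z = - 1/2 * u z * (g3 z / g1 z - 3 / 2 * (g2 z / g1 z)\<^sup>2)"
      unfolding u2_def e1 e2 using g by (simp add: u_def field_simps power2_eq_square)
    moreover have "u z * (g3 z / g1 z - 3 / 2 * (g2 z / g1 z)\<^sup>2) \<le> 0"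
      using u_pos[OF that] S[OF that] by (simp add: mult_nonneg_nonpos)
    ultimately show ?thesis by linarith
  qed
  have conv: "convex_on {p<..<q} u"
    by (rule f''_ge0_imp_convex[where f' = u1 and f'' = u2]) (auto intro: du du1 u2)
  have tangent: "u1 z * (x - z) \<le> u x - u z" if "p < z" "z < q" for z
    by (rule convex_on_imp_above_tangent[OF conv])
      (use that xt in \<open>auto intro!: has_field_derivative_at_within[OF du] simp: interior_open\<close>)
  \<comment> \<open>As \<open>u\<close> lies above its tangents, the derivative of
    \<open>(s - x) / (u x * u s)\<close> in \<open>s\<close> is at most 1 / u(s)^2 =
    \<open>g1 s\<close>. So \<open>H\<close> is nondecreasing, and it starts with the value
    \<open>g x\<close>.\<close>
  define H where "H s = g s - (s - x) / (u x * u s)" for s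
  have "H x \<le> H t"
  proof (rule DERIV_nonneg_imp_nondecreasing[where f = H])
    fix z assume z: "x \<le> z" "z \<le> t"
    then have z': "p < z" "z < q" using xt by auto
    have ux: "u x > 0" "u z > 0" using u_pos xt z' by auto
    have H: "(H has_real_derivative g1 z - (u z - (z - x) * u1 z) / (u x * (u z)\<^sup>2)) (at z)"
      unfolding H_def using ux
      by (auto intro!: derivative_eq_intros d0[OF z'] du[OF z'] simp: field_simps power2_eq_square)
    have "(u z - (z - x) * u1 z) / (u x * (u z)\<^sup>2) \<le> u x / (u x * (u z)\<^sup>2)"
      using tangent[OF z'] ux by (intro divide_right_mono) (auto simp: algebra_simps)
    moreover have "u x / (u x * (u z)\<^sup>2) = g1 z"
      using usq[OF z'] ux pos[OF z'] by (simp add: power2_eq_square field_simps)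
    ultimately have "0 \<le> g1 z - (u z - (z - x) * u1 z) / (u x * (u z)\<^sup>2)" by linarith
    with H show "\<exists>y. (H has_real_derivative y) (at z) \<and> 0 \<le> y" by blast
  qed (use xt in auto)
  then have "(t - x) / (u x * u t) \<le> g t - g x" by (simp add: H_def)
  then have "((t - x) / (u x * u t))\<^sup>2 \<le> (g t - g x)\<^sup>2"
    using u_pos[of x] u_pos[of t] xt by (intro power_mono) auto
  moreover have "((t - x) / (u x * u t))\<^sup>2 = g1 x * g1 t * (t - x)\<^sup>2"
  proof -
    have "((t - x) / (u x * u t))\<^sup>2 = (t - x)\<^sup>2 / ((u x * u x) * (u t * u t))"
      by (simp add: power2_eq_square field_simps)
    then show ?thesis using xt usq[of x] usq[of t] by (simp add: field_simps)
  qed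
  ultimately show ?thesis by simp
qed

text \<open>Integrating the two-point inequality once in each variable gives the statement for a cross ratio
  with overlapping intervals, which Ptolemy's identity turns into the required one.\<close>

lemma expands_cross_ratio_slope:
  fixes g g1 :: "real \<Rightarrow> real"
  assumes d0: "\<And>x. p < x \<Longrightarrow> x < q \<Longrightarrow> (g has_real_derivative g1 x) (at x)"
    and pos: "\<And>x. p < x \<Longrightarrow> x < q \<Longrightarrow> g1 x > 0"
    and E: "\<And>x t. p < x \<Longrightarrow> x < t \<Longrightarrow> t < q \<Longrightarrow> g1 x * g1 t * (t - x)\<^sup>2 \<le> (g t - g x)\<^sup>2"
  shows "expands_cross_ratio {p<..<q} g"
  unfolding expands_cross_ratio_def
proof (intro ballI impI, elim conjE)
  fix a x y b
  assume S: "a \<in> {p<..<q}" "x \<in> {p<..<q}" "y \<in> {p<..<q}" "b \<in> {p<..<q}"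
    and less: "a < x" "x < y" "y < b"
  have mono: "g s < g t" if "p < s" "s < t" "t < q" for s t
    by (rule DERIV_pos_imp_increasing[OF that(2)]) (use that d0 pos in \<open>meson le_less_trans less_le_trans\<close>)
  \<comment> \<open>First integration: hypothesis \<open>E\<close> gives the sign of the
    \<open>t\<close>-derivative of \<open>g1 s / (g t - g s) - 1 / (t - s)\<close>, used from
    \<open>y\<close> to \<open>b\<close>.\<close>
  have step1: "g1 s * (1 / (g y - g s) - 1 / (g b - g s)) \<le> 1 / (y - s) - 1 / (b - s)"
    if "p < s" "s < y" for s
  proof -
    have "g1 s / (g b - g s) - 1 / (b - s) \<ge> g1 s / (g y - g s) - 1 / (y - s)"
    proof (rule DERIV_nonneg_imp_nondecreasing[of y b])
      fix t assume t: "y \<le> t" "t \<le> b"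
      then have t': "p < t" "s < t" "t < q" using that S by auto
      have gg: "g s < g t" using mono that t' by auto
      have "((\<lambda>t. g1 s / (g t - g s) - 1 / (t - s)) has_real_derivative
          1 / (t - s)\<^sup>2 - g1 s * g1 t / (g t - g s)\<^sup>2) (at t)"
        using gg t' by (auto intro!: derivative_eq_intros d0 simp: field_simps power2_eq_square)
      moreover have "g1 s * g1 t / (g t - g s)\<^sup>2 \<le> 1 / (t - s)\<^sup>2"
        using E[of s t] that t' gg by (simp add: field_simps)
      ultimately show "\<exists>z. ((\<lambda>t. g1 s / (g t - g s) - 1 / (t - s)) has_real_derivative z) (at t) \<and> 0 \<le> z"
        by (intro exI[of _ "1 / (t - s)\<^sup>2 - g1 s * g1 t / (g t - g s)\<^sup>2"]) simp
    qed (use less in auto)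
    then show ?thesis by (simp add: algebra_simps)
  qed
  \<comment> \<open>Second integration, over \<open>s\<close> from \<open>a\<close> to
    \<open>x\<close>: \<open>step1\<close> says that this logarithm of a cross ratio is
    nonincreasing.\<close>
  define \<phi> where "\<phi> s = ln (g b - g s) - ln (g y - g s) + ln (y - s) - ln (b - s)" for s
  have "\<phi> a \<ge> \<phi> x"
  proof (rule DERIV_nonpos_imp_nonincreasing[where f = \<phi>])
    fix s assume s: "a \<le> s" "s \<le> x"
    then have s': "p < s" "s < y" "s < b" "s < q" using S less by auto
    have gg: "g s < g y" "g s < g b" using mono s' S by auto
    have \<phi>: "(\<phi> has_real_derivative g1 s * (1 / (g y - g s) - 1 / (g b - g s)) - (1 / (y - s) - 1 / (b - s))) (at s)"
      unfolding \<phi>_def using gg s'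
      by (auto intro!: derivative_eq_intros d0 simp: right_diff_distrib)
    moreover have "g1 s * (1 / (g y - g s) - 1 / (g b - g s)) - (1 / (y - s) - 1 / (b - s)) \<le> 0"
      using step1[OF s'(1,2)] by simp
    ultimately show "\<exists>z. (\<phi> has_real_derivative z) (at s) \<and> z \<le> 0" by blast
  qed (use less in auto)
  define A where "A s = (g b - g s) * (y - s)" for s
  define B where "B s = (g y - g s) * (b - s)" for s
  have AB: "A s > 0 \<and> B s > 0 \<and> \<phi> s = ln (A s / B s)" if "p < s" "s < y" for s
    using that mono[of s y] mono[of s b] less S
    by (auto simp: \<phi>_def A_def B_def ln_mult ln_div)
  have "A x / B x \<le> A a / B a"
    using \<open>\<phi> a \<ge> \<phi> x\<close> AB[of a] AB[of x] S less by auto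
  then have *: "A x * B a \<le> A a * B x"
    using AB[of a] AB[of x] S less by (simp add: field_simps)
  define P where "P = (b - a) * (y - x)" define Q where "Q = (x - a) * (b - y)"
  define P' where "P' = (g b - g a) * (g y - g x)" define Q' where "Q' = (g x - g a) * (g b - g y)"
  \<comment> \<open>Ptolemy's identity, once for the values of \<open>g\<close> and once for the
    points. The common term \<open>P' * P\<close> then drops out of \<open>*\<close>.\<close>
  have "A x * B a = (P' + Q') * P" "A a * B x = P' * (P + Q)"
    unfolding A_def B_def P_def Q_def P'_def Q'_def by algebra+
  with * have "P * Q' \<le> P' * Q" by (simp add: algebra_simps)
  moreover have "g a < g x" "g x < g y" "g y < g b" "g a < g b" using mono S less by auto
  ultimately show "(b - a) * (y - x) * (\<bar>g x - g a\<bar> * \<bar>g b - g y\<bar>)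
      \<le> \<bar>g b - g a\<bar> * \<bar>g y - g x\<bar> * ((x - a) * (b - y))"
    by (simp add: P_def Q_def P'_def Q'_def)
qed

text \<open>A Koebe-type estimate: an interval J = [j1, j2] with a long image fills a definite
  proportion of M = [m1, m2]. Only M needs margins in the image; J may touch the ends of the branch.
  The signed length of M is split at \<open>j1\<close> and \<open>j2\<close>. The part to the left
  of J is bounded by the cross ratio of \<open>a\<close>, \<open>m1\<close>, \<open>j1\<close>,
  \<open>j2\<close>, the part to the right by that of \<open>j1\<close>, \<open>j2\<close>,
  \<open>m2\<close>, \<open>b\<close>: there J is an outer interval and the margin \<open>d\<close>
  bounds the other outer interval from below.\<close>

lemma branch_distortion:
  fixes g :: "real \<Rightarrow> real"
  assumes cr: "expands_cross_ratio {a..b} g"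
    and mono: "strict_mono_on {a..b} g \<or> strict_antimono_on {a..b} g"
    and D: "\<bar>g b - g a\<bar> \<le> D" and d: "d > 0"
    and j: "a \<le> j1" "j1 < j2" "j2 \<le> b"
    and m: "a \<le> m1" "m1 \<le> m2" "m2 \<le> b"
    and marg: "d \<le> \<bar>g m1 - g a\<bar>" "d \<le> \<bar>g b - g m2\<bar>"
  shows "(m2 - m1) * \<bar>g j2 - g j1\<bar> \<le> (2 * D\<^sup>2 / d + D) * (j2 - j1)"
proof -
  have bound: "\<bar>g t - g s\<bar> \<le> D" if "a \<le> s" "s \<le> t" "t \<le> b" for s t
  proof -
    have "mono_on {a..b} g \<or> antimono_on {a..b} g"
      using mono unfolding monotone_on_def by (metis order_le_less)
    then have "g a \<le> g s \<and> g s \<le> g t \<and> g t \<le> g b \<or> g a \<ge> g s \<and> g s \<ge> g t \<and> g t \<ge> g b"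
      using that unfolding monotone_on_def by auto
    then show ?thesis using D by linarith
  qed
  have D0: "D \<ge> 0" using D by linarith
  have m1: "a < m1" "m2 < b" using marg d m by (auto simp: less_le)
  have J: "\<bar>g j2 - g j1\<bar> > 0"
  proof -
    have "g j1 \<noteq> g j2" using mono j monotone_onD[of "{a..b}" "(<)" _ g j1 j2] by fastforce
    then show ?thesis by simp
  qed
  define G where "G = \<bar>g j2 - g j1\<bar>"
  have left: "(j1 - m1) * G \<le> D\<^sup>2 / d * (j2 - j1)"
  proof (cases "m1 < j1")
    case True
    have "(j2 - a) * (j1 - m1) * (\<bar>g m1 - g a\<bar> * G) \<le> \<bar>g j2 - g a\<bar> * \<bar>g j1 - g m1\<bar> * ((m1 - a) * (j2 - j1))"
      unfolding G_def by (rule expands_cross_ratioD[OF cr]) (use True m m1 j in auto)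
    moreover have "(j2 - a) * (j1 - m1) * (\<bar>g m1 - g a\<bar> * G) \<ge> (j2 - a) * (j1 - m1) * (d * G)"
      using True m1 m j J marg by (intro mult_left_mono mult_right_mono) (auto simp: G_def)
    moreover have "\<bar>g j2 - g a\<bar> * \<bar>g j1 - g m1\<bar> * ((m1 - a) * (j2 - j1)) \<le> D * D * ((j2 - a) * (j2 - j1))"
      using True m1 m j D0 by (intro mult_mono bound) auto
    ultimately have "(j2 - a) * ((j1 - m1) * (d * G)) \<le> (j2 - a) * (D * D * (j2 - j1))"
      by (simp add: mult_ac)
    then have "(j1 - m1) * (d * G) \<le> D * D * (j2 - j1)"
      using True m1 j by (simp add: mult_le_cancel_left)
    then show ?thesis using d by (simp add: field_simps power2_eq_square)
  next
    case False
    then have "(j1 - m1) * G \<le> 0" using J by (simp add: G_def mult_nonpos_nonneg)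
    also have "0 \<le> D\<^sup>2 / d * (j2 - j1)" using d j by simp
    finally show ?thesis .
  qed
  have right: "(m2 - j2) * G \<le> D\<^sup>2 / d * (j2 - j1)"
  proof (cases "j2 < m2")
    case True
    have "(b - j1) * (m2 - j2) * (\<bar>g j2 - g j1\<bar> * \<bar>g b - g m2\<bar>) \<le> \<bar>g b - g j1\<bar> * \<bar>g m2 - g j2\<bar> * ((j2 - j1) * (b - m2))"
      by (rule expands_cross_ratioD[OF cr]) (use True m m1 j in auto)
    moreover have "(b - j1) * (m2 - j2) * (\<bar>g j2 - g j1\<bar> * \<bar>g b - g m2\<bar>) \<ge> (b - j1) * (m2 - j2) * (G * d)"
      using True m1 m j J marg unfolding G_def by (intro mult_left_mono) auto
    moreover have "\<bar>g b - g j1\<bar> * \<bar>g m2 - g j2\<bar> * ((j2 - j1) * (b - m2)) \<le> D * D * ((j2 - j1) * (b - j1))"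
      using True m1 m j D0 by (intro mult_mono bound) auto
    ultimately have "(b - j1) * ((m2 - j2) * (d * G)) \<le> (b - j1) * (D * D * (j2 - j1))"
      by (simp add: mult_ac)
    then have "(m2 - j2) * (d * G) \<le> D * D * (j2 - j1)"
      using True m1 j by (simp add: mult_le_cancel_left)
    then show ?thesis using d by (simp add: field_simps power2_eq_square)
  next
    case False
    then have "(m2 - j2) * G \<le> 0" using J by (simp add: G_def mult_nonpos_nonneg)
    also have "0 \<le> D\<^sup>2 / d * (j2 - j1)" using d j by simp
    finally show ?thesis .
  qed
  have mid: "(j2 - j1) * G \<le> D * (j2 - j1)"
    using bound[of j1 j2] j by (simp add: G_def mult.commute mult_left_mono)
  have "(m2 - m1) * G = (j1 - m1) * G + (j2 - j1) * G + (m2 - j2) * G" by (simp add: algebra_simps)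
  also have "\<dots> \<le> D\<^sup>2 / d * (j2 - j1) + D * (j2 - j1) + D\<^sup>2 / d * (j2 - j1)"
    using left right mid by linarith
  finally show ?thesis unfolding G_def by (simp add: algebra_simps)
qed

section \<open>Smooth unimodal maps\<close>

locale S_unimodal_map =
  fixes l lo hi c :: real and f :: "real \<Rightarrow> real"
  assumes S_unimodal: "S_unimodal l lo hi c f" and l_gt_1: "l > 1"
begin

definition df :: "real \<Rightarrow> real" where "df x = vector_derivative f (at x within {lo..hi})"

lemma unimodal: "unimodal lo hi c f"
  using S_unimodal unfolding S_unimodal_def by blast

lemma lo_less_c: "lo < c" and c_less_hi: "c < hi"
  and f_cont: "continuous_on {lo..hi} f"
  and f_left: "strict_mono_on {lo..c} f" and f_right: "strict_antimono_on {c..hi} f"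
  and c2_less: "(f ^^ 2) c < c" and c_less_c1: "c < f c" and c2_less_c3: "(f ^^ 2) c < (f ^^ 3) c"
  using unimodal unfolding unimodal_def by blast+

lemma f_less_left: "lo \<le> x \<Longrightarrow> x < y \<Longrightarrow> y \<le> c \<Longrightarrow> f x < f y"
  using f_left unfolding monotone_on_def by auto

lemma f_less_right: "c \<le> x \<Longrightarrow> x < y \<Longrightarrow> y \<le> hi \<Longrightarrow> f y < f x"
  using f_right unfolding monotone_on_def by auto

lemma f_in: "x \<in> {lo..hi} \<Longrightarrow> f x \<in> {lo..hi}"
  using unimodal unfolding unimodal_def by blast

lemma f_lo: "f lo = lo" and f_hi: "f hi = lo"
proof -
  have "f lo \<in> {lo, hi}" "f hi \<in> {lo, hi}" using unimodal unfolding unimodal_def by auto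
  moreover have "f c \<le> hi" using f_in[of c] lo_less_c c_less_hi by auto
  moreover have "f lo < f c" "f hi < f c"
    using f_less_left[of lo c] f_less_right[of c hi] lo_less_c c_less_hi by auto
  ultimately show "f lo = lo" "f hi = lo" by auto
qed

lemma iter_in: "x \<in> {lo..hi} \<Longrightarrow> (f ^^ n) x \<in> {lo..hi}"
  by (induction n) (use f_in in auto)

lemma iter_c_in: "(f ^^ n) c \<in> {lo..hi}"
  using iter_in[of c n] lo_less_c c_less_hi by auto

lemma iter_lo: "(f ^^ n) lo = lo"
  by (induction n) (auto simp: f_lo)

lemma iter_cont: "continuous_on {lo..hi} (f ^^ n)"
proof (induction n)
  case (Suc n)
  have "(f ^^ n) ` {lo..hi} \<subseteq> {lo..hi}" using iter_in by blast
  then show ?case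
    using continuous_on_compose[OF Suc continuous_on_subset[OF f_cont]] by (simp add: comp_def)
qed (simp add: continuous_on_id)

lemma Ck1: "Ck_on 1 {lo..hi} f" and Ck3: "Ck_on 3 ({lo..hi} - {c}) f"
  and nonflat: "nonflat_of_order l c f"
  using S_unimodal unfolding S_unimodal_def by blast+

lemma nth_deriv_on_1: "nth_deriv_on X (Suc 0) g x = vector_derivative g (at x within X)"
  by (simp add: nth_deriv_on_def)

lemma df_eq_0_iff: "x \<in> {lo..hi} \<Longrightarrow> df x = 0 \<longleftrightarrow> x = c"
  using S_unimodal unfolding S_unimodal_def df_def by (simp add: nth_deriv_on_1)

lemma df: "x \<in> {lo..hi} \<Longrightarrow> (f has_real_derivative df x) (at x within {lo..hi})"
  using Ck1 unfolding Ck_on_def df_def differentiable_on_def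
  by (simp add: nth_deriv_on_def has_real_derivative_iff_has_vector_derivative vector_derivative_works[symmetric])

lemma df_cont: "continuous_on {lo..hi} df"
  using Ck1 unfolding Ck_on_def by (simp add: df_def nth_deriv_on_def)

text \<open>Chosen at least 1, so that inserting further factors \<open>L\<close> only weakens an
  upper bound.\<close>

definition L :: real where
  "L = (SOME L. L \<ge> 1 \<and> (\<forall>x\<in>{lo..hi}. \<forall>y\<in>{lo..hi}. \<bar>f x - f y\<bar> \<le> L * \<bar>x - y\<bar>)
     \<and> (\<forall>x\<in>{lo..hi}. \<bar>df x\<bar> \<le> L))"

lemma L: "L \<ge> 1" "\<And>x y. x \<in> {lo..hi} \<Longrightarrow> y \<in> {lo..hi} \<Longrightarrow> \<bar>f x - f y\<bar> \<le> L * \<bar>x - y\<bar>"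
  "\<And>x. x \<in> {lo..hi} \<Longrightarrow> \<bar>df x\<bar> \<le> L"
proof -
  have "bounded (df ` {lo..hi})"
    by (intro compact_imp_bounded compact_continuous_image df_cont compact_Icc)
  then obtain B where B: "\<forall>x\<in>{lo..hi}. \<bar>df x\<bar> \<le> B"
    unfolding bounded_iff by auto
  define M where "M = max 1 B"
  have M: "\<bar>df x\<bar> \<le> M" if "x \<in> {lo..hi}" for x using B that by (auto simp: M_def le_max_iff_disj)
  have "\<bar>f x - f y\<bar> \<le> M * \<bar>x - y\<bar>" if "x \<in> {lo..hi}" "y \<in> {lo..hi}" for x y
    using field_differentiable_bound[of "{lo..hi}" f df M x y] df M that by auto
  with M have "M \<ge> 1 \<and> (\<forall>x\<in>{lo..hi}. \<forall>y\<in>{lo..hi}. \<bar>f x - f y\<bar> \<le> M * \<bar>x - y\<bar>)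
     \<and> (\<forall>x\<in>{lo..hi}. \<bar>df x\<bar> \<le> M)"
    by (simp add: M_def)
  from someI[of "\<lambda>L. L \<ge> 1 \<and> (\<forall>x\<in>{lo..hi}. \<forall>y\<in>{lo..hi}. \<bar>f x - f y\<bar> \<le> L * \<bar>x - y\<bar>)
     \<and> (\<forall>x\<in>{lo..hi}. \<bar>df x\<bar> \<le> L)", OF this, folded L_def]
  show "L \<ge> 1" "\<And>x y. x \<in> {lo..hi} \<Longrightarrow> y \<in> {lo..hi} \<Longrightarrow> \<bar>f x - f y\<bar> \<le> L * \<bar>x - y\<bar>"
    "\<And>x. x \<in> {lo..hi} \<Longrightarrow> \<bar>df x\<bar> \<le> L"
    by blast+
qed

lemma iter_deriv:
  "x \<in> {lo..hi} \<Longrightarrow>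
    ((f ^^ n) has_real_derivative (\<Prod>i<n. df ((f ^^ i) x))) (at x within {lo..hi})"
proof (induction n)
  case 0
  show ?case by (simp add: id_def)
next
  case (Suc n)
  have "((f ^^ n) has_real_derivative (\<Prod>i<n. df ((f ^^ i) x))) (at x within {lo..hi})"
    using Suc by blast
  moreover have "(f has_real_derivative df ((f ^^ n) x)) (at ((f ^^ n) x) within (f ^^ n) ` {lo..hi})"
    by (rule DERIV_subset[OF df]) (use iter_in Suc.prems in auto)
  ultimately have "(f \<circ> (f ^^ n) has_real_derivative df ((f ^^ n) x) * (\<Prod>i<n. df ((f ^^ i) x))) (at x within {lo..hi})"
    by (intro DERIV_image_chain)
  then show ?case by (simp add: mult.commute comp_def)
qed

lemma periodic_repelling:
  assumes x: "x \<in> {lo..hi}" and n: "n \<ge> 1" and per: "(f ^^ n) x = x"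
    and D: "((f ^^ n) has_real_derivative D) (at x within {lo..hi})"
  shows "\<bar>D\<bar> > 1"
proof -
  have "vector_derivative (f ^^ n) (at x within {lo..hi}) = D"
    using vector_derivative_within_cbox[where f = "f ^^ n" and x = x and a = lo and b = hi and f' = D]
      x D lo_less_c c_less_hi
    by (simp add: has_real_derivative_iff_has_vector_derivative)
  moreover have "\<not> attracting_periodic {lo..hi} f x" "\<not> parabolic_periodic {lo..hi} f x"
    using S_unimodal x unfolding S_unimodal_def by auto
  ultimately show ?thesis
    using n per unfolding attracting_periodic_def parabolic_periodic_def
    by (simp add: nth_deriv_on_1) (metis linorder_neqE_linordered_idom)
qed

text \<open>A periodic turning point would be superattracting: the chain rule product contains the
  factor \<open>df c = 0\<close>.\<close>

lemma iter_c_neq_c: assumes "n \<ge> 1" shows "(f ^^ n) c \<noteq> c"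
proof
  assume per: "(f ^^ n) c = c"
  have c: "c \<in> {lo..hi}" using lo_less_c c_less_hi by auto
  have "(\<Prod>i<n. df ((f ^^ i) c)) = 0"
    using assms df_eq_0_iff[OF c] by (intro prod_zero bexI[of _ 0]) auto
  then show False
    using periodic_repelling[OF c assms per iter_deriv[OF c]] by linarith
qed

lemma deriv_interior:
  assumes "x \<in> {lo<..<c} \<union> {c<..<hi}" "i < 3"
  shows "(nth_deriv_on ({lo..hi} - {c}) i f has_real_derivative nth_deriv_on ({lo..hi} - {c}) (Suc i) f x) (at x)"
proof -
  let ?X = "{lo..hi} - {c}"
  have "x \<in> interior ?X"
    by (rule interiorI[of "{lo<..<c} \<union> {c<..<hi}"]) (use assms lo_less_c c_less_hi in auto)
  then have at: "at x within ?X = at x" by (rule at_within_interior)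
  have "nth_deriv_on ?X i f differentiable (at x within ?X)"
    using Ck3 assms lo_less_c c_less_hi unfolding Ck_on_def differentiable_on_def by auto
  then show ?thesis
    unfolding at has_real_derivative_iff_has_vector_derivative nth_deriv_on_def
    by (simp add: at vector_derivative_works)
qed

lemma expands_left: "expands_cross_ratio {lo..c} f"
  and expands_right: "expands_cross_ratio {c..hi} f"
proof -
  let ?X = "{lo..hi} - {c}"
  define g1 g2 g3 where "g1 = nth_deriv_on ?X 1 f" and "g2 = nth_deriv_on ?X 2 f"
    and "g3 = nth_deriv_on ?X 3 f"
  have D0: "(f has_real_derivative g1 x) (at x)" and D1: "(g1 has_real_derivative g2 x) (at x)"
    and D2: "(g2 has_real_derivative g3 x) (at x)"
    if "x \<in> {lo<..<c} \<union> {c<..<hi}" for x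
    using deriv_interior[OF that, of 0] deriv_interior[OF that, of 1] deriv_interior[OF that, of 2]
    by (simp_all add: g1_def g2_def g3_def numeral_2_eq_2 numeral_3_eq_3)
      (simp add: nth_deriv_on_def)
  have nz: "g1 x \<noteq> 0" if x: "x \<in> {lo<..<c} \<union> {c<..<hi}" for x
  proof
    assume "g1 x = 0"
    then have "(f has_real_derivative 0) (at x within {lo..hi})"
      using D0[OF x] has_field_derivative_at_within by metis
    moreover have x': "x \<in> cbox lo hi" using x lo_less_c c_less_hi by auto
    ultimately have "df x = 0"
      using vector_derivative_within_cbox[where f = f and x = x and a = lo and b = hi and f' = 0] lo_less_c c_less_hi
      by (simp add: df_def has_real_derivative_iff_has_vector_derivative)
    then show False using df_eq_0_iff[of x] x x' by auto
  qed
  have left: "g1 x > 0" if x: "x \<in> {lo<..<c}" for x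
  proof (rule ccontr)
    assume "\<not> g1 x > 0"
    then have "g1 x < 0" using nz[of x] x by force
    then obtain d where d: "d > 0" "\<And>h. 0 < h \<Longrightarrow> h < d \<Longrightarrow> f (x + h) < f x"
      using DERIV_neg_dec_right[OF D0[of x]] x by auto
    define h where "h = min (d/2) ((c - x)/2)"
    have "0 < h" "h < d" "x + h \<le> c" using d x by (auto simp: h_def min_def field_simps)
    then show False using d(2)[of h] f_less_left[of x "x+h"] x by auto
  qed
  have right: "g1 x < 0" if x: "x \<in> {c<..<hi}" for x
  proof (rule ccontr)
    assume "\<not> g1 x < 0"
    then have "g1 x > 0" using nz[of x] x by force
    then obtain d where d: "d > 0" "\<And>h. 0 < h \<Longrightarrow> h < d \<Longrightarrow> f x < f (x + h)"
      using DERIV_pos_inc_right[OF D0[of x]] x by auto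
    define h where "h = min (d/2) ((hi - x)/2)"
    have "0 < h" "h < d" "x + h \<le> hi" using d x by (auto simp: h_def min_def field_simps)
    then show False using d(2)[of h] f_less_right[of x "x+h"] x by auto
  qed
  have S: "g3 x / g1 x - 3 / 2 * (g2 x / g1 x)\<^sup>2 < 0" if "x \<in> {lo<..<c} \<union> {c<..<hi}" for x
  proof -
    have "x \<in> ?X" using that lo_less_c c_less_hi by auto
    moreover have "\<forall>x\<in>?X. schwarzian_on ?X f x < 0"
      using S_unimodal unfolding S_unimodal_def by (elim conjE)
    ultimately have "schwarzian_on ?X f x < 0" by (rule bspec[rotated])
    then show ?thesis by (simp add: schwarzian_on_def g1_def g2_def g3_def)
  qed
  have "expands_cross_ratio {lo<..<c} f"
    by (rule expands_cross_ratio_slope[of lo c f "g1"])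
      (auto intro!: D0 left negative_schwarzian_slope[of lo c f "g1" "g2" "g3"] D1 D2 less_imp_le[OF S])
  then show "expands_cross_ratio {lo..c} f"
    using f_cont lo_less_c c_less_hi by (auto intro!: expands_cross_ratio_closure intro: continuous_on_subset)
  \<comment> \<open>The slope lemma is stated for positive derivatives; \<open>- f\<close> has one
    on this side and has the same Schwarzian derivative as \<open>f\<close>.\<close>
  have "expands_cross_ratio {c<..<hi} (\<lambda>x. - f x)"
  proof (rule expands_cross_ratio_slope[of c hi _ "\<lambda>x. - g1 x"])
    fix x t assume "c < x" "x < t" "t < hi"
    then show "- g1 x * - g1 t * (t - x)\<^sup>2 \<le> (- f t - - f x)\<^sup>2"
    proof (rule negative_schwarzian_slope[of c hi _ "\<lambda>x. - g1 x" "\<lambda>x. - g2 x" "\<lambda>x. - g3 x", rotated 5])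
      fix x assume "c < x" "x < hi"
      then have x: "x \<in> {lo<..<c} \<union> {c<..<hi}" "x \<in> {c<..<hi}" by auto
      show "((\<lambda>x. - f x) has_real_derivative - g1 x) (at x)" by (rule DERIV_minus[OF D0[OF x(1)]])
      show "((\<lambda>x. - g1 x) has_real_derivative - g2 x) (at x)" by (rule DERIV_minus[OF D1[OF x(1)]])
      show "((\<lambda>x. - g2 x) has_real_derivative - g3 x) (at x)" by (rule DERIV_minus[OF D2[OF x(1)]])
      show "0 < - g1 x" using right[OF x(2)] by simp
      show "- g3 x / - g1 x - 3 / 2 * (- g2 x / - g1 x)\<^sup>2 \<le> 0" using S[OF x(1)] by simp
    qed
  qed (auto intro!: DERIV_minus D0 simp: right)
  then have "expands_cross_ratio {c<..<hi} f"
    using expands_cross_ratio_uminus by fastforce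
  then show "expands_cross_ratio {c..hi} f"
    using f_cont lo_less_c c_less_hi by (auto intro!: expands_cross_ratio_closure intro: continuous_on_subset)
qed

end

section \<open>Non-flatness and the closest returns of the critical orbit\<close>

lemma DERIV_abs_nonzero:
  fixes h :: "real \<Rightarrow> real"
  assumes D: "(h has_real_derivative D) (at x)" and nz: "h x \<noteq> 0"
  shows "((\<lambda>x. \<bar>h x\<bar>) has_real_derivative sgn (h x) * D) (at x)"
proof -
  have "(h \<longlongrightarrow> h x) (nhds x)"
    using DERIV_isCont[OF D] by (simp add: continuous_at tendsto_at_iff_tendsto_nhds)
  then have ev: "\<forall>\<^sub>F y in nhds x. dist (h y) (h x) < \<bar>h x\<bar>"
    using nz by (intro tendstoD) auto
  have "\<forall>\<^sub>F y in nhds x. \<bar>h y\<bar> = sgn (h x) * h y"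
    using ev by eventually_elim (auto simp: dist_real_def sgn_if)
  moreover have "((\<lambda>y. sgn (h x) * h y) has_real_derivative sgn (h x) * D) (at x)"
    by (rule DERIV_cmult[OF D])
  ultimately show ?thesis using DERIV_cong_ev by fastforce
qed

lemma Ck_diffeo_deriv:
  assumes "Ck_diffeo 3 \<phi>"
  obtains \<phi>' where "\<And>x. (\<phi> has_real_derivative \<phi>' x) (at x)" "continuous_on UNIV \<phi>'" "\<And>x. \<phi>' x \<noteq> 0"
proof -
  have C: "bij \<phi>" "Ck_on 3 UNIV \<phi>" "Ck_on 3 UNIV (inv \<phi>)" using assms by (auto simp: Ck_diffeo_def)
  have deriv: "(g has_real_derivative nth_deriv_on UNIV 1 g x) (at x)"
    and cont: "continuous_on UNIV (nth_deriv_on UNIV 1 g)" if "Ck_on 3 UNIV g" for g x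
  proof -
    have "nth_deriv_on UNIV 0 g differentiable_on UNIV" "nth_deriv_on UNIV 1 g differentiable_on UNIV"
      using that unfolding Ck_on_def by auto
    then show "(g has_real_derivative nth_deriv_on UNIV 1 g x) (at x)" "continuous_on UNIV (nth_deriv_on UNIV 1 g)"
      by (auto simp: differentiable_on_def nth_deriv_on_def has_real_derivative_iff_has_vector_derivative
          vector_derivative_works[symmetric] intro: differentiable_imp_continuous_on)
  qed
  have "nth_deriv_on UNIV 1 \<phi> x \<noteq> 0" for x
  proof -
    have "((\<lambda>x. inv \<phi> (\<phi> x)) has_real_derivative nth_deriv_on UNIV 1 (inv \<phi>) (\<phi> x) * nth_deriv_on UNIV 1 \<phi> x) (at x)"
      by (rule DERIV_chain2[OF deriv[OF C(3)] deriv[OF C(2)]])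
    moreover have "(\<lambda>x. inv \<phi> (\<phi> x)) = (\<lambda>x. x)"
      using C(1) by (simp add: bij_is_inj)
    ultimately have "nth_deriv_on UNIV 1 (inv \<phi>) (\<phi> x) * nth_deriv_on UNIV 1 \<phi> x = 1"
      using DERIV_unique DERIV_ident by metis
    then show ?thesis by auto
  qed
  with deriv[OF C(2)] cont[OF C(2)] show thesis by (rule that)
qed

context S_unimodal_map
begin

text \<open>Both sides of the non-flatness equation are differentiated. Near \<open>c\<close> the
  derivative of \<psi> along \<open>f\<close> stays away from 0, and \<phi> is Lipschitz and
  vanishes at \<open>c\<close>; this leaves a multiple of the power \<open>l - 1\<close> of the
  distance to \<open>c\<close>.\<close>

lemma nonflat_deriv_bound:
  obtains M \<rho> where "M > 0" "\<rho> > 0" "\<And>x. x \<in> {lo..hi} \<Longrightarrow> \<bar>x - c\<bar> < \<rho> \<Longrightarrow> \<bar>df x\<bar> \<le> M * \<bar>x - c\<bar> powr (l - 1)"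
proof -
  obtain \<phi> \<psi> where C: "Ck_diffeo 3 \<phi>" "Ck_diffeo 3 \<psi>" and 0: "\<phi> c = 0" "\<psi> (f c) = 0"
    and ev: "\<forall>\<^sub>F x in nhds c. \<bar>\<psi> (f x)\<bar> = \<bar>\<phi> x\<bar> powr l"
    using nonflat unfolding nonflat_of_order_def by blast
  obtain \<phi>' where \<phi>': "\<And>x. (\<phi> has_real_derivative \<phi>' x) (at x)" "continuous_on UNIV \<phi>'"
    using Ck_diffeo_deriv[OF C(1)] by metis
  obtain \<psi>' where \<psi>': "\<And>x. (\<psi> has_real_derivative \<psi>' x) (at x)" "continuous_on UNIV \<psi>'" "\<And>x. \<psi>' x \<noteq> 0"
    using Ck_diffeo_deriv[OF C(2)] by metis
  have inj: "inj \<phi>" "inj \<psi>" using C by (auto simp: Ck_diffeo_def bij_is_inj)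
  obtain U where U: "open U" "c \<in> U" "\<And>x. x \<in> U \<Longrightarrow> \<bar>\<psi> (f x)\<bar> = \<bar>\<phi> x\<bar> powr l"
    using ev unfolding eventually_nhds by blast
  obtain \<rho> where \<rho>: "\<rho> > 0" "{c - \<rho> .. c + \<rho>} \<subseteq> U \<inter> {lo<..<hi}"
  proof -
    have "open (U \<inter> {lo<..<hi})" "c \<in> U \<inter> {lo<..<hi}" using U lo_less_c c_less_hi by auto
    then have "\<exists>e>0. cball c e \<subseteq> U \<inter> {lo<..<hi}" by (rule open_contains_cball[THEN iffD1, THEN bspec])
    then show thesis using that unfolding cball_eq_atLeastAtMost by (elim exE conjE)
  qed
  let ?I = "{c - \<rho> .. c + \<rho>}"
  have "bounded (\<phi>' ` ?I)"
    by (intro compact_imp_bounded compact_continuous_image) (auto intro: continuous_on_subset[OF \<phi>'(2)])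
  then obtain A where A: "A > 0" "\<And>x. x \<in> ?I \<Longrightarrow> \<bar>\<phi>' x\<bar> \<le> A"
    unfolding bounded_pos by auto
  have \<phi>_bd: "\<bar>\<phi> x\<bar> \<le> A * \<bar>x - c\<bar>" if "x \<in> ?I" for x
    using field_differentiable_bound[of ?I \<phi> \<phi>' A x c] that A \<rho> \<phi>'(1) 0
    by (auto simp: has_field_derivative_at_within)
  have "continuous_on ?I (\<lambda>x. \<psi>' (f x))"
    by (rule continuous_on_compose2[OF \<psi>'(2) continuous_on_subset[OF f_cont]]) (use \<rho> in force)+
  then have "bounded ((\<lambda>x. inverse (\<psi>' (f x))) ` ?I)"
    using \<psi>'(3) by (intro compact_imp_bounded compact_continuous_image continuous_on_inverse) auto
  then obtain B where B: "B > 0" "\<And>x. x \<in> ?I \<Longrightarrow> \<bar>inverse (\<psi>' (f x))\<bar> \<le> B"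
    unfolding bounded_pos by auto
  show thesis
  proof (rule that[of "B * (l * A powr (l - 1) * A)" \<rho>])
    show "B * (l * A powr (l - 1) * A) > 0" using A B l_gt_1 by simp
    fix x assume x: "x \<in> {lo..hi}" "\<bar>x - c\<bar> < \<rho>"
    then have xI: "x \<in> ?I" by auto
    show "\<bar>df x\<bar> \<le> B * (l * A powr (l - 1) * A) * \<bar>x - c\<bar> powr (l - 1)"
    proof (cases "x = c")
      case True
      then show ?thesis using df_eq_0_iff[OF x(1)] by simp
    next
      case False
      have nz: "\<phi> x \<noteq> 0" using False inj_eq[OF inj(1), of x c] 0 by simp
      have xU: "x \<in> U" using subsetD[OF \<rho>(2) xI] by simp
      have "\<bar>\<phi> x\<bar> powr l \<noteq> 0" using nz by simp
      then have nz': "\<psi> (f x) \<noteq> 0" unfolding U(3)[OF xU, symmetric] by simp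
      have "x \<in> interior {lo..hi}" using subsetD[OF \<rho>(2) xI] by simp
      then have "at x within {lo..hi} = at x" by (rule at_within_interior)
      with df[OF x(1)] have "(f has_real_derivative df x) (at x)" by argo
      from DERIV_chain2[OF \<psi>'(1)[of "f x"] this]
      have "((\<lambda>x. \<psi> (f x)) has_real_derivative \<psi>' (f x) * df x) (at x)" .
      from DERIV_abs_nonzero[OF this, OF nz']
      have 1: "((\<lambda>x. \<bar>\<psi> (f x)\<bar>) has_real_derivative sgn (\<psi> (f x)) * (\<psi>' (f x) * df x)) (at x)" .
      from DERIV_abs_nonzero[OF \<phi>'(1)[of x], OF nz]
      have "((\<lambda>x. \<bar>\<phi> x\<bar>) has_real_derivative sgn (\<phi> x) * \<phi>' x) (at x)" .
      from DERIV_fun_powr[OF this, of l] nz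
      have 2: "((\<lambda>x. \<bar>\<phi> x\<bar> powr l) has_real_derivative l * \<bar>\<phi> x\<bar> powr (l - 1) * (sgn (\<phi> x) * \<phi>' x)) (at x)"
        by simp
      have "((\<lambda>x. \<bar>\<phi> x\<bar> powr l) has_real_derivative sgn (\<psi> (f x)) * (\<psi>' (f x) * df x)) (at x)"
        by (rule has_field_derivative_transform_within_open[OF 1 U(1) xU]) (rule U(3))
      then have "sgn (\<psi> (f x)) * (\<psi>' (f x) * df x) = l * \<bar>\<phi> x\<bar> powr (l - 1) * (sgn (\<phi> x) * \<phi>' x)"
        by (rule DERIV_unique[OF _ 2])
      then have "\<bar>sgn (\<psi> (f x)) * (\<psi>' (f x) * df x)\<bar> = \<bar>l * \<bar>\<phi> x\<bar> powr (l - 1) * (sgn (\<phi> x) * \<phi>' x)\<bar>"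
        by (rule arg_cong)
      then have "\<bar>\<psi>' (f x)\<bar> * \<bar>df x\<bar> = l * \<bar>\<phi> x\<bar> powr (l - 1) * \<bar>\<phi>' x\<bar>"
        using nz nz' l_gt_1 by (simp only: abs_mult abs_sgn_eq) simp
      then have "\<bar>df x\<bar> = \<bar>inverse (\<psi>' (f x))\<bar> * (l * \<bar>\<phi> x\<bar> powr (l - 1) * \<bar>\<phi>' x\<bar>)"
        using \<psi>'(3)[of "f x"] by (simp add: field_simps)
      also have "\<dots> \<le> B * (l * (A * \<bar>x - c\<bar>) powr (l - 1) * A)"
        using A(1) B(1) l_gt_1 by (intro mult_mono A(2) B(2) powr_mono2 \<phi>_bd xI) auto
      also have "\<dots> = B * (l * A powr (l - 1) * A) * \<bar>x - c\<bar> powr (l - 1)"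
        using A by (simp add: powr_mult)
      finally show ?thesis .
    qed
  qed (use \<rho> in auto)
qed

text \<open>A closer return would produce an attracting periodic orbit of period \<open>q\<close> near \<open>c\<close>.\<close>

lemma closest_return_bound:
  obtains B where "B > 1" "\<And>q. q \<ge> 1 \<Longrightarrow> (f ^^ q) c > c \<Longrightarrow> (f ^^ q) c - c \<ge> 1 / B ^ q"
proof -
  obtain M \<rho> where M: "M > 0" "\<rho> > 0"
    "\<And>x. x \<in> {lo..hi} \<Longrightarrow> \<bar>x - c\<bar> < \<rho> \<Longrightarrow> \<bar>df x\<bar> \<le> M * \<bar>x - c\<bar> powr (l - 1)"
    using nonflat_deriv_bound by blast
  define M' where "M' = max 1 M"
  define K where "K = 2 * M' * L * 2 powr (l - 1)"
  have K: "K \<ge> 1" using L l_gt_1 ge_one_powr_ge_zero[of 2 "l - 1"]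
    by (auto simp: K_def M'_def intro!: mult_ge1_I)
  \<comment> \<open>The first three entries give \<open>B > 1\<close> and keep [c, c + 2e] inside
    \<open>{lo..hi}\<close> and inside the range of the derivative bound. The last one makes
    \<open>B powr (l - 1)\<close> at least \<open>K\<close>, which pays for one factor
    \<open>L\<close> per iterate and for the constants in front.\<close>
  define B where "B = Max {2, 4 / \<rho>, 2 / (hi - c), K powr (1 / (l - 1))}"
  have B: "B \<ge> 2" "B \<ge> 4 / \<rho>" "B \<ge> 2 / (hi - c)" "B \<ge> K powr (1 / (l - 1))"
    by (simp_all add: B_def)
  have BK: "B powr (l - 1) \<ge> K"
  proof -
    have "K = (K powr (1 / (l - 1))) powr (l - 1)" using K l_gt_1 by (simp add: powr_powr)
    also have "\<dots> \<le> B powr (l - 1)" using B l_gt_1 by (intro powr_mono2) auto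
    finally show ?thesis .
  qed
  show thesis
  proof (rule that[of B])
    fix q :: nat assume q: "q \<ge> 1" and cq: "(f ^^ q) c > c"
    show "(f ^^ q) c - c \<ge> 1 / B ^ q"
    proof (rule ccontr)
      assume neg: "\<not> (f ^^ q) c - c \<ge> 1 / B ^ q"
      define e where "e = (f ^^ q) c - c"
      have e: "e > 0" "e < 1 / B ^ q" using cq neg by (auto simp: e_def)
      have "e * B \<le> e * B ^ q"
        using B(1) q e self_le_power[of B q] by (intro mult_left_mono) auto
      moreover have "e * B ^ q < 1" using e B(1) by (simp add: divide_simps)
      ultimately have eB: "2 * e * B < 2" by linarith
      have "2 * e < \<rho>" "c + 2 * e \<le> hi"
      proof -
        have "2 * e * (4 / \<rho>) \<le> 2 * e * B" "2 * e * (2 / (hi - c)) \<le> 2 * e * B"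
          using e B by (intro mult_left_mono; simp)+
        then have "2 * e * (4 / \<rho>) < 2" "2 * e * (2 / (hi - c)) < 2" using eB by linarith+
        then show "2 * e < \<rho>" "c + 2 * e \<le> hi" using M(2) c_less_hi e by (auto simp: field_simps)
      qed
      note e = e this
      \<comment> \<open>Twice the displacement \<open>e\<close>: a map with slope at most 1/2 that
        sends \<open>c\<close> to \<open>c + e\<close> maps this interval into itself.\<close>
      let ?I = "{c..c + 2 * e}"
      have I: "?I \<subseteq> {lo..hi}" using e lo_less_c by auto
      have small: "M * (2 * e) powr (l - 1) * L ^ q \<le> 1 / 2"
      proof -
        have "(2 * e) powr (l - 1) \<le> (2 / B ^ q) powr (l - 1)"
          using e l_gt_1 by (intro powr_mono2) auto
        also have "\<dots> = 2 powr (l - 1) / (B powr (l - 1)) ^ q"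
          using B(1) by (simp add: powr_divide powr_realpow[symmetric] powr_powr mult.commute)
        also have "\<dots> \<le> 2 powr (l - 1) / K ^ q"
          using BK K by (intro divide_left_mono power_mono mult_pos_pos zero_less_power) auto
        finally have "(2 * e) powr (l - 1) \<le> 2 powr (l - 1) / K ^ q" .
        then have "M * (2 * e) powr (l - 1) * L ^ q \<le> M' * (2 powr (l - 1) / K ^ q) * L ^ q"
          using M L K by (intro mult_mono) (auto simp: M'_def)
        also have "\<dots> \<le> 1 / 2"
        proof -
          define a where "a = M' * 2 powr (l - 1)"
          have a: "a \<ge> 1" using ge_one_powr_ge_zero[of 2 "l - 1"] l_gt_1
            by (auto simp: a_def M'_def intro!: mult_ge1_I)
          have "2 * a * L ^ q \<le> (2 * a) ^ q * L ^ q"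
            using a L q self_le_power[of "2 * a" q] by (intro mult_right_mono) auto
          also have "\<dots> = K ^ q" by (simp add: K_def a_def power_mult_distrib mult_ac)
          finally have "2 * a * L ^ q \<le> K ^ q" .
          then show ?thesis using K by (simp add: a_def field_simps)
        qed
        finally show ?thesis .
      qed
      have D: "\<bar>\<Prod>i<q. df ((f ^^ i) x)\<bar> \<le> 1 / 2" if x: "x \<in> ?I" for x
      proof -
        obtain q' where q': "q = Suc q'" using q by (cases q) auto
        have "\<bar>\<Prod>i<q. df ((f ^^ i) x)\<bar> = \<bar>df x\<bar> * (\<Prod>i<q'. \<bar>df ((f ^^ Suc i) x)\<bar>)"
          unfolding q' prod.lessThan_Suc_shift by (simp add: abs_mult abs_prod)
        also have "\<dots> \<le> (M * (2 * e) powr (l - 1)) * (\<Prod>i<q'. L)"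
        proof (rule mult_mono)
          have "\<bar>df x\<bar> \<le> M * \<bar>x - c\<bar> powr (l - 1)" using x I e by (intro M(3)) auto
          also have "\<dots> \<le> M * (2 * e) powr (l - 1)"
            using x M(1) l_gt_1 by (intro mult_left_mono powr_mono2) auto
          finally show "\<bar>df x\<bar> \<le> M * (2 * e) powr (l - 1)" .
          show "(\<Prod>i<q'. \<bar>df ((f ^^ Suc i) x)\<bar>) \<le> (\<Prod>i<q'. L)"
            using x I L by (intro prod_mono conjI L(3) iter_in) auto
        qed (use M in \<open>auto intro: prod_nonneg\<close>)
        also have "\<dots> \<le> (M * (2 * e) powr (l - 1)) * L ^ q"
          using L M unfolding q' by (intro mult_left_mono) (auto intro: power_increasing)
        finally show ?thesis using small by linarith
      qed
      have close: "\<bar>(f ^^ q) x - (f ^^ q) c\<bar> \<le> 1 / 2 * \<bar>x - c\<bar>" if x: "x \<in> ?I" for x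
        using field_differentiable_bound[of ?I "f ^^ q" "\<lambda>x. \<Prod>i<q. df ((f ^^ i) x)" "1/2" x c]
          D x e I DERIV_subset[OF iter_deriv I] by auto
      have "(f ^^ q) ` ?I \<subseteq> ?I"
      proof
        fix y assume "y \<in> (f ^^ q) ` ?I"
        then obtain x where x: "x \<in> ?I" "y = (f ^^ q) x" by auto
        have "\<bar>y - (c + e)\<bar> \<le> 1/2 * \<bar>x - c\<bar>" using close[OF x(1)] by (simp add: x(2) e_def)
        also have "\<dots> \<le> e" using x(1) by auto
        finally show "y \<in> ?I" by auto
      qed
      then have "f ^^ q \<in> ?I \<rightarrow> ?I" by blast
      moreover have "?I \<noteq> {}" using e(1) by simp
      ultimately obtain x where x: "x \<in> ?I" "(f ^^ q) x = x"
        using brouwer[OF compact_Icc convex_real_interval(5) _ continuous_on_subset[OF iter_cont I]]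
        by metis
      then have "\<bar>\<Prod>i<q. df ((f ^^ i) x)\<bar> > 1"
        using I q by (intro periodic_repelling[OF _ _ _ iter_deriv]) auto
      then show False using D[OF x(1)] by linarith
    qed
  qed (use B in auto)
qed

end

section \<open>The kneading map\<close>

locale sturmian_map = S_unimodal_map +
  fixes \<gamma> :: real
  assumes \<gamma>_pos: "0 < \<gamma>" and \<gamma>_less: "\<gamma> < 1/2"
    and kneading: "has_kneading_map c f (Q_sturmian \<gamma>)"
begin

text \<open>In the rotation model, time \<open>i\<close> corresponds to the point \<open>i\<gamma>\<close> modulo 1, with \<open>c\<close> at \<open>0\<close>.\<close>

definition F :: "int \<Rightarrow> int" where "F i = \<lfloor>of_int i * \<gamma>\<rfloor>"

definition cut :: "nat \<Rightarrow> bool" where "cut n \<longleftrightarrow> n \<in> cutting_times c f"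

text \<open>As \<gamma> is below 1/2, not only one step but also two steps raise \<open>F\<close> by
  at most 1. The jumps of \<open>F\<close> are therefore isolated.\<close>

lemma F_step: "F i = F (i - 1) \<or> F i = F (i - 1) + 1"
  and F_step2: "F i = F (i - 2) \<or> F i = F (i - 2) + 1"
proof -
  have *: "\<lfloor>y + d\<rfloor> = \<lfloor>y\<rfloor> \<or> \<lfloor>y + d\<rfloor> = \<lfloor>y\<rfloor> + 1" if "0 < d" "d < 1" for y d :: real
    using that by linarith
  have eq: "of_int i * \<gamma> = of_int (i - 1) * \<gamma> + \<gamma>" "of_int i * \<gamma> = of_int (i - 2) * \<gamma> + 2 * \<gamma>"
    by (simp_all add: algebra_simps)
  show "F i = F (i - 1) \<or> F i = F (i - 1) + 1"
    unfolding F_def eq(1) by (rule *) (use \<gamma>_pos \<gamma>_less in auto)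
  show "F i = F (i - 2) \<or> F i = F (i - 2) + 1"
    unfolding F_def eq(2) by (rule *) (use \<gamma>_pos \<gamma>_less in auto)
qed

lemma F_small: "F 0 = 0" "F 1 = 0" "F 2 = 0" "F (-1) = -1"
  unfolding F_def using \<gamma>_pos \<gamma>_less by (simp_all add: floor_eq_iff)

lemma omega: "0 < sturmian_omega \<gamma>" "sturmian_omega \<gamma> < 1"
  using \<gamma>_pos \<gamma>_less by (simp_all add: sturmian_omega_def field_simps)

lemma cutting_time_0: "cutting_time c f 0 = 1"
proof -
  have "(LEAST n. n \<in> cutting_times c f) = 1"
    by (rule Least_equality) (auto simp: cutting_times_def)
  then show ?thesis by (simp add: cutting_time_def enumerate_0)
qed

text \<open>\<open>Q_sturmian\<close> takes only the values 0 and 1, so consecutive cutting times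
  differ by 1 or by 2. The floor counts the differences equal to 2.\<close>

lemma cutting_time: "int (cutting_time c f k) = 1 + int k + \<lfloor>real k * sturmian_omega \<gamma>\<rfloor>"
proof -
  define w where "w = sturmian_omega \<gamma>"
  have w: "0 < w" "w < 1" using omega by (simp_all add: w_def)
  have inf: "infinite (cutting_times c f)"
    and step: "cutting_time c f (Suc k) - cutting_time c f k = cutting_time c f (Q_sturmian \<gamma> (Suc k))" for k
    using kneading unfolding has_kneading_map_def by auto
  \<comment> \<open>The kneading equation subtracts natural numbers; strict growth turns it into an
    addition.\<close>
  have less: "cutting_time c f k < cutting_time c f (Suc k)" for k
    unfolding cutting_time_def by (rule enumerate_step[OF inf])
  have fl: "\<lfloor>real (Suc k) * w\<rfloor> = \<lfloor>real k * w\<rfloor> \<or> \<lfloor>real (Suc k) * w\<rfloor> = \<lfloor>real k * w\<rfloor> + 1" for k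
  proof -
    have "real (Suc k) * w = real k * w + w" by (simp add: algebra_simps)
    then show ?thesis using w by linarith
  qed
  have Q: "Q_sturmian \<gamma> (Suc k) = nat (\<lfloor>real (Suc k) * w\<rfloor> - \<lfloor>real k * w\<rfloor>)" for k
    unfolding Q_sturmian_def w_def by simp
  have "\<lfloor>w\<rfloor> = 0" using w by (simp add: floor_eq_iff)
  then have "Q_sturmian \<gamma> 1 = 0" using Q[of 0] by simp
  then have one: "cutting_time c f 1 = 2"
    using step[of 0] less[of 0] cutting_time_0 by simp
  show ?thesis
    unfolding w_def[symmetric]
  proof (induction k)
    case 0
    show ?case by (simp add: cutting_time_0)
  next
    case (Suc k)
    show ?case
      using fl[of k] Suc step[of k] less[of k] Q[of k] cutting_time_0 one
      by (elim disjE) (simp_all add: algebra_simps)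
  qed
qed

text \<open>Let m be the floor of k times \<open>sturmian_omega \<gamma>\<close> and n = 1 + k + m.
  Clearing the denominator 1 - \<gamma>, the two bounds that define the floor become m \<le> (n -
  1)\<gamma> and n\<gamma> < m + 1, which says that \<open>F\<close> equals m at both n - 1 and
  n.\<close>

lemma cut_iff: assumes "n \<ge> 1" shows "cut n \<longleftrightarrow> F (int n) = F (int n - 1)"
proof -
  have inf: "infinite (cutting_times c f)"
    using kneading unfolding has_kneading_map_def by auto
  have "cut n \<longleftrightarrow> (\<exists>k. n = cutting_time c f k)"
    using range_enumerate[OF inf] unfolding cut_def cutting_time_def by (metis rangeE rangeI)
  also have "\<dots> \<longleftrightarrow> (\<exists>k. int n = 1 + int k + \<lfloor>real k * sturmian_omega \<gamma>\<rfloor>)"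
    by (simp flip: cutting_time)
  also have "\<dots> \<longleftrightarrow> F (int n) = F (int n - 1)"
  proof
    assume "\<exists>k. int n = 1 + int k + \<lfloor>real k * sturmian_omega \<gamma>\<rfloor>"
    then obtain k where k: "int n = 1 + int k + \<lfloor>real k * sturmian_omega \<gamma>\<rfloor>" by blast
    define m where "m = \<lfloor>real k * sturmian_omega \<gamma>\<rfloor>"
    have rn: "real n = 1 + real k + of_int m"
      using arg_cong[OF k, of real_of_int] by (simp add: m_def)
    have "of_int m \<le> real k * \<gamma> / (1 - \<gamma>)" "real k * \<gamma> / (1 - \<gamma>) < of_int m + 1"
      using floor_correct[of "real k * sturmian_omega \<gamma>"] by (simp_all add: m_def sturmian_omega_def)
    then have "of_int m * (1 - \<gamma>) \<le> real k * \<gamma>" "real k * \<gamma> < (of_int m + 1) * (1 - \<gamma>)"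
      using \<gamma>_less by (simp_all add: pos_le_divide_eq pos_divide_less_eq)
    then have "of_int m \<le> (real n - 1) * \<gamma>" "real n * \<gamma> < of_int m + 1"
      unfolding rn by (simp_all add: algebra_simps)
    moreover have "(real n - 1) * \<gamma> \<le> real n * \<gamma>" using \<gamma>_pos by (simp add: algebra_simps)
    ultimately have "F (int n) = m" "F (int n - 1) = m"
      unfolding F_def by (simp_all add: floor_eq_iff)
    then show "F (int n) = F (int n - 1)" by simp
  next
    assume eq: "F (int n) = F (int n - 1)"
    define m where "m = F (int n)"
    have 1: "of_int m \<le> (real n - 1) * \<gamma>" "real n * \<gamma> < of_int m + 1"
      using eq floor_correct[of "real n * \<gamma>"] floor_correct[of "(real n - 1) * \<gamma>"]
      unfolding m_def F_def by simp_all
    have n1: "real n - 1 \<ge> 0" using assms by simp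
    then have "(real n - 1) * \<gamma> \<le> real n - 1" using \<gamma>_less by (simp add: mult_left_le)
    then have "of_int m \<le> real_of_int (int n - 1)" using 1 by simp
    then have "m \<le> int n - 1" by linarith
    then obtain k where k: "int n - 1 - m = int k" using nonneg_int_cases[of "int n - 1 - m"] by auto
    have rk: "real k = real n - 1 - of_int m" using arg_cong[OF k, of real_of_int] by simp
    have "of_int m * (1 - \<gamma>) \<le> real k * \<gamma>" "real k * \<gamma> < (of_int m + 1) * (1 - \<gamma>)"
      using 1 unfolding rk by (simp_all add: algebra_simps)
    then have "of_int m \<le> real k * sturmian_omega \<gamma>" "real k * sturmian_omega \<gamma> < of_int m + 1"
      using \<gamma>_less unfolding sturmian_omega_def by (simp_all add: pos_le_divide_eq pos_divide_less_eq)
    then have "\<lfloor>real k * sturmian_omega \<gamma>\<rfloor> = m" by (simp add: floor_eq_iff)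
    then show "\<exists>k. int n = 1 + int k + \<lfloor>real k * sturmian_omega \<gamma>\<rfloor>" using k by (intro exI[of _ k]) simp
  qed
  finally show ?thesis .
qed

lemma cut_1: "cut 1" and cut_2: "cut 2"
  by (simp_all add: cut_iff F_small)

lemma cut_Suc: "n \<ge> 1 \<Longrightarrow> \<not> cut n \<Longrightarrow> cut (Suc n)"
  using cut_iff[of n] cut_iff[of "Suc n"] F_step[of "int n"] F_step[of "int n + 1"] F_step2[of "int n + 1"]
  by (auto simp: algebra_simps)

section \<open>The side of the turning point on which the critical orbit lies\<close>

abbreviation cs :: "nat \<Rightarrow> real" where "cs n \<equiv> (f ^^ n) c"

lemma cut_interval_step:
  assumes "n \<ge> 1"
  shows "cut n \<Longrightarrow> cut_interval c f (Suc n) = closed_segment (cs (Suc n)) (f c)"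
    and "\<not> cut n \<Longrightarrow> cut_interval c f (Suc n) = f ` cut_interval c f n"
proof -
  obtain m where m: "n = Suc m" using assms by (cases n) auto
  have "cut n \<longleftrightarrow> c \<in> cut_interval c f n" using assms by (simp add: cut_def cutting_times_def)
  then show "cut n \<Longrightarrow> cut_interval c f (Suc n) = closed_segment (cs (Suc n)) (f c)"
    and "\<not> cut n \<Longrightarrow> cut_interval c f (Suc n) = f ` cut_interval c f n"
    unfolding m by (simp_all only: cut_interval.simps if_True if_False)
qed

lemma cut_mem: "n \<ge> 1 \<Longrightarrow> cut n \<longleftrightarrow> c \<in> cut_interval c f n"
  by (simp add: cut_def cutting_times_def)

lemma f_image_right: assumes "c \<le> a" "a \<le> b" "b \<le> hi" shows "f ` {a..b} = {f b..f a}"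
proof
  show "f ` {a..b} \<subseteq> {f b..f a}"
    using f_less_right assms by (force simp: le_less)
  show "{f b..f a} \<subseteq> f ` {a..b}"
  proof
    fix y assume "y \<in> {f b..f a}"
    moreover have "continuous_on {a..b} f" using assms lo_less_c by (intro continuous_on_subset[OF f_cont]) auto
    ultimately show "y \<in> f ` {a..b}" using IVT2'[of f b y a] assms by force
  qed
qed

text \<open>The side is read off the interval D_n. After a cutting time it is [c_n, c_1], and as
  \<open>c < f c\<close>, it contains \<open>c\<close> exactly if c_n < c. After a non-cutting time
  it is the image [c_2, c_n] of [c_{n-1}, c_1], and it contains \<open>c\<close> because n is then a
  cutting time, so c_n > c.\<close>

lemma cs_side_aux:
  assumes "n \<ge> 1"
  shows "\<not> cut n \<Longrightarrow> cs n > c"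
    and "cut n \<Longrightarrow> n \<ge> 2 \<Longrightarrow> cut (n - 1) \<Longrightarrow> cs n < c"
    and "cut n \<Longrightarrow> n \<ge> 2 \<Longrightarrow> \<not> cut (n - 1) \<Longrightarrow> cs n > c"
proof -
  have ne: "cs n \<noteq> c" using assms by (rule iter_c_neq_c)
  have main: "\<not> cut m \<Longrightarrow> cs m > c" if m: "m \<ge> 1" for m
  proof -
    assume nc: "\<not> cut m"
    then have "m \<noteq> 1" using cut_1 by auto
    then obtain m' where m': "m = Suc m'" "m' \<ge> 1" using m by (cases m) auto
    have "cut m'" using nc cut_Suc m' by blast
    then have "cut_interval c f m = closed_segment (cs m) (f c)" using cut_interval_step(1) m' by simp
    then have "c \<notin> closed_segment (cs m) (f c)" using nc cut_mem[OF m] by simp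
    then show "cs m > c" using c_less_c1 by (auto simp: closed_segment_eq_real_ivl split: if_splits)
  qed
  from main[OF assms] show "\<not> cut n \<Longrightarrow> cs n > c" .
  {
    assume A: "cut n" "n \<ge> 2"
    then obtain m where m: "n = Suc m" "m \<ge> 1" by (cases n) auto
    {
      assume "cut (n - 1)"
      then have "cut m" using m by simp
      then have "cut_interval c f n = closed_segment (cs n) (f c)" using cut_interval_step(1) m by simp
      then have "c \<in> closed_segment (cs n) (f c)" using A cut_mem[OF assms] by simp
      then show "cs n < c" using c_less_c1 ne by (auto simp: closed_segment_eq_real_ivl split: if_splits)
    }
    {
      assume "\<not> cut (n - 1)"
      then have nc: "\<not> cut m" using m by simp
      then have "m \<noteq> 1" using cut_1 by auto
      then obtain k where k: "m = Suc k" "k \<ge> 1" using m by (cases m) auto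
      have "cut k" using nc cut_Suc k by blast
      then have "cut_interval c f m = closed_segment (cs m) (f c)" using cut_interval_step(1) k by simp
      then have D: "cut_interval c f n = f ` closed_segment (cs m) (f c)"
        using cut_interval_step(2)[OF m(2) nc] m by simp
      have "cs m > c" using main[OF m(2) nc] .
      moreover have "cs m \<noteq> c" using m iter_c_neq_c by blast
      ultimately have "f (cs k) = cs m" "cs k \<noteq> c"
        using iter_c_neq_c[OF k(2)] k by auto
      have "cs m \<le> f c"
      proof -
        have "cs k \<in> {lo..hi}" by (rule iter_c_in)
        then show ?thesis
          using \<open>f (cs k) = cs m\<close> \<open>cs k \<noteq> c\<close> f_less_left[of "cs k" c] f_less_right[of c "cs k"] by force
      qed
      then have "closed_segment (cs m) (f c) = {cs m..f c}" by (simp add: closed_segment_eq_real_ivl)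
      moreover have "f ` {cs m..f c} = {f (f c)..f (cs m)}"
        using \<open>cs m > c\<close> \<open>cs m \<le> f c\<close> iter_c_in[of 1] by (intro f_image_right) auto
      ultimately have "c \<in> {f (f c)..f (cs m)}" using D A cut_mem[OF assms] by simp
      then have "c \<le> cs n" using m by simp
      then show "cs n > c" using ne by simp
    }
  }
qed

text \<open>The itinerary of \<open>c\<close> as a coding of the rotation: c_n lies to the left
  exactly if n and n - 1 are both cutting times. For n = 1 the value \<open>F (-1) = -1\<close>
  makes the formula agree with \<open>c < f c\<close>.\<close>

lemma cs_less_iff: assumes "n \<ge> 1" shows "cs n < c \<longleftrightarrow> F (int n) = F (int n - 2)"
proof (cases "n = 1")
  case True
  then show ?thesis using c_less_c1 by (simp add: F_small)
next
  case False
  then have n: "n \<ge> 2" using assms by simp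
  have i: "int (n - 1) = int n - 1" "int n - 1 - 1 = int n - 2" using n by auto
  have "cs n < c \<longleftrightarrow> cut n \<and> cut (n - 1)"
    using cs_side_aux[OF assms] n by (metis less_asym')
  also have "\<dots> \<longleftrightarrow> F (int n) = F (int n - 1) \<and> F (int n - 1) = F (int n - 2)"
    using cut_iff[of n] cut_iff[of "n - 1"] n unfolding i by simp
  also have "\<dots> \<longleftrightarrow> F (int n) = F (int n - 2)"
    using F_step[of "int n"] F_step[of "int n - 1"] unfolding i by auto
  finally show ?thesis .
qed

lemma cs_greater: "n \<ge> 1 \<Longrightarrow> \<not> cs n < c \<Longrightarrow> cs n > c"
  using iter_c_neq_c[of n] by simp

lemma cs_less_c1: "n \<ge> 1 \<Longrightarrow> cs (Suc n) < f c"
  using iter_c_neq_c[of n] iter_c_in[of n] f_less_left[of "cs n" c] f_less_right[of c "cs n"]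
  by (force simp: neq_iff)

lemma cs_le_c1: "n \<ge> 1 \<Longrightarrow> cs n \<le> f c"
  using cs_less_c1[of "n - 1"] by (cases n rule: nat.exhaust; cases "n = 1") auto

section \<open>Images of monotone branches\<close>

text \<open>\<open>f\<close> maps the interval from \<open>x1\<close> to \<open>f c\<close> onto the
  one from \<open>f (f c)\<close> to \<open>c\<close>. These are the two intervals one of which lies
  in every branch image.\<close>

definition x1 :: real where "x1 = (SOME x. c < x \<and> x < f c \<and> f x = c)"

lemma x1: "c < x1" "x1 < f c" "f x1 = c"
proof -
  have "f c \<le> hi" using iter_c_in[of 1] by simp
  then have "continuous_on {c..f c} f" using lo_less_c by (intro continuous_on_subset[OF f_cont]) auto
  moreover have "f (f c) < c" using c2_less by (simp add: numeral_2_eq_2)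
  ultimately obtain x where x: "c \<le> x" "x \<le> f c" "f x = c"
    using IVT2'[of f "f c" c c] c_less_c1 by auto
  have "x \<noteq> c" "x \<noteq> f c" using x c_less_c1 \<open>f (f c) < c\<close> by auto
  then have "c < x \<and> x < f c \<and> f x = c" using x by auto
  then have "c < x1 \<and> x1 < f c \<and> f x1 = c" unfolding x1_def by (rule someI)
  then show "c < x1" "x1 < f c" "f x1 = c" by auto
qed

lemma c1_le_hi: "f c \<le> hi" using iter_c_in[of 1] by simp

text \<open>\<open>f\<close> maps the interval from \<open>u\<close> to \<open>c\<close> onto the
  one from \<open>x1\<close> to \<open>f c\<close>, whose interior the critical orbit avoids right
  after a cutting time. Hence the gap in \<open>cs_gap\<close>.\<close>

definition u :: real where "u = (SOME x. lo < x \<and> x < c \<and> f x = x1)"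

lemma u: "lo < u" "u < c" "f u = x1"
proof -
  have "continuous_on {lo..c} f" using c_less_hi by (intro continuous_on_subset[OF f_cont]) auto
  then obtain x where x: "lo \<le> x" "x \<le> c" "f x = x1"
    using IVT'[of f lo x1 c] x1 lo_less_c f_lo by auto
  have "x \<noteq> lo" "x \<noteq> c" using x x1 f_lo lo_less_c by auto
  then have "lo < x \<and> x < c \<and> f x = x1" using x by auto
  then have "lo < u \<and> u < c \<and> f u = x1" unfolding u_def by (rule someI)
  then show "lo < u" "u < c" "f u = x1" by auto
qed

text \<open>If the next time is cutting too, the point is to the left of \<open>c\<close>. If not,
  the time after that is cutting and its point is to the right of \<open>c\<close>, whereas
  \<open>f\<close> sends everything beyond \<open>x1\<close> to the left of
  \<open>c\<close>.\<close>

lemma cut_imp_le_x1: assumes "n \<ge> 1" "cut n" shows "cs (Suc n) \<le> x1"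
proof (cases "cut (Suc n)")
  case True
  then have "cs (Suc n) < c" using cs_side_aux(2)[of "Suc n"] assms by simp
  then show ?thesis using x1 by simp
next
  case False
  then have 1: "cs (Suc n) > c" using cs_side_aux(1)[of "Suc n"] by simp
  have "cut (Suc (Suc n))" using False cut_Suc by simp
  then have 2: "cs (Suc (Suc n)) > c" using cs_side_aux(3)[of "Suc (Suc n)"] False by simp
  show ?thesis
  proof (rule ccontr)
    assume "\<not> cs (Suc n) \<le> x1"
    then have "f (cs (Suc n)) < f x1" using x1 iter_c_in[of "Suc n"] by (intro f_less_right) auto
    then show False using 2 x1 by simp
  qed
qed

lemma cs_gap: assumes "n \<ge> 1" shows "cs n \<notin> {u<..<c}"
proof
  assume A: "cs n \<in> {u<..<c}"
  then have "cut n" using cs_side_aux[OF assms] by (metis greaterThanLessThan_iff less_asym')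
  then have "f (cs n) \<le> f u" using cut_imp_le_x1[OF assms] u by simp
  moreover have "f u < f (cs n)" using A u by (intro f_less_left) auto
  ultimately show False by simp
qed

text \<open>The endpoints of the images of the maximal monotone branches of the iterates.\<close>

definition tower :: "real \<Rightarrow> real \<Rightarrow> bool" where
  "tower s t \<longleftrightarrow> s = lo \<and> t = f c \<or> (\<exists>n\<ge>1. cut n \<and> s = cs (Suc n) \<and> t = f c)
     \<or> (\<exists>n\<ge>1. \<not> cut n \<and> s = f (f c) \<and> t = cs (Suc n))"

lemma cut_Suc_greater: "n \<ge> 1 \<Longrightarrow> \<not> cut n \<Longrightarrow> cs (Suc n) > c"
  using cs_side_aux(3)[of "Suc n"] cut_Suc by simp

lemma tower_cases:
  assumes "tower s t"
  obtains "s \<le> x1" "t = f c" | "s = f (f c)" "c < t"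
  using assms x1 lo_less_c cut_imp_le_x1 cut_Suc_greater unfolding tower_def by fastforce

lemma tower_bounds:
  assumes "tower s t" shows "lo \<le> s" "s < t" "t \<le> f c"
proof -
  have c2: "f (f c) < c" using c2_less by (simp add: numeral_2_eq_2)
  show "s < t" using assms
    by (cases rule: tower_cases) (use x1 c2 in auto)
  show "lo \<le> s"
    using assms iter_c_in[of "Suc n" for n] iter_c_in[of 2] unfolding tower_def
    by (auto simp: numeral_2_eq_2)
  show "t \<le> f c"
    using assms cs_le_c1[of "Suc n" for n] unfolding tower_def by auto
qed

text \<open>The family of endpoint pairs is closed under cutting at \<open>c\<close>: an endpoint
  c_{n+1} that occurs here always belongs to a cutting time n + 1, so its image together with
  \<open>f c\<close> is a pair of the second kind.\<close>

lemma tower_split: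
  assumes "tower s t" "s < c" "c < t" shows "tower (f s) (f c)" "tower (f t) (f c)"
proof -
  have 1: "tower (f (f c)) (f c)" using cut_1 unfolding tower_def by (auto intro!: exI[of _ 1])
  have 2: "tower (f (f (f c))) (f c)"
    using cut_2 unfolding tower_def by (auto intro!: exI[of _ 2] simp: numeral_2_eq_2)
  have 3: "tower (f (cs (Suc n))) (f c)" if "n \<ge> 1" "\<not> cut n \<or> cs (Suc n) < c" for n
  proof -
    have "cut (Suc n)" using that cut_Suc[of n] cs_side_aux(1)[of "Suc n"] by force
    then show ?thesis unfolding tower_def by (intro disjI2 disjI1 exI[of _ "Suc n"]) auto
  qed
  consider "s = lo" "t = f c" | n where "n \<ge> 1" "s = cs (Suc n)" "t = f c"
    | n where "n \<ge> 1" "\<not> cut n" "s = f (f c)" "t = cs (Suc n)"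
    using assms(1) unfolding tower_def by blast
  then have "tower (f s) (f c) \<and> tower (f t) (f c)"
  proof cases
    case 1
    then show ?thesis using \<open>tower (f (f c)) (f c)\<close> by (simp add: f_lo tower_def)
  next
    case (2 n)
    then show ?thesis using 1 3[of n] assms(2) by blast
  next
    case (3 n)
    then show ?thesis using \<open>tower (f (f (f c))) (f c)\<close> \<open>\<And>n. n \<ge> 1 \<Longrightarrow> \<not> cut n \<or> cs (Suc n) < c \<Longrightarrow> tower (f (cs (Suc n))) (f c)\<close> by blast
  qed
  then show "tower (f s) (f c)" "tower (f t) (f c)" by auto
qed

text \<open>Only a pair with s = c_{n+1} > c and n cutting fails to enclose \<open>c\<close>. Then n
  + 1 is not cutting, and the image is a pair of the third kind.\<close>

lemma tower_no_split:
  assumes "tower s t" "\<not> (s < c \<and> c < t)" shows "c < s" "tower (f t) (f s)"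
proof -
  have c2: "f (f c) < c" using c2_less by (simp add: numeral_2_eq_2)
  obtain n where n: "n \<ge> 1" "cut n" "s = cs (Suc n)" "t = f c"
    using assms lo_less_c c_less_c1 c2 cut_Suc_greater unfolding tower_def by blast
  have "\<not> cs (Suc n) < c" using n assms(2) c_less_c1 by auto
  then have g: "cs (Suc n) > c" using cs_greater[of "Suc n"] by simp
  then show "c < s" using n by simp
  have "\<not> cut (Suc n)" using cs_side_aux(2)[of "Suc n"] n g by force
  then show "tower (f t) (f s)" using n unfolding tower_def by (intro disjI2 exI[of _ "Suc n"]) auto
qed

text \<open>Forbidding one fixed gap along the whole orbit makes the set closed and forward
  invariant, and it contains every endpoint of a branch image by \<open>tower_K\<close>.\<close>

definition K :: "real set" where "K = {x \<in> {lo..hi}. \<forall>n. (f ^^ n) x \<notin> {u<..<c}}"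

lemma K_subset: "K \<subseteq> {lo..hi}" by (auto simp: K_def)

lemma K_iter: "x \<in> K \<Longrightarrow> (f ^^ n) x \<in> K"
  unfolding K_def using iter_in[of x n] by (auto simp flip: funpow_add[THEN fun_cong, unfolded comp_apply])

lemma closed_K: "closed K"
proof -
  have "K = (\<Inter>n. {lo..hi} \<inter> (f ^^ n) -` (- {u<..<c}))" by (auto simp: K_def)
  moreover have c: "closed ({lo..hi} \<inter> (f ^^ n) -` (- {u<..<c}))" for n
    by (rule continuous_closed_preimage[OF iter_cont]) (auto simp: closed_def)
  ultimately show ?thesis by (metis (no_types, lifting) closed_INT)
qed

lemma tower_K: assumes "tower s t" shows "s \<in> K" "t \<in> K"
proof -
  have "cs n \<in> K" if "n \<ge> 1" for n
    unfolding K_def using that cs_gap[of "m + n" for m] iter_c_in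
    by (auto simp: funpow_add)
  note this[of 1, simplified] this[of 2, simplified numeral_2_eq_2] this[of "Suc n" for n]
  moreover have "lo \<in> K" using iter_lo u lo_less_c c_less_hi by (auto simp: K_def)
  ultimately show "s \<in> K" "t \<in> K" using assms unfolding tower_def by auto
qed

text \<open>An image of the one type contains the gap from \<open>u\<close> to \<open>c\<close>
  itself; an image of the other type contains its preimage between \<open>x1\<close> and
  \<open>y\<close>. Taking a quarter of the gap leaves a margin \<open>g\<close> on both sides, so
  that the interval lies in the part of the image where distortion is controlled.\<close>

lemma tower_gap:
  obtains g where "g > 0"
    "\<And>s t. tower s t \<Longrightarrow> \<exists>z. s + g \<le> z \<and> z + 2 * g \<le> t \<and> {z..z + g} \<inter> K = {}"
proof -
  have c2: "f (f c) < c" using c2_less by (simp add: numeral_2_eq_2)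
  have c2u: "f (f c) \<le> u" using cs_gap[of 2] c2 by (auto simp: numeral_2_eq_2)
  have "continuous_on {x1..f c} f" using lo_less_c x1 c1_le_hi by (intro continuous_on_subset[OF f_cont]) auto
  then obtain y where y: "x1 \<le> y" "y \<le> f c" "f y = u"
    using IVT2'[of f "f c" u x1] x1 c2u u by auto
  have "y \<noteq> x1" using y x1 u by auto
  then have y1: "x1 < y" using y by simp
  define g where "g = min (y - x1) (c - u) / 4"
  have g: "g > 0" "4 * g \<le> y - x1" "4 * g \<le> c - u" using y1 u by (auto simp: g_def)
  show thesis
  proof (rule that[OF g(1)])
    fix s t assume "tower s t"
    then show "\<exists>z. s + g \<le> z \<and> z + 2 * g \<le> t \<and> {z..z + g} \<inter> K = {}"
    proof (cases rule: tower_cases)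
      case 1
      have "x \<notin> K" if "x \<in> {x1 + g..x1 + g + g}" for x
      proof -
        have "f y < f x" "f x < f x1" using that g x1 y c1_le_hi by (intro f_less_right; force)+
        then have "(f ^^ 1) x \<in> {u<..<c}" using y x1 by simp
        then show ?thesis unfolding K_def by blast
      qed
      then show ?thesis using 1 g y by (intro exI[of _ "x1 + g"]) auto
    next
      case 2
      have "x \<notin> K" if "x \<in> {u + g..u + g + g}" for x
      proof -
        have "(f ^^ 0) x \<in> {u<..<c}" using that g by auto
        then show ?thesis unfolding K_def by blast
      qed
      then show ?thesis using 2 g c2u by (intro exI[of _ "u + g"]) auto
    qed
  qed
qed

end

section \<open>Monotone branches of the iterates\<close>

context sturmian_map
begin

text \<open>The maximal intervals of monotonicity of \<open>f ^^ n\<close>. Building them by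
  successive cuts at preimages of \<open>c\<close> lets the shape of their images be carried along
  by \<open>tower_split\<close> and \<open>tower_no_split\<close>.\<close>

inductive branch :: "nat \<Rightarrow> real \<Rightarrow> real \<Rightarrow> bool" where
  branch_0: "branch 0 lo hi"
| branch_keep: "branch n a b \<Longrightarrow> (\<And>x. a < x \<Longrightarrow> x < b \<Longrightarrow> (f ^^ n) x \<noteq> c) \<Longrightarrow> branch (Suc n) a b"
| branch_left: "branch n a b \<Longrightarrow> a < z \<Longrightarrow> z < b \<Longrightarrow> (f ^^ n) z = c \<Longrightarrow> branch (Suc n) a z"
| branch_right: "branch n a b \<Longrightarrow> a < z \<Longrightarrow> z < b \<Longrightarrow> (f ^^ n) z = c \<Longrightarrow> branch (Suc n) z b"

definition smono :: "real \<Rightarrow> real \<Rightarrow> (real \<Rightarrow> real) \<Rightarrow> bool" where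
  "smono a b g \<longleftrightarrow> strict_mono_on {a..b} g \<or> strict_antimono_on {a..b} g"

lemma smono_cases:
  assumes "smono a b g"
  obtains "\<And>x y. a \<le> x \<Longrightarrow> x < y \<Longrightarrow> y \<le> b \<Longrightarrow> g x < g y"
  | "\<And>x y. a \<le> x \<Longrightarrow> x < y \<Longrightarrow> y \<le> b \<Longrightarrow> g y < g x"
  using assms unfolding smono_def monotone_on_def by auto

lemma smono_inj: "smono a b g \<Longrightarrow> x \<in> {a..b} \<Longrightarrow> y \<in> {a..b} \<Longrightarrow> g x = g y \<Longrightarrow> x = y"
  by (rule ccontr, erule smono_cases) (force simp: neq_iff)+

lemma smono_between:
  assumes "smono a b g" "a \<le> x" "x \<le> y" "y \<le> z" "z \<le> b"
  shows "\<bar>g z - g x\<bar> = \<bar>g z - g y\<bar> + \<bar>g y - g x\<bar>"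
  using assms(1)
proof (cases rule: smono_cases)
  case 1
  have "g x \<le> g y" "g y \<le> g z" using 1[of x y] 1[of y z] assms by (auto simp: le_less)
  then show ?thesis by simp
next
  case 2
  have "g x \<ge> g y" "g y \<ge> g z" using 2[of x y] 2[of y z] assms by (auto simp: le_less)
  then show ?thesis by simp
qed

lemma smono_split:
  assumes "smono a b g" "a < z" "z < b"
  shows "min (g a) (g b) < g z" "g z < max (g a) (g b)" "g a \<noteq> g z" "g b \<noteq> g z"
proof -
  have "min (g a) (g b) < g z \<and> g z < max (g a) (g b)"
    using assms(1)
  proof (cases rule: smono_cases)
    case 1
    then have "g a < g z" "g z < g b" using assms by auto
    then show ?thesis by auto
  next
    case 2
    then have "g z < g a" "g b < g z" using assms by auto
    then show ?thesis by auto
  qed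
  then show "min (g a) (g b) < g z" "g z < max (g a) (g b)" "g a \<noteq> g z" "g b \<noteq> g z"
    using smono_inj[OF assms(1), of a z] smono_inj[OF assms(1), of b z] assms by auto
qed

lemma smono_step:
  assumes m: "smono a b (f ^^ n)" and cr: "expands_cross_ratio {a..b} (f ^^ n)"
    and ab: "lo \<le> a" "a \<le> a'" "a' \<le> b'" "b' \<le> b" "b \<le> hi"
    and side: "(f ^^ n) a' \<le> c \<and> (f ^^ n) b' \<le> c \<or> c \<le> (f ^^ n) a' \<and> c \<le> (f ^^ n) b'"
  shows "smono a' b' (f ^^ Suc n) \<and> expands_cross_ratio {a'..b'} (f ^^ Suc n)"
proof -
  define g where "g = f ^^ n"
  have m': "smono a' b' g"
    using m ab monotone_on_subset[of "{a..b}" _ _ g "{a'..b'}"] unfolding smono_def g_def by auto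
  have cr': "expands_cross_ratio {a'..b'} g"
    using cr ab unfolding g_def by (auto intro: expands_cross_ratio_subset)
  have hull: "g x \<in> {min (g a') (g b')..max (g a') (g b')}" if "x \<in> {a'..b'}" for x
    using m'
  proof (cases rule: smono_cases)
    case 1
    then have "g a' \<le> g x" "g x \<le> g b'" using that by (auto simp: le_less)
    then show ?thesis by auto
  next
    case 2
    then have "g a' \<ge> g x" "g x \<ge> g b'" using that by (auto simp: le_less)
    then show ?thesis by auto
  qed
  have in_I: "g x \<in> {lo..hi}" if "x \<in> {a'..b'}" for x
    unfolding g_def using that ab by (intro iter_in) auto
  have "g ` {a'..b'} \<subseteq> {lo..c} \<or> g ` {a'..b'} \<subseteq> {c..hi}"
    using side hull in_I unfolding g_def[symmetric] by (fastforce simp: min_le_iff_disj le_max_iff_disj)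
  then obtain T where T: "g ` {a'..b'} \<subseteq> T" "T = {lo..c} \<or> T = {c..hi}" by blast
  have fT: "expands_cross_ratio T f" "strict_mono_on T f \<or> strict_antimono_on T f"
    using T(2) expands_left expands_right f_left f_right by auto
  have "expands_cross_ratio {a'..b'} (f \<circ> g)"
    using expands_cross_ratio_compose[OF cr' fT(1) T(1)] m' unfolding smono_def by blast
  moreover have "smono a' b' (f \<circ> g)"
    using m' fT(2) T(1) unfolding smono_def monotone_on_def by (auto simp: image_subset_iff)
  ultimately show ?thesis by (simp add: g_def)
qed

text \<open>At time 0 the image is all of \<open>{lo..hi}\<close> and is treated separately:
  \<open>f\<close> sends both of its ends to \<open>lo\<close>, which gives the first kind of
  pair.\<close>

lemma cut_tower:
  assumes sm: "smono a b (f ^^ n)" and z: "a < z" "z < b" "(f ^^ n) z = c" and e: "e = a \<or> e = b"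
    and tower: "n \<ge> 1 \<Longrightarrow> tower (min ((f ^^ n) a) ((f ^^ n) b)) (max ((f ^^ n) a) ((f ^^ n) b))"
    and 0: "n = 0 \<Longrightarrow> a = lo \<and> b = hi"
  shows "tower (f ((f ^^ n) e)) (f c)"
proof (cases "n = 0")
  case True
  then show ?thesis using 0 e f_lo f_hi by (auto simp: tower_def)
next
  case False
  define s t where "s = min ((f ^^ n) a) ((f ^^ n) b)" and "t = max ((f ^^ n) a) ((f ^^ n) b)"
  have "tower s t" using tower False by (simp add: s_def t_def)
  moreover have "s < c" "c < t" using smono_split[OF sm z(1,2)] z(3) by (simp_all add: s_def t_def)
  moreover have "(f ^^ n) e = s \<or> (f ^^ n) e = t" using e by (auto simp: s_def t_def)
  ultimately show ?thesis using tower_split by metis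
qed

lemma branch_invariant:
  assumes "branch n a b"
  shows "lo \<le> a \<and> a < b \<and> b \<le> hi \<and> smono a b (f ^^ n) \<and> expands_cross_ratio {a..b} (f ^^ n)
    \<and> (n \<ge> 1 \<longrightarrow> tower (min ((f ^^ n) a) ((f ^^ n) b)) (max ((f ^^ n) a) ((f ^^ n) b)))"
  using assms
proof induction
  case branch_0
  have "smono lo hi (f ^^ 0)" unfolding smono_def by (auto simp: monotone_on_def)
  moreover have "expands_cross_ratio {lo..hi} (f ^^ 0)"
    unfolding expands_cross_ratio_def by (auto simp: mult_ac)
  ultimately show ?case using lo_less_c c_less_hi by (simp add: id_def)
next
  case (branch_keep n a b)
  define s t where "s = min ((f ^^ n) a) ((f ^^ n) b)" and "t = max ((f ^^ n) a) ((f ^^ n) b)"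
  have cont: "continuous_on {a..b} (f ^^ n)" using branch_keep by (intro continuous_on_subset[OF iter_cont]) auto
  \<comment> \<open>The initial interval contains \<open>c\<close> in its interior, so it cannot be
    kept uncut.\<close>
  have n: "n \<ge> 1" using branch_keep lo_less_c c_less_hi
    by (cases n) (auto elim: branch.cases)
  have no: "\<not> (s < c \<and> c < t)"
  proof
    assume st: "s < c \<and> c < t"
    then have "\<exists>x. a \<le> x \<and> x \<le> b \<and> (f ^^ n) x = c"
      using IVT'[OF _ _ _ cont, of c] IVT2'[OF _ _ _ cont, of c] branch_keep
      by (auto simp: s_def t_def min_def max_def split: if_splits)
    then obtain x where x: "a \<le> x" "x \<le> b" "(f ^^ n) x = c" by blast
    then have "x \<noteq> a" "x \<noteq> b" using st by (auto simp: s_def t_def)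
    then show False using branch_keep x by force
  qed
  have tower: "tower s t" using branch_keep n by (simp add: s_def t_def)
  note ns = tower_no_split[OF tower no]
  have st: "s < t" using tower_bounds[OF tower] by simp
  have "t \<le> hi" using tower_bounds[OF tower] c1_le_hi by simp
  then have "f t < f s" using ns st by (intro f_less_right) auto
  then have "min ((f ^^ Suc n) a) ((f ^^ Suc n) b) = f t" "max ((f ^^ Suc n) a) ((f ^^ Suc n) b) = f s"
    unfolding s_def t_def by (auto simp: min_def max_def split: if_splits)
  moreover have "smono a b (f ^^ Suc n) \<and> expands_cross_ratio {a..b} (f ^^ Suc n)"
    using branch_keep ns(1) by (intro smono_step[of a b]) (auto simp: s_def)
  ultimately show ?case using ns(2) branch_keep by (simp add: comp_def)
next
  case (branch_left n a b z)
  have "smono a z (f ^^ Suc n) \<and> expands_cross_ratio {a..z} (f ^^ Suc n)"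
    using branch_left by (intro smono_step[of a b]) auto
  moreover have "tower (f ((f ^^ n) a)) (f c)"
  proof (rule cut_tower[OF _ branch_left(2-4)])
    show "n = 0 \<Longrightarrow> a = lo \<and> b = hi" using branch_left(1) by (auto elim: branch.cases)
  qed (use branch_left in auto)
  moreover from this have "f ((f ^^ n) a) < f c" using tower_bounds by blast
  ultimately show ?case using branch_left by (simp add: comp_def min_def max_def)
next
  case (branch_right n a b z)
  have "smono z b (f ^^ Suc n) \<and> expands_cross_ratio {z..b} (f ^^ Suc n)"
    using branch_right by (intro smono_step[of a b]) auto
  moreover have "tower (f ((f ^^ n) b)) (f c)"
  proof (rule cut_tower[OF _ branch_right(2-4)])
    show "n = 0 \<Longrightarrow> a = lo \<and> b = hi" using branch_right(1) by (auto elim: branch.cases)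
  qed (use branch_right in auto)
  moreover from this have "f ((f ^^ n) b) < f c" using tower_bounds by blast
  ultimately show ?case using branch_right by (simp add: comp_def min_def max_def)
qed

lemma branch_bounds: "branch n a b \<Longrightarrow> lo \<le> a" "branch n a b \<Longrightarrow> a < b" "branch n a b \<Longrightarrow> b \<le> hi"
  and branch_smono: "branch n a b \<Longrightarrow> smono a b (f ^^ n)"
  and branch_expands: "branch n a b \<Longrightarrow> expands_cross_ratio {a..b} (f ^^ n)"
  and branch_tower: "branch n a b \<Longrightarrow> n \<ge> 1 \<Longrightarrow>
    tower (min ((f ^^ n) a) ((f ^^ n) b)) (max ((f ^^ n) a) ((f ^^ n) b))"
  using branch_invariant by blast+

lemma branch_parent:
  assumes "branch (Suc n) a b"
  obtains a' b' where "branch n a' b'" "a' \<le> a" "b \<le> b'"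
    "a = a' \<or> a' < a \<and> a < b' \<and> (f ^^ n) a = c" "b = b' \<or> a' < b \<and> b < b' \<and> (f ^^ n) b = c"
    "\<And>x. a < x \<Longrightarrow> x < b \<Longrightarrow> (f ^^ n) x \<noteq> c"
  using assms
proof cases
  case branch_keep
  then show ?thesis using that by auto
next
  case (branch_left b')
  have "(f ^^ n) x \<noteq> c" if "a < x" "x < b" for x
    using smono_inj[OF branch_smono[OF branch_left(1)], of x b] that branch_left by auto
  then show ?thesis using that[of a b'] branch_left by auto
next
  case (branch_right a')
  have "(f ^^ n) x \<noteq> c" if "a < x" "x < b" for x
    using smono_inj[OF branch_smono[OF branch_right(1)], of x a] that branch_right by auto
  then show ?thesis using that[of a' b] branch_right by auto
qed

lemma branch_no_c:
  assumes "branch n a b" "i < n" "a < x" "x < b" shows "(f ^^ i) x \<noteq> c"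
  using assms
proof (induction n arbitrary: a b)
  case (Suc n)
  obtain a' b' where p: "branch n a' b'" "a' \<le> a" "b \<le> b'" "\<And>x. a < x \<Longrightarrow> x < b \<Longrightarrow> (f ^^ n) x \<noteq> c"
    using branch_parent[OF Suc.prems(1)] by metis
  show ?case
    using Suc.IH[OF p(1)] p Suc.prems by (cases "i = n") auto
qed simp

lemma branch_unique:
  assumes "branch n a b" "branch n a' b'" "a < x" "x < b" "a' < x" "x < b'"
  shows "a = a' \<and> b = b'"
  using assms
proof (induction n arbitrary: a b a' b')
  case 0
  then show ?case by (auto elim: branch.cases)
next
  case (Suc n)
  obtain A B where p: "branch n A B" "A \<le> a" "b \<le> B"
    "a = A \<or> A < a \<and> a < B \<and> (f ^^ n) a = c" "b = B \<or> A < b \<and> b < B \<and> (f ^^ n) b = c"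
    "\<And>x. a < x \<Longrightarrow> x < b \<Longrightarrow> (f ^^ n) x \<noteq> c"
    by (rule branch_parent[OF Suc.prems(1)]) (rule that; assumption)
  obtain A' B' where p': "branch n A' B'" "A' \<le> a'" "b' \<le> B'"
    "a' = A' \<or> A' < a' \<and> a' < B' \<and> (f ^^ n) a' = c" "b' = B' \<or> A' < b' \<and> b' < B' \<and> (f ^^ n) b' = c"
    "\<And>x. a' < x \<Longrightarrow> x < b' \<Longrightarrow> (f ^^ n) x \<noteq> c"
    by (rule branch_parent[OF Suc.prems(2)]) (rule that; assumption)
  have "A = A'" "B = B'" using Suc.IH[OF p(1) p'(1)] p p' Suc.prems by auto
  have "\<not> a < a'" using p(6)[of a'] p'(4) p(2) Suc.prems(3-6) unfolding \<open>A = A'\<close> by auto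
  moreover have "\<not> a' < a" using p'(6)[of a] p(4) p'(2) Suc.prems(3-6) unfolding \<open>A = A'\<close> by auto
  moreover have "\<not> b < b'" using p'(6)[of b] p(5) p'(3) Suc.prems(3-6) unfolding \<open>B = B'\<close> by auto
  moreover have "\<not> b' < b" using p(6)[of b'] p'(5) p(3) Suc.prems(3-6) unfolding \<open>B = B'\<close> by auto
  ultimately show ?case by simp
qed

lemma branch_exists:
  assumes "x \<in> {lo<..<hi}" "\<And>i. i < n \<Longrightarrow> (f ^^ i) x \<noteq> c"
  obtains a b where "branch n a b" "a < x" "x < b"
proof -
  have "\<exists>a b. branch n a b \<and> a < x \<and> x < b"
    using assms(2)
  proof (induction n)
    case 0
    then show ?case using branch_0 assms(1) by auto
  next
    case (Suc n)
    then obtain a b where ab: "branch n a b" "a < x" "x < b" by auto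
    have xc: "(f ^^ n) x \<noteq> c" using Suc.prems by simp
    show ?case
    proof (cases "\<exists>z. a < z \<and> z < b \<and> (f ^^ n) z = c")
      case True
      then obtain z where z: "a < z" "z < b" "(f ^^ n) z = c" by blast
      then have "x \<noteq> z" using xc by auto
      then show ?thesis using branch_left[OF ab(1) z] branch_right[OF ab(1) z] ab by (metis linorder_neqE)
    next
      case False
      then show ?thesis using branch_keep[OF ab(1)] ab by blast
    qed
  qed
  then show thesis using that by blast
qed

lemma finite_branches: "finite {(a, b). branch n a b}"
proof (induction n)
  case 0
  have "{(a, b). branch 0 a b} \<subseteq> {(lo, hi)}" by (auto elim: branch.cases)
  then show ?case using finite_subset by blast
next
  case (Suc n)
  define Z where "Z a b = {z. a < z \<and> z < b \<and> (f ^^ n) z = c}" for a b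
  have Z: "finite (Z a b)" if "branch n a b" for a b
  proof (cases "\<exists>w. w \<in> Z a b")
    case True
    then obtain w where w: "w \<in> Z a b" by blast
    have "Z a b \<subseteq> {w}" using w smono_inj[OF branch_smono[OF that]] by (force simp: Z_def)
    then show ?thesis using finite_subset by blast
  next
    case False
    then have "Z a b = {}" by blast
    then show ?thesis by simp
  qed
  have "{(a, b). branch (Suc n) a b} \<subseteq>
      (\<Union>(a, b)\<in>{(a, b). branch n a b}. {(a, b)} \<union> Pair a ` Z a b \<union> (\<lambda>z. (z, b)) ` Z a b)"
  proof clarify
    fix a b assume "branch (Suc n) a b"
    then show "(a, b) \<in> (\<Union>(a, b)\<in>{(a, b). branch n a b}. {(a, b)} \<union> Pair a ` Z a b \<union> (\<lambda>z. (z, b)) ` Z a b)"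
    proof cases
      case branch_keep
      then show ?thesis by blast
    next
      case (branch_left b')
      then have "b \<in> Z a b'" by (simp add: Z_def)
      then show ?thesis using branch_left(1) by blast
    next
      case (branch_right a')
      then have "a \<in> Z a' b" by (simp add: Z_def)
      then show ?thesis using branch_right(1) by blast
    qed
  qed
  moreover have "finite (\<Union>(a, b)\<in>{(a, b). branch n a b}. {(a, b)} \<union> Pair a ` Z a b \<union> (\<lambda>z. (z, b)) ` Z a b)"
    using Suc Z by auto
  ultimately show ?case by (rule finite_subset)
qed

lemma branch_Suc:
  assumes "branch n a b" "branch (Suc n) a' b'" "a < x" "x < b" "a' < x" "x < b'"
  shows "a' = a \<or> a < a' \<and> (f ^^ n) a' = c" "b' = b \<or> b' < b \<and> (f ^^ n) b' = c" "a \<le> a'" "b' \<le> b"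
proof -
  obtain A B where p: "branch n A B" "A \<le> a'" "b' \<le> B"
    "a' = A \<or> A < a' \<and> a' < B \<and> (f ^^ n) a' = c" "b' = B \<or> A < b' \<and> b' < B \<and> (f ^^ n) b' = c"
    by (rule branch_parent[OF assms(2)]) (rule that; assumption)
  have "A = a \<and> B = b"
    by (rule branch_unique[OF p(1) assms(1) _ _ assms(3,4)]) (use p(2,3) assms(5,6) in linarith)+
  then show "a' = a \<or> a < a' \<and> (f ^^ n) a' = c" "b' = b \<or> b' < b \<and> (f ^^ n) b' = c" "a \<le> a'" "b' \<le> b"
    using p by auto
qed

section \<open>Homtervals and the points to which branches shrink\<close>

definition homterval :: "real \<Rightarrow> real \<Rightarrow> bool" where
  "homterval p q \<longleftrightarrow> lo \<le> p \<and> p < q \<and> q \<le> hi \<and> (\<forall>n x. p < x \<longrightarrow> x < q \<longrightarrow> (f ^^ n) x \<noteq> c)"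

text \<open>A point inside a homterval is also an endpoint of smaller ones, so it is enough to
  exclude endpoints.\<close>

definition good :: "real \<Rightarrow> bool" where
  "good x \<longleftrightarrow> x \<in> {lo<..<hi} \<and> (\<forall>n. (f ^^ n) x \<noteq> c) \<and> (\<forall>p. \<not> homterval p x) \<and> (\<forall>q. \<not> homterval x q)"

lemma good_branch_exists:
  assumes "good x" obtains a b where "branch n a b" "a < x" "x < b"
  using branch_exists[of x n] assms unfolding good_def by blast

text \<open>Since no homterval ends or starts at \<open>x\<close>, there are preimages of
  \<open>c\<close> within distance \<open>e\<close> on both sides. Branches of later iterates do not
  contain them.\<close>

lemma good_branch_shrinks:
  assumes x: "good x" and e: "e > 0"
  obtains N where "\<And>n a b. n \<ge> N \<Longrightarrow> branch n a b \<Longrightarrow> a < x \<Longrightarrow> x < b \<Longrightarrow> x - e < a \<and> b < x + e"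
proof -
  have lx: "lo < x" "x < hi" using x by (auto simp: good_def)
  have "\<not> homterval (max lo (x - e)) x" "\<not> homterval x (min hi (x + e))" using x by (auto simp: good_def)
  then obtain i y j z where yz: "max lo (x - e) < y" "y < x" "(f ^^ i) y = c"
      "x < z" "z < min hi (x + e)" "(f ^^ j) z = c"
    unfolding homterval_def using lx e by auto
  show thesis
  proof (rule that[of "Suc (max i j)"])
    fix n a b assume A: "Suc (max i j) \<le> n" "branch n a b" "a < x" "x < b"
    have "i < n" "j < n" "y < b" "a < z" using A yz by auto
    then have "\<not> a < y" "\<not> z < b"
      using branch_no_c[OF A(2), of i y] branch_no_c[OF A(2), of j z] yz(3,6) by auto
    then show "x - e < a \<and> b < x + e" using yz by auto
  qed
qed

lemma tower_length: obtains \<eta> where "\<eta> > 0" "\<And>s t. tower s t \<Longrightarrow> \<eta> \<le> t - s"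
proof -
  define \<eta> where "\<eta> = min (f c - x1) (c - f (f c))"
  have "\<eta> > 0" using x1 c2_less by (simp add: \<eta>_def numeral_2_eq_2)
  moreover have "\<eta> \<le> t - s" if "tower s t" for s t
    using that by (cases rule: tower_cases) (auto simp: \<eta>_def)
  ultimately show thesis using that by blast
qed

text \<open>If the orbit of \<open>x\<close> stays close to the boundary of the branch images, then it follows the image of
  one fixed endpoint forever, because the images are long and only get cut far from their endpoints.
  The interval between \<open>x\<close> and that endpoint is then never cut.\<close>

lemma good_large_margins:
  obtains \<delta> where "\<delta> > 0"
    "\<And>x N. good x \<Longrightarrow> \<exists>n\<ge>N. \<exists>a b. branch n a b \<and> a < x \<and> x < b \<and>
        \<delta> \<le> \<bar>(f ^^ n) x - (f ^^ n) a\<bar> \<and> \<delta> \<le> \<bar>(f ^^ n) b - (f ^^ n) x\<bar>"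
proof -
  obtain \<eta> where \<eta>: "\<eta> > 0" "\<And>s t. tower s t \<Longrightarrow> \<eta> \<le> t - s" using tower_length by metis
  \<comment> \<open>Chosen so that a margin at most \<open>L * \<delta>\<close> on one side leaves
    more than \<delta> on the other, since images have length at least \<eta>.\<close>
  define \<delta> where "\<delta> = \<eta> / (L + 2)"
  have \<delta>: "\<delta> > 0" "L * \<delta> < \<eta>" "(L + 1) * \<delta> < \<eta>" using \<eta>(1) L(1) by (simp_all add: \<delta>_def field_simps)
  show thesis
  proof (rule that[OF \<delta>(1)], rule ccontr)
    fix x N
    assume x: "good x" and contra: "\<not> (\<exists>n\<ge>N. \<exists>a b. branch n a b \<and> a < x \<and> x < b \<and>
        \<delta> \<le> \<bar>(f ^^ n) x - (f ^^ n) a\<bar> \<and> \<delta> \<le> \<bar>(f ^^ n) b - (f ^^ n) x\<bar>)"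
    have "\<exists>a b. branch n a b \<and> a < x \<and> x < b" for n using good_branch_exists[OF x] by metis
    then obtain a b where ab: "\<And>n. branch n (a n) (b n)" "\<And>n. a n < x" "\<And>n. x < b n" by metis
    define d where "d e n = \<bar>(f ^^ n) x - (f ^^ n) (e n)\<bar>" for e :: "nat \<Rightarrow> real" and n
    have in_I: "a n \<in> {lo..hi}" "b n \<in> {lo..hi}" "x \<in> {lo..hi}" for n
      using branch_bounds[OF ab(1)[of n]] ab(2,3)[of n] by auto
    have len: "\<eta> \<le> d a n + d b n" if "n \<ge> 1" for n
    proof -
      have "\<eta> \<le> \<bar>(f ^^ n) (b n) - (f ^^ n) (a n)\<bar>"
        using \<eta>(2)[OF branch_tower[OF ab(1)[of n] that]] by linarith
      also have "\<dots> = d a n + d b n"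
        using smono_between[OF branch_smono[OF ab(1)[of n]], of "a n" x "b n"] ab(2,3)[of n]
        by (simp add: d_def abs_minus_commute)
      finally show ?thesis .
    qed
    \<comment> \<open>When a branch is cut, the piece at \<open>e\<close> is mapped to an interval
      ending at \<open>f c\<close> of length at least \<eta>. By the Lipschitz bound the image of
      \<open>e\<close> was at distance at least \<open>\<eta> / L\<close> from
      \<open>c\<close>.\<close>
    have far: "\<eta> \<le> L * \<bar>(f ^^ n) e - c\<bar>"
      if n: "n \<ge> 1" and e: "e = a n \<or> e = b n" and z: "a n < z" "z < b n" "(f ^^ n) z = c" for n e z
    proof -
      have "tower (f ((f ^^ n) e)) (f c)"
        using ab(1)[of n] n by (intro cut_tower[OF branch_smono z e]) (auto intro: branch_tower)
      then have "\<eta> \<le> f c - f ((f ^^ n) e)" by (rule \<eta>(2))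
      also have "\<dots> \<le> \<bar>f ((f ^^ n) e) - f c\<bar>" by linarith
      also have "\<dots> \<le> L * \<bar>(f ^^ n) e - c\<bar>"
        using e in_I iter_in lo_less_c c_less_hi by (intro L(2)) auto
      finally show ?thesis .
    qed
    \<comment> \<open>A cut between \<open>e n\<close> and \<open>x\<close> would put
      \<open>c\<close> within \<delta> of the image of \<open>e n\<close>, contrary to
      \<open>far\<close>.\<close>
    have stay: "e (Suc n) = e n" if n: "n \<ge> 1" and e: "e = a \<or> e = b" and small: "d e n < \<delta>" for n e
    proof (rule ccontr)
      assume ne: "e (Suc n) \<noteq> e n"
      have z: "(f ^^ n) (e (Suc n)) = c" "a n < e (Suc n)" "e (Suc n) < b n"
        using e ne branch_Suc[OF ab(1)[of n] ab(1)[of "Suc n"] ab(2)[of n] ab(3)[of n] ab(2)[of "Suc n"] ab(3)[of "Suc n"]]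
          ab(2,3)[of "Suc n"] ab(2,3)[of n] by auto
      have "\<bar>(f ^^ n) (e n) - c\<bar> \<le> d e n"
        using e
      proof
        assume e: "e = a"
        show ?thesis
          using smono_between[OF branch_smono[OF ab(1)[of n]], of "a n" "a (Suc n)" x] z ab(2,3)[of n] ab(2)[of "Suc n"]
          unfolding e d_def by simp
      next
        assume e: "e = b"
        show ?thesis
          using smono_between[OF branch_smono[OF ab(1)[of n]], of x "b (Suc n)" "b n"] z ab(2,3)[of n] ab(3)[of "Suc n"]
          unfolding e d_def by simp
      qed
      then have "L * \<bar>(f ^^ n) (e n) - c\<bar> \<le> L * \<delta>" using small L(1) by (intro mult_left_mono) auto
      moreover have "\<eta> \<le> L * \<bar>(f ^^ n) (e n) - c\<bar>"
        using far[OF n _ z(2,3,1), of "e n"] e by blast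
      ultimately show False using \<delta> by simp
    qed
    define M where "M = max 1 N"
    have contra': "d a n < \<delta> \<or> d b n < \<delta>" if "n \<ge> M" for n
    proof -
      have "n \<ge> N" using that by (simp add: M_def)
      then have "\<not> (\<delta> \<le> \<bar>(f ^^ n) x - (f ^^ n) (a n)\<bar> \<and> \<delta> \<le> \<bar>(f ^^ n) (b n) - (f ^^ n) x\<bar>)"
        using contra ab by blast
      then show ?thesis unfolding d_def by (auto simp: abs_minus_commute)
    qed
    \<comment> \<open>One step enlarges the small margin by at most the factor \<open>L\<close>, so
      the opposite margin stays at least \<delta> and, by \<open>contra'\<close>, the same side is
      again the small one.\<close>
    have main: "e n = e M" if e: "e = a \<and> e' = b \<or> e = b \<and> e' = a" and start: "d e M < \<delta>" and n: "n \<ge> M" for e e' n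
    proof -
      have "e n = e M \<and> d e n < \<delta>"
        using n
      proof (induction n rule: dec_induct)
        case base
        show ?case using start by simp
      next
        case (step n)
        have n1: "n \<ge> 1" using step by (simp add: M_def)
        have same: "e (Suc n) = e n" using e step by (intro stay[OF n1]) auto
        have "d e (Suc n) \<le> L * d e n"
          unfolding d_def same funpow.simps comp_apply using e in_I by (intro L(2) iter_in) auto
        also have "\<dots> \<le> L * \<delta>" using step L(1) by (intro mult_left_mono) auto
        finally have "d e (Suc n) \<le> L * \<delta>" .
        moreover have "\<eta> \<le> d e (Suc n) + d e' (Suc n)" using len[of "Suc n"] e by auto
        ultimately have "\<not> d e' (Suc n) < \<delta>" using \<delta> by (auto simp: algebra_simps)
        then have "d e (Suc n) < \<delta>" using contra'[of "Suc n"] step e by auto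
        then show ?case using same step by simp
      qed
      then show ?thesis by simp
    qed
    consider "d a M < \<delta>" | "d b M < \<delta>" using contra'[of M] by auto
    then show False
    proof cases
      case 1
      have "homterval (a M) x"
        unfolding homterval_def
      proof (intro conjI allI impI)
        fix n y assume y: "a M < y" "y < x"
        have "a (max M (Suc n)) = a M" by (rule main[of a b]) (use 1 in auto)
        then show "(f ^^ n) y \<noteq> c"
          using branch_no_c[OF ab(1)[of "max M (Suc n)"], of n y] y ab(3)[of "max M (Suc n)"] by auto
      qed (use in_I ab(2)[of M] in auto)
      then show False using x by (auto simp: good_def)
    next
      case 2
      have "homterval x (b M)"
        unfolding homterval_def
      proof (intro conjI allI impI)
        fix n y assume y: "x < y" "y < b M"
        have "b (max M (Suc n)) = b M" by (rule main[of b a]) (use 2 in auto)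
        then show "(f ^^ n) y \<noteq> c"
          using branch_no_c[OF ab(1)[of "max M (Suc n)"], of n y] y ab(2)[of "max M (Suc n)"] by auto
      qed (use in_I ab(3)[of M] in auto)
      then show False using x by (auto simp: good_def)
    qed
  qed
qed

end

text \<open>Unless the left end is already a suitable fixed point, the graph is above the diagonal
  at some \<open>z\<close>. At the first crossing to the right of \<open>z\<close> the graph comes
  from above the diagonal, so the difference quotients from the left are at most 1. All derivatives
  are taken within the interval, so this also works at its ends.\<close>

lemma increasing_self_map_nonrepelling:
  fixes g D :: "real \<Rightarrow> real"
  assumes e: "e1 < e2" and self: "g ` {e1..e2} \<subseteq> {e1..e2}"
    and inc: "\<And>x y. e1 \<le> x \<Longrightarrow> x < y \<Longrightarrow> y \<le> e2 \<Longrightarrow> g x < g y"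
    and D: "\<And>x. x \<in> {e1..e2} \<Longrightarrow> (g has_real_derivative D x) (at x within {e1..e2})"
  obtains x where "x \<in> {e1..e2}" "g x = x" "\<bar>D x\<bar> \<le> 1"
proof -
  have cont: "continuous_on {e1..e2} g"
    using D DERIV_continuous continuous_on_eq_continuous_within by blast
  have quot: "((\<lambda>y. (g y - g x) / (y - x)) \<longlongrightarrow> D x) (at x within {e1..e2})" if "x \<in> {e1..e2}" for x
    using D[OF that] unfolding has_field_derivative_iff .
  have nonneg: "D x \<ge> 0" if x: "x \<in> {e1..e2}" for x
  proof (rule tendsto_lowerbound[OF quot[OF x]])
    show "\<forall>\<^sub>F y in at x within {e1..e2}. 0 \<le> (g y - g x) / (y - x)"
      unfolding eventually_at_filter
    proof (rule always_eventually, intro allI impI)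
      fix y assume y: "y \<noteq> x" "y \<in> {e1..e2}"
      show "0 \<le> (g y - g x) / (y - x)"
        using inc[of x y] inc[of y x] x y by (cases "x < y") (auto intro: divide_nonneg_nonneg divide_nonpos_nonpos)
    qed
    show "at x within {e1..e2} \<noteq> bot"
      using e x by (simp add: trivial_limit_within islimpt_Icc)
  qed
  have "\<exists>z\<in>{e1..<e2}. g z > z \<or> (g e1 = e1 \<and> D e1 \<le> 1)"
  proof (cases "g e1 = e1 \<and> D e1 > 1")
    case True
    have "\<forall>\<^sub>F y in at e1 within {e1..e2}. (g y - g e1) / (y - e1) > 1"
      using order_tendstoD(1)[OF quot[of e1]] True e by auto
    then have "\<forall>\<^sub>F y in at e1 within {e1..e2}. y \<in> {e1..e2} \<and> y \<noteq> e1 \<and> y < e2 \<and> (g y - g e1) / (y - e1) > 1"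
    proof (rule eventually_elim2)
      have "\<forall>\<^sub>F y in at e1 within {e1..e2}. y < e2"
        using e order_tendstoD(2)[OF tendsto_ident_at] by blast
      then show "\<forall>\<^sub>F y in at e1 within {e1..e2}. y \<in> {e1..e2} \<and> y \<noteq> e1 \<and> y < e2"
        unfolding eventually_at_filter by (rule eventually_mono) auto
    qed auto
    moreover have "at e1 within {e1..e2} \<noteq> bot"
      using e by (simp add: trivial_limit_within islimpt_Icc)
    ultimately obtain y where y: "y \<in> {e1..e2}" "y \<noteq> e1" "y < e2" "(g y - g e1) / (y - e1) > 1"
      using eventually_happens'[of "at e1 within {e1..e2}"] by blast
    then have "g y > y" using True by (simp add: field_simps)
    then show ?thesis using y by auto
  next
    case False
    have "g e1 \<ge> e1" using self e by (auto simp: image_subset_iff)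
    then show ?thesis using False e by (cases "g e1 = e1") (auto intro!: bexI[of _ e1])
  qed
  then consider "g e1 = e1" "D e1 \<le> 1" | z where "z \<in> {e1..<e2}" "g z > z" by blast
  then show thesis
  proof cases
    case 1
    then show thesis using that[of e1] nonneg[of e1] e by auto
  next
    case (2 z)
    define A where "A = {x \<in> {z..e2}. g x \<le> x}"
    have contz: "continuous_on {z..e2} g" using 2 by (intro continuous_on_subset[OF cont]) auto
    have "closed A"
      unfolding A_def by (rule continuous_on_closed_Collect_le) (auto intro: contz)
    moreover have "e2 \<in> A" using 2 e self by (auto simp: A_def image_subset_iff)
    moreover have bdd: "bdd_below A" by (rule bdd_belowI[of _ z]) (auto simp: A_def)
    ultimately have tA: "Inf A \<in> A" using closed_contains_Inf[of A] by blast
    define t where "t = Inf A"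
    have t: "z < t" "t \<le> e2" "g t \<le> t"
      using tA 2 unfolding t_def[symmetric] by (auto simp: A_def less_le)
    have above: "g y > y" if "z \<le> y" "y < t" for y
    proof (rule ccontr)
      assume "\<not> g y > y"
      then have "y \<in> A" using that t by (auto simp: A_def)
      then have "t \<le> y" unfolding t_def by (rule cInf_lower[OF _ bdd])
      then show False using that by simp
    qed
    have "g t \<ge> t"
    proof (rule dense_le_bounded[OF t(1)])
      fix y assume "z < y" "y < t"
      then show "y \<le> g t" using above[of y] inc[of y t] 2 t by force
    qed
    then have gt: "g t = t" using t by simp
    have tI: "t \<in> {e1..e2}" using t 2 by auto
    have "D t \<le> 1"
    proof (rule tendsto_upperbound)
      show "((\<lambda>y. (g y - g t) / (y - t)) \<longlongrightarrow> D t) (at t within {z<..<t})"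
        by (rule tendsto_within_subset[OF quot[OF tI]]) (use 2 t in auto)
      show "\<forall>\<^sub>F y in at t within {z<..<t}. (g y - g t) / (y - t) \<le> 1"
        unfolding eventually_at_filter
      proof (rule always_eventually, intro allI impI)
        fix y assume "y \<noteq> t" "y \<in> {z<..<t}"
        then show "(g y - g t) / (y - t) \<le> 1" using above[of y] gt by (simp add: field_simps)
      qed
      show "at t within {z<..<t} \<noteq> bot"
        using t by (simp add: trivial_limit_within islimpt_greaterThanLessThan2)
    qed
    then show thesis using that[of t] tI gt nonneg[OF tI] by auto
  qed
qed

context sturmian_map
begin

section \<open>Disjointness of the images of a homterval\<close>

lemma branch_endpoint:
  assumes "branch n a b"
  shows "a = lo \<or> (\<exists>i<n. (f ^^ i) a = c)" "b = hi \<or> (\<exists>i<n. (f ^^ i) b = c)"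
  using assms by (induction; auto intro: less_SucI)+

lemma smono_subset: "smono a b g \<Longrightarrow> a \<le> a' \<Longrightarrow> b' \<le> b \<Longrightarrow> smono a' b' g"
  unfolding smono_def monotone_on_def by auto

lemma homterval_smono:
  assumes h: "homterval p q" shows "smono p q (f ^^ n)"
proof -
  define x where "x = (p + q) / 2"
  have x: "p < x" "x < q" "lo \<le> p" "q \<le> hi" using h by (auto simp: homterval_def x_def)
  have "\<And>i. (f ^^ i) x \<noteq> c" using h x by (auto simp: homterval_def)
  then obtain a b where ab: "branch n a b" "a < x" "x < b"
    using branch_exists[of x n] x by auto
  have "a \<le> p"
  proof (rule ccontr)
    assume "\<not> a \<le> p"
    then have "p < a" "a < q" "a \<noteq> lo" using x ab by auto
    then show False using branch_endpoint(1)[OF ab(1)] h by (auto simp: homterval_def)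
  qed
  moreover have "q \<le> b"
  proof (rule ccontr)
    assume "\<not> q \<le> b"
    then have "p < b" "b < q" "b \<noteq> hi" using x ab by auto
    then show False using branch_endpoint(2)[OF ab(1)] h by (auto simp: homterval_def)
  qed
  ultimately show ?thesis using smono_subset[OF branch_smono[OF ab(1)]] by blast
qed

text \<open>A self-map of the closed interval that is monotone would have a periodic point whose
  multiplier is at most 1 in absolute value, but all periodic points are repelling.\<close>

lemma homterval_not_periodic:
  assumes h: "homterval e1 e2" and m: "m \<ge> 1" and self: "(f ^^ m) ` {e1<..<e2} \<subseteq> {e1..e2}"
  shows False
proof -
  have e: "e1 < e2" "lo \<le> e1" "e2 \<le> hi" using h by (auto simp: homterval_def)
  define g where "g = f ^^ m"
  have cont: "continuous_on {e1..e2} g" unfolding g_def using e by (intro continuous_on_subset[OF iter_cont]) auto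
  have "closure {e1<..<e2} = {e1..e2}" using e by simp
  then have gself: "g ` {e1..e2} \<subseteq> {e1..e2}"
    using image_closure_subset[of "{e1<..<e2}" g "{e1..e2}"] cont self by (simp add: g_def)
  \<comment> \<open>The second iterate is increasing even if \<open>g\<close> reverses
    orientation.\<close>
  have gg: "f ^^ (m + m) = g \<circ> g" by (simp add: g_def funpow_add)
  have "smono e1 e2 g" unfolding g_def by (rule homterval_smono[OF h])
  then have inc: "(f ^^ (m + m)) x < (f ^^ (m + m)) y" if "e1 \<le> x" "x < y" "y \<le> e2" for x y
  proof (cases rule: smono_cases)
    case 1
    then show ?thesis unfolding gg comp_apply using that gself by (intro 1) (auto simp: image_subset_iff)
  next
    case 2
    then show ?thesis unfolding gg comp_apply using that gself by (intro 2) (auto simp: image_subset_iff)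
  qed
  have I: "{e1..e2} \<subseteq> {lo..hi}" using e by auto
  have "(f ^^ (m + m)) ` {e1..e2} \<subseteq> {e1..e2}" unfolding gg image_comp[symmetric] using gself by blast
  then obtain x where x: "x \<in> {e1..e2}" "(f ^^ (m + m)) x = x" "\<bar>\<Prod>i<m + m. df ((f ^^ i) x)\<bar> \<le> 1"
    using increasing_self_map_nonrepelling[OF e(1) _ inc DERIV_subset[OF iter_deriv I]] I by blast
  moreover have "\<bar>\<Prod>i<m + m. df ((f ^^ i) x)\<bar> > 1"
    using x I m by (intro periodic_repelling[OF _ _ _ iter_deriv]) auto
  ultimately show False by simp
qed

lemma smono_image_Ioo:
  assumes sm: "smono p q g" and cont: "continuous_on {p..q} g" and pq: "p < q"
  shows "g ` {p<..<q} = {min (g p) (g q)<..<max (g p) (g q)}"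
proof
  show "g ` {p<..<q} \<subseteq> {min (g p) (g q)<..<max (g p) (g q)}"
    using smono_split[OF sm] by auto
  show "{min (g p) (g q)<..<max (g p) (g q)} \<subseteq> g ` {p<..<q}"
  proof
    fix y assume y: "y \<in> {min (g p) (g q)<..<max (g p) (g q)}"
    then have "g p \<le> y \<and> y \<le> g q \<or> g q \<le> y \<and> y \<le> g p" by auto
    then obtain x where x: "p \<le> x" "x \<le> q" "g x = y"
      using IVT'[of g p y q] IVT2'[of g q y p] cont pq by (metis less_imp_le)
    then have "x \<noteq> p" "x \<noteq> q" using y by auto
    then show "y \<in> g ` {p<..<q}" using x by auto
  qed
qed

text \<open>If two images met, consecutive members of the sequence I (i + k * m) with m = j - i
  would meet as well. Their union \<open>E\<close> is then connected, is mapped into itself by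
  \<open>f ^^ m\<close> and never reaches \<open>c\<close>, so the interval from
  \<open>Inf E\<close> to \<open>Sup E\<close> contradicts
  \<open>homterval_not_periodic\<close>.\<close>

lemma homterval_images_disjoint:
  assumes h: "homterval p q" and ij: "i < j"
  shows "(f ^^ i) ` {p<..<q} \<inter> (f ^^ j) ` {p<..<q} = {}"
proof (rule ccontr)
  define H where "H = {p<..<q}"
  define I where "I n = (f ^^ n) ` H" for n
  assume "(f ^^ i) ` {p<..<q} \<inter> (f ^^ j) ` {p<..<q} \<noteq> {}"
  then obtain y where y: "y \<in> I i" "y \<in> I j" unfolding I_def H_def by blast
  define m where "m = j - i"
  have j: "j = i + m" "m \<ge> 1" using ij by (auto simp: m_def)
  have pq: "p < q" "lo \<le> p" "q \<le> hi" using h by (auto simp: homterval_def)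
  have HX: "H \<subseteq> {lo..hi}" using pq by (auto simp: H_def)
  have Iadd: "(f ^^ k) ` I n = I (k + n)" for k n by (simp add: I_def image_image funpow_add)
  have conn: "connected (I n)" for n
    unfolding I_def by (intro connected_continuous_image continuous_on_subset[OF iter_cont] HX) (simp add: H_def)
  have IX: "I n \<subseteq> {lo..hi}" for n using iter_in HX unfolding I_def by blast
  have noc: "(f ^^ k) x \<noteq> c" if x: "x \<in> I n" for k n x
  proof -
    obtain w where w: "w \<in> H" "x = (f ^^ n) w" using x by (auto simp: I_def)
    then have "(f ^^ k) x = (f ^^ (k + n)) w" by (simp add: funpow_add)
    then show ?thesis using h w by (auto simp: homterval_def H_def)
  qed
  define U where "U k = (\<Union>k'\<le>k. I (i + k' * m))" for k
  define E where "E = (\<Union>k. U k)"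
  have Uconn: "connected (U k)" for k
  proof (induction k)
    case 0
    then show ?case using conn by (simp add: U_def)
  next
    case (Suc k)
    have "(f ^^ (k * m)) y \<in> I (k * m + i)" "(f ^^ (k * m)) y \<in> I (k * m + j)"
      using y Iadd by blast+
    then have "(f ^^ (k * m)) y \<in> U k \<inter> I (i + Suc k * m)" by (auto simp: U_def j algebra_simps)
    moreover have "U (Suc k) = U k \<union> I (i + Suc k * m)" by (auto simp: U_def atMost_Suc)
    ultimately show ?case using connected_Un[OF Suc conn] by auto
  qed
  have "y \<in> U k" for k using y unfolding U_def by (auto intro!: bexI[of _ 0])
  then have Econn: "connected E" unfolding E_def by (intro connected_Union) (use Uconn in auto)
  have EX: "E \<subseteq> {lo..hi}" using IX by (auto simp: E_def U_def)
  have Ec: "(f ^^ k) x \<noteq> c" if "x \<in> E" for k x using that noc by (auto simp: E_def U_def)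
  have Em: "(f ^^ m) ` E \<subseteq> E"
  proof -
    have "(f ^^ m) ` I (i + k * m) = I (i + Suc k * m)" for k using Iadd by (simp add: algebra_simps)
    then show ?thesis unfolding E_def U_def by blast
  qed
  have bdd: "bdd_below E" "bdd_above E" using bdd_below_mono[OF bdd_below_Icc EX] bdd_above_mono[OF bdd_above_Icc EX] by auto
  have IE: "I i \<subseteq> E" unfolding E_def U_def by (auto intro!: exI[of _ 0] bexI[of _ 0])
  define a b where "a = (2 * p + q) / 3" and "b = (p + 2 * q) / 3"
  have ab: "p < a" "a < b" "b < q" using pq by (auto simp: a_def b_def)
  have "(f ^^ i) a \<noteq> (f ^^ i) b"
    using smono_inj[OF homterval_smono[OF h], of a b i] ab by auto
  moreover have "a \<in> H" "b \<in> H" using ab by (auto simp: H_def)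
  then have abE: "(f ^^ i) a \<in> E" "(f ^^ i) b \<in> E" using subsetD[OF IE] by (auto simp: I_def)
  ultimately have less: "Inf E < Sup E"
    using cInf_lower[OF abE(1) bdd(1)] cSup_upper[OF abE(1) bdd(2)]
      cInf_lower[OF abE(2) bdd(1)] cSup_upper[OF abE(2) bdd(2)] by linarith
  have ne: "E \<noteq> {}" using abE by blast
  have inE: "x \<in> E" if x: "Inf E < x" "x < Sup E" for x
  proof -
    obtain v where "v \<in> E" "v < x" using cInf_lessD[OF ne x(1)] by blast
    moreover obtain w where "w \<in> E" "x < w" using less_cSupD[OF ne x(2)] by blast
    ultimately show ?thesis using Econn connected_contains_Icc[OF Econn, of v w] by auto
  qed
  have "homterval (Inf E) (Sup E)"
    unfolding homterval_def using less inE Ec EX ne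
    by (auto intro!: cInf_greatest cSup_least)
  moreover have "(f ^^ m) ` {Inf E<..<Sup E} \<subseteq> {Inf E..Sup E}"
    using inE Em cInf_lower[OF _ bdd(1)] cSup_upper[OF _ bdd(2)] by force
  ultimately show False using homterval_not_periodic j by blast
qed

section \<open>Proportions of preimages inside a branch\<close>

lemma smono_vimage_Icc:
  assumes sm: "smono a b g" and cont: "continuous_on {a..b} g" and ab: "a < b"
    and y: "min (g a) (g b) \<le> y1" "y1 \<le> y2" "y2 \<le> max (g a) (g b)"
  obtains m1 m2 where "a \<le> m1" "m1 \<le> m2" "m2 \<le> b" "{x \<in> {a..b}. g x \<in> {y1..y2}} = {m1..m2}"
    "\<bar>g m2 - g m1\<bar> = y2 - y1"
    "\<And>d. d \<le> y1 - min (g a) (g b) \<Longrightarrow> d \<le> max (g a) (g b) - y2 \<Longrightarrow> d \<le> \<bar>g m1 - g a\<bar> \<and> d \<le> \<bar>g b - g m2\<bar>"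
proof -
  have ex: "\<exists>x\<in>{a..b}. g x = y" if "min (g a) (g b) \<le> y" "y \<le> max (g a) (g b)" for y
  proof -
    have "g a \<le> y \<and> y \<le> g b \<or> g b \<le> y \<and> y \<le> g a" using that by linarith
    then consider "g a \<le> y" "y \<le> g b" | "g b \<le> y" "y \<le> g a" by blast
    then show ?thesis
    proof cases
      case 1
      then show ?thesis using IVT'[OF _ _ _ cont, of y] ab by auto
    next
      case 2
      then show ?thesis using IVT2'[OF _ _ _ cont, of y] ab by auto
    qed
  qed
  obtain x1 where x1: "x1 \<in> {a..b}" "g x1 = y1" using ex[of y1] y by auto
  obtain x2 where x2: "x2 \<in> {a..b}" "g x2 = y2" using ex[of y2] y by auto
  show thesis
    using sm
  proof (cases rule: smono_cases)
    case 1
    have mono: "g x \<le> g y \<longleftrightarrow> x \<le> y" if "x \<in> {a..b}" "y \<in> {a..b}" for x y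
      using 1[of x y] 1[of y x] that by (cases "x < y"; cases "y < x") auto
    have "g a \<le> g b" using mono[of a b] ab by auto
    show thesis
    proof (rule that[of x1 x2])
      show "{x \<in> {a..b}. g x \<in> {y1..y2}} = {x1..x2}"
        using mono x1 x2 by (auto 0 3 dest: order_trans)
      show "x1 \<le> x2" using mono[of x1 x2] x1 x2 y by auto
    qed (use x1 x2 y \<open>g a \<le> g b\<close> in auto)
  next
    case 2
    have mono: "g x \<le> g y \<longleftrightarrow> y \<le> x" if "x \<in> {a..b}" "y \<in> {a..b}" for x y
      using 2[of x y] 2[of y x] that by (cases "x < y"; cases "y < x") auto
    have "g b \<le> g a" using mono[of b a] ab by auto
    show thesis
    proof (rule that[of x2 x1])
      show "{x \<in> {a..b}. g x \<in> {y1..y2}} = {x2..x1}"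
        using mono x1 x2 by (auto 0 3 dest: order_trans)
      show "x2 \<le> x1" using mono[of x1 x2] x1 x2 y by auto
    qed (use x1 x2 y \<open>g b \<le> g a\<close> in auto)
  qed
qed

lemma smono_left: "smono lo c f" and smono_right: "smono c hi f"
  using f_left f_right by (auto simp: smono_def)

lemma interval_preimage:
  assumes sm: "smono a b f" and ab: "lo \<le> a" "a < b" "b \<le> hi"
    and y: "min (f a) (f b) \<le> y1" "y1 < y2" "y2 \<le> max (f a) (f b)"
  obtains z1 z2 where "a \<le> z1" "z1 < z2" "z2 \<le> b" "f ` {z1..z2} \<subseteq> {y1..y2}" "y2 - y1 \<le> L * (z2 - z1)"
proof -
  have cont: "continuous_on {a..b} f" using ab by (intro continuous_on_subset[OF f_cont]) auto
  obtain z1 z2 where z: "a \<le> z1" "z1 \<le> z2" "z2 \<le> b" "{x \<in> {a..b}. f x \<in> {y1..y2}} = {z1..z2}"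
    "\<bar>f z2 - f z1\<bar> = y2 - y1"
    by (rule smono_vimage_Icc[OF sm cont ab(2) y(1) less_imp_le[OF y(2)] y(3)]) (rule that; assumption)
  have "z1 \<noteq> z2" using z(5) y(2) by auto
  then have "z1 < z2" using z(2) by simp
  moreover have "f ` {z1..z2} \<subseteq> {y1..y2}" unfolding z(4)[symmetric] by auto
  moreover have "y2 - y1 \<le> L * (z2 - z1)" using L(2)[of z2 z1] z ab by simp
  ultimately show thesis using that[of z1 z2] z by blast
qed

text \<open>\<open>branch_distortion\<close> in terms of Lebesgue measure, with D = hi - lo because
  all images lie in \<open>{lo..hi}\<close>.\<close>

lemma branch_proportion:
  assumes br: "branch n a b" and d: "d > 0" and y: "y1 < y2"
    and J: "{y1..y2} \<subseteq> {min ((f ^^ n) a) ((f ^^ n) b)..max ((f ^^ n) a) ((f ^^ n) b)}"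
  shows "measure lborel {x \<in> {a..b}. (f ^^ n) x \<in> {min ((f ^^ n) a) ((f ^^ n) b) + d..max ((f ^^ n) a) ((f ^^ n) b) - d}} * (y2 - y1)
    \<le> (2 * (hi - lo)\<^sup>2 / d + (hi - lo)) * measure lborel {x \<in> {a..b}. (f ^^ n) x \<in> {y1..y2}}"
proof -
  define s t where "s = min ((f ^^ n) a) ((f ^^ n) b)" and "t = max ((f ^^ n) a) ((f ^^ n) b)"
  note b = branch_bounds[OF br]
  have cont: "continuous_on {a..b} (f ^^ n)" using b by (intro continuous_on_subset[OF iter_cont]) auto
  have D: "\<bar>(f ^^ n) b - (f ^^ n) a\<bar> \<le> hi - lo"
    using iter_in[of a n] iter_in[of b n] b by auto
  have y': "s \<le> y1" "y2 \<le> t" using J y by (auto simp: s_def t_def)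
  note vimage = smono_vimage_Icc[OF branch_smono[OF br] cont b(2), folded s_def t_def]
  obtain j1 j2 where j: "a \<le> j1" "j1 \<le> j2" "j2 \<le> b" "{x \<in> {a..b}. (f ^^ n) x \<in> {y1..y2}} = {j1..j2}"
    "\<bar>(f ^^ n) j2 - (f ^^ n) j1\<bar> = y2 - y1"
    by (rule vimage[OF y'(1) less_imp_le[OF y] y'(2)]) (rule that; assumption)
  have j12: "j1 < j2" using j y by (cases "j1 = j2") auto
  have C: "2 * (hi - lo)\<^sup>2 / d + (hi - lo) \<ge> 0" using d lo_less_c c_less_hi by simp
  show ?thesis
    unfolding s_def[symmetric] t_def[symmetric] j(4)
  proof (cases "s + d \<le> t - d")
    case True
    obtain m1 m2 where m: "a \<le> m1" "m1 \<le> m2" "m2 \<le> b" "{x \<in> {a..b}. (f ^^ n) x \<in> {s + d..t - d}} = {m1..m2}"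
      "\<And>e. e \<le> s + d - s \<Longrightarrow> e \<le> t - (t - d) \<Longrightarrow> e \<le> \<bar>(f ^^ n) m1 - (f ^^ n) a\<bar> \<and> e \<le> \<bar>(f ^^ n) b - (f ^^ n) m2\<bar>"
    proof (rule vimage[of "s + d" "t - d"])
      show "s \<le> s + d" "s + d \<le> t - d" "t - d \<le> t" using True d by auto
    qed (rule that; assumption)
    have "(m2 - m1) * (y2 - y1) \<le> (2 * (hi - lo)\<^sup>2 / d + (hi - lo)) * (j2 - j1)"
      using branch_distortion[OF branch_expands[OF br] branch_smono[OF br, unfolded smono_def] D d j(1) j12 j(3) m(1-3)]
        m(5)[of d] j(5) by simp
    then show "measure lborel {x \<in> {a..b}. (f ^^ n) x \<in> {s + d..t - d}} * (y2 - y1)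
        \<le> (2 * (hi - lo)\<^sup>2 / d + (hi - lo)) * measure lborel {j1..j2}"
      using m j unfolding m(4) by simp
  next
    case False
    then have "{x \<in> {a..b}. (f ^^ n) x \<in> {s + d..t - d}} = {}" by auto
    then have 0: "measure lborel {x \<in> {a..b}. (f ^^ n) x \<in> {s + d..t - d}} = 0" by (simp only: measure_empty)
    then show "measure lborel {x \<in> {a..b}. (f ^^ n) x \<in> {s + d..t - d}} * (y2 - y1)
        \<le> (2 * (hi - lo)\<^sup>2 / d + (hi - lo)) * measure lborel {j1..j2}"
      unfolding 0 using C j12 by simp
  qed
qed

end

section \<open>A null set containing the critical orbit\<close>

context sturmian_map
begin

lemma finite_iter_eq_c: "finite {x \<in> {lo..hi}. (f ^^ n) x = y}"
proof (induction n)
  case 0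
  have "{x \<in> {lo..hi}. (f ^^ 0) x = y} \<subseteq> {y}" by auto
  then show ?case using finite_subset by blast
next
  case (Suc n)
  let ?F = "{x \<in> {lo..hi}. (f ^^ n) x = y}"
  have "inj_on f {lo..c}" by (rule strict_mono_on_imp_inj_on[OF f_left])
  moreover have "inj_on f {c..hi}"
    by (rule inj_onI) (metis atLeastAtMost_iff f_less_right less_irrefl linorder_neqE_linordered_idom)
  ultimately have "finite (f -` ?F \<inter> {lo..c} \<union> f -` ?F \<inter> {c..hi})"
    using Suc finite_vimage_IntI by blast
  moreover have "{x \<in> {lo..hi}. (f ^^ Suc n) x = y} \<subseteq> f -` ?F \<inter> {lo..c} \<union> f -` ?F \<inter> {c..hi}"
  proof
    fix x assume "x \<in> {x \<in> {lo..hi}. (f ^^ Suc n) x = y}"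
    then have x: "x \<in> {lo..hi}" "(f ^^ n) (f x) = y"
      by (simp_all only: mem_Collect_eq funpow_Suc_right comp_apply)
    then have "x \<in> f -` ?F" using f_in[OF x(1)] by simp
    then show "x \<in> f -` ?F \<inter> {lo..c} \<union> f -` ?F \<inter> {c..hi}" using x(1) by auto
  qed
  ultimately show ?case by (rule finite_subset[rotated])
qed

text \<open>Around each good point of \<open>K\<close> there are arbitrarily small intervals in
  which the complement of \<open>K\<close> has proportion at least 1 / Q: the gap of
  \<open>tower_gap\<close> is pulled back by a branch with large margins, and forward invariance
  keeps the preimage of the gap outside \<open>K\<close>. Disjoint intervals of this kind inside an
  open set W around \<open>K\<close> have total length at most Q times the measure of W - K.\<close>

lemma negligible_good_K: "negligible {x \<in> K. good x}"
proof -
  let ?S = "{x \<in> K. good x}"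
  obtain \<delta> where \<delta>: "\<delta> > 0" "\<And>x N. good x \<Longrightarrow> \<exists>n\<ge>N. \<exists>a b. branch n a b \<and> a < x \<and> x < b \<and>
        \<delta> \<le> \<bar>(f ^^ n) x - (f ^^ n) a\<bar> \<and> \<delta> \<le> \<bar>(f ^^ n) b - (f ^^ n) x\<bar>"
    using good_large_margins by metis
  obtain g where g: "g > 0"
    "\<And>s t. tower s t \<Longrightarrow> \<exists>z. s + g \<le> z \<and> z + 2 * g \<le> t \<and> {z..z + g} \<inter> K = {}"
    using tower_gap by metis
  \<comment> \<open>Being below \<delta> makes the interval around \<open>x\<close> nondegenerate;
    being at most \<open>g\<close> makes it contain the preimage of the gap.\<close>
  define d where "d = min (\<delta> / 2) g"
  have d: "d > 0" "2 * d \<le> \<delta>" "d \<le> g" using \<delta> g by (auto simp: d_def)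
  define C where "C = 2 * (hi - lo)\<^sup>2 / d + (hi - lo)"
  have C: "C > 0" using d lo_less_c c_less_hi by (auto simp: C_def intro!: add_nonneg_pos)
  define Q where "Q = C / g"
  have Q: "Q > 0" using C g by (simp add: Q_def)
  \<comment> \<open>The intervals contain \<open>x\<close> without being centred at it, which is
    enough for the Vitali covering theorem.\<close>
  have cover: "\<exists>m1 m2. m1 < m2 \<and> x \<in> {m1..m2} \<and> {m1..m2} \<subseteq> ball x r \<and>
      measure lborel {m1..m2} \<le> Q * measure lborel ({m1..m2} - K)" if x: "x \<in> ?S" and r: "r > 0" for x r
  proof -
    have gx: "good x" using x by simp
    obtain N where N: "\<And>n a b. n \<ge> N \<Longrightarrow> branch n a b \<Longrightarrow> a < x \<Longrightarrow> x < b \<Longrightarrow> x - r < a \<and> b < x + r"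
      using good_branch_shrinks[OF gx r] by metis
    obtain n a b where n: "n \<ge> max 1 N" and br: "branch n a b" "a < x" "x < b"
      and marg: "\<delta> \<le> \<bar>(f ^^ n) x - (f ^^ n) a\<bar>" "\<delta> \<le> \<bar>(f ^^ n) b - (f ^^ n) x\<bar>"
      using \<delta>(2)[OF gx] by metis
    have ab: "x - r < a" "b < x + r" using N[OF _ br] n by auto
    define s t where "s = min ((f ^^ n) a) ((f ^^ n) b)" and "t = max ((f ^^ n) a) ((f ^^ n) b)"
    have n1: "n \<ge> 1" using n by simp
    have tower: "tower s t" using branch_tower[OF br(1) n1] by (simp add: s_def t_def)
    obtain z where z: "s + g \<le> z" "z + 2 * g \<le> t" "{z..z + g} \<inter> K = {}" using g(2)[OF tower] by blast
    have fx: "s + \<delta> \<le> (f ^^ n) x" "(f ^^ n) x \<le> t - \<delta>"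
      using smono_split[OF branch_smono[OF br(1)] br(2,3)] marg unfolding s_def t_def by linarith+
    note b = branch_bounds[OF br(1)]
    have cont: "continuous_on {a..b} (f ^^ n)" using b by (intro continuous_on_subset[OF iter_cont]) auto
    have y12: "s + d < t - d" using fx d by linarith
    obtain m1 m2 where m: "a \<le> m1" "m1 \<le> m2" "m2 \<le> b" "{x \<in> {a..b}. (f ^^ n) x \<in> {s + d..t - d}} = {m1..m2}"
      "\<bar>(f ^^ n) m2 - (f ^^ n) m1\<bar> = t - d - (s + d)"
    proof (rule smono_vimage_Icc[OF branch_smono[OF br(1)] cont b(2), folded s_def t_def, of "s + d" "t - d"])
      show "s \<le> s + d" "s + d \<le> t - d" "t - d \<le> t" using y12 d by auto
    qed (rule that; assumption)
    have "m1 \<noteq> m2" using m(5) y12 by auto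
    then have m12: "m1 < m2" using m by simp
    have xm: "x \<in> {m1..m2}" unfolding m(4)[symmetric] using br fx d by auto
    let ?J = "{x \<in> {a..b}. (f ^^ n) x \<in> {z..z + g}}"
    have "measure lborel {m1..m2} * g \<le> C * measure lborel ?J"
      using branch_proportion[OF br(1) d(1), of z "z + g"] z g(1)
      unfolding s_def[symmetric] t_def[symmetric] m(4) C_def by simp
    also have "measure lborel ?J \<le> measure lborel ({m1..m2} - K)"
    proof (rule measure_mono_fmeasurable)
      have "?J \<subseteq> {x \<in> {a..b}. (f ^^ n) x \<in> {s + d..t - d}}" using z d g(1) by auto
      then show "?J \<subseteq> {m1..m2} - K" unfolding m(4) using K_iter z(3) by auto
      have "closed ({a..b} \<inter> (f ^^ n) -` {z..z + g})" by (rule continuous_closed_preimage[OF cont]) auto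
      moreover have "{a..b} \<inter> (f ^^ n) -` {z..z + g} = ?J" by auto
      ultimately show "?J \<in> sets lborel" by (simp only: sets_lborel borel_closed)
      show "{m1..m2} - K \<in> fmeasurable lborel"
        using closed_K by (intro fmeasurable_Diff) (auto simp: fmeasurable_def emeasure_lborel_Icc_eq)
    qed
    finally have "measure lborel {m1..m2} \<le> Q * measure lborel ({m1..m2} - K)"
      using C g(1) by (simp add: Q_def field_simps)
    moreover have "{m1..m2} \<subseteq> ball x r" using m(1,3) ab by (auto simp: dist_real_def)
    ultimately show ?thesis using m12 xm by blast
  qed
  show ?thesis
    unfolding negligible_outer
  proof (intro allI impI)
    fix e :: real assume e: "e > 0"
    have "K \<in> sets lebesgue" using closed_K by (intro sets_completionI_sets) (simp add: borel_closed)
    then obtain W where W: "open W" "K \<subseteq> W" "W - K \<in> lmeasurable"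
      "emeasure lebesgue (W - K) < ennreal (e / (2 * Q))"
      using sets_lebesgue_outer_open[of K "e / (2 * Q)"] e Q by auto
    define I where "I = {(p, r). r > 0 \<and> cball p r \<subseteq> W \<and>
        measure lborel (cball p r) \<le> Q * measure lborel (cball p r - K)}"
    have ex: "\<exists>i. i \<in> I \<and> x \<in> cball (fst i) (snd i) \<and> snd i < r" if x: "x \<in> ?S" and r: "r > 0" for x r
    proof -
      obtain r' where r': "r' > 0" "ball x r' \<subseteq> W" using W(1,2) x open_contains_ball[of W] by blast
      obtain m1 m2 where m: "m1 < m2" "x \<in> {m1..m2}" "{m1..m2} \<subseteq> ball x (min r r')"
        "measure lborel {m1..m2} \<le> Q * measure lborel ({m1..m2} - K)"
        using cover[OF x, of "min r r'"] r r' by auto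
      define p q where "p = (m1 + m2) / 2" and "q = (m2 - m1) / 2"
      have eq: "cball p q = {m1..m2}" by (simp add: cball_eq_atLeastAtMost p_def q_def field_simps)
      have "m1 \<in> ball x r" "m2 \<in> ball x r" using m(1) subsetD[OF m(3), of m1] subsetD[OF m(3), of m2] by auto
      then have "q < r" by (auto simp: q_def dist_real_def)
      moreover have "(p, q) \<in> I"
      proof -
        have "ball x (min r r') \<subseteq> ball x r'" by (rule subset_ball) simp
        then have "{m1..m2} \<subseteq> W" using m(3) r'(2) by blast
        moreover have "q > 0" using m(1) by (simp add: q_def)
        ultimately show ?thesis unfolding I_def using m(4) by (simp only: eq mem_Collect_eq case_prod_conv)
      qed
      ultimately show ?thesis using m(2) eq by (intro exI[of _ "(p, q)"]) auto
    qed
    obtain F where F: "countable F" "F \<subseteq> I"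
      "pairwise (\<lambda>i j. disjnt (cball (fst i) (snd i)) (cball (fst j) (snd j))) F"
      "negligible (?S - (\<Union>i\<in>F. cball (fst i) (snd i)))"
    proof (rule Vitali_covering_theorem_cballs[of I snd ?S fst])
      show "0 < snd i" if "i \<in> I" for i using that by (auto simp: I_def)
      show "\<exists>i. i \<in> I \<and> x \<in> cball (fst i) (snd i) \<and> snd i < r" if "x \<in> ?S" "0 < r" for x r
        using ex[OF that] .
    qed (rule that; assumption)
    define B where "B i = cball (fst i) (snd i)" for i :: "real \<times> real"
    define U where "U = (\<Union>i\<in>F. B i)"
    have disj: "disjoint_family_on B F"
      using F(3) unfolding disjoint_family_on_def pairwise_def disjnt_def B_def by blast
    then have disj': "disjoint_family_on (\<lambda>i. B i - K) F" unfolding disjoint_family_on_def by blast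
    have Bm: "B i \<in> sets lebesgue" "B i - K \<in> sets lebesgue" for i
      using closed_K by (auto simp: B_def)
    have Ble: "emeasure lebesgue (B i) \<le> ennreal Q * emeasure lebesgue (B i - K)" if "i \<in> F" for i
    proof -
      have fin: "B i \<in> fmeasurable lborel"
        by (auto simp: B_def cball_eq_atLeastAtMost fmeasurable_def emeasure_lborel_Icc_eq)
      then have fin': "B i - K \<in> fmeasurable lborel" using closed_K by (intro fmeasurable_Diff) auto
      have "measure lborel (B i) \<le> Q * measure lborel (B i - K)"
        using that F(2) by (auto simp: I_def B_def)
      then have "emeasure lborel (B i) \<le> ennreal (Q * measure lborel (B i - K))"
        unfolding emeasure_eq_measure2[OF fin] by (rule ennreal_leI)
      also have "\<dots> = ennreal Q * emeasure lborel (B i - K)"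
        unfolding emeasure_eq_measure2[OF fin'] using Q by (simp add: ennreal_mult)
      finally show ?thesis
        using fin fin' by (simp add: fmeasurable_def emeasure_completion)
    qed
    have BW: "B i \<subseteq> W" if "i \<in> F" for i
      using subsetD[OF F(2) that] by (cases i) (auto simp: I_def B_def)
    have "emeasure lebesgue U = (\<integral>\<^sup>+ i. emeasure lebesgue (B i) \<partial>count_space F)"
      unfolding U_def using F(1) disj Bm by (intro emeasure_UN_countable) auto
    also have "\<dots> \<le> (\<integral>\<^sup>+ i. ennreal Q * emeasure lebesgue (B i - K) \<partial>count_space F)"
      by (intro nn_integral_mono) (use Ble in auto)
    also have "\<dots> = ennreal Q * (\<integral>\<^sup>+ i. emeasure lebesgue (B i - K) \<partial>count_space F)"
      by (intro nn_integral_cmult) auto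
    also have "(\<integral>\<^sup>+ i. emeasure lebesgue (B i - K) \<partial>count_space F) = emeasure lebesgue (\<Union>i\<in>F. B i - K)"
      using F(1) disj' Bm by (intro emeasure_UN_countable[symmetric]) auto
    also have "\<dots> \<le> emeasure lebesgue (W - K)"
      using BW W(3) by (intro emeasure_mono) auto
    also have "ennreal Q * emeasure lebesgue (W - K) \<le> ennreal Q * ennreal (e / (2 * Q))"
      using W(4) by (intro mult_left_mono) auto
    also have "\<dots> = ennreal (e / 2)" using Q e by (simp add: ennreal_mult[symmetric])
    finally have Ule: "emeasure lebesgue U \<le> ennreal (e / 2)" by (simp add: mult_left_mono)
    have Um: "U \<in> sets lebesgue" unfolding U_def using F(1) Bm by blast
    have U: "U \<in> lmeasurable" using le_less_trans[OF Ule ennreal_less_top] by (intro fmeasurableI Um) simp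
    have "measure lebesgue U \<le> e / 2"
      using Ule e U by (simp add: emeasure_eq_measure2)
    have N: "?S - U \<in> null_sets lebesgue"
      using F(4) by (simp add: U_def B_def negligible_iff_null_sets)
    have "(?S - U) \<union> U \<in> lmeasurable" using N U by (intro fmeasurable.Un) (auto simp: negligible_iff_null_sets[symmetric] negligible_imp_measurable)
    moreover have "measure lebesgue ((?S - U) \<union> U) \<le> e / 2"
      using \<open>measure lebesgue U \<le> e / 2\<close> measure_Un_null_set[OF Um N] by (simp add: Un_commute)
    ultimately show "\<exists>T. ?S \<subseteq> T \<and> T \<in> lmeasurable \<and> measure lebesgue T < e"
      using e by (intro exI[of _ "(?S - U) \<union> U"]) auto
  qed
qed

end

section \<open>Absolutely continuous invariant measures\<close>

locale sturmian_acip = sturmian_map +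
  fixes \<mu> :: "real measure"
  assumes acip: "is_acip lo hi f \<mu>"
begin

sublocale prob_space \<mu> using acip by (simp add: is_acip_def)

lemma sets_mu: "A \<in> sets \<mu> \<longleftrightarrow> A \<subseteq> {lo..hi} \<and> A \<in> sets borel"
proof -
  have "sets \<mu> = sets (restrict_space borel {lo..hi})" using acip by (simp add: is_acip_def)
  then show ?thesis by (simp add: sets_restrict_space_iff)
qed

lemma space_mu: "space \<mu> = {lo..hi}"
proof -
  have "sets \<mu> = sets (restrict_space borel {lo..hi})" using acip by (simp add: is_acip_def)
  then have "space \<mu> = space (restrict_space borel {lo..hi} :: real measure)" by (rule sets_eq_imp_space_eq)
  then show ?thesis by (simp add: space_restrict_space)
qed

lemma iter_distr: "f ^^ n \<in> measurable \<mu> \<mu> \<and> distr \<mu> \<mu> (f ^^ n) = \<mu>"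
proof (induction n)
  case 0
  show ?case by (simp add: id_def distr_id)
next
  case (Suc n)
  have f: "f \<in> measurable \<mu> \<mu>" "distr \<mu> \<mu> f = \<mu>" using acip by (auto simp: is_acip_def)
  have "distr \<mu> \<mu> (f \<circ> f ^^ n) = distr (distr \<mu> \<mu> (f ^^ n)) \<mu> f"
    using Suc f by (intro distr_distr[symmetric]) auto
  moreover have "f \<circ> f ^^ n \<in> measurable \<mu> \<mu>" using Suc f by (blast intro: measurable_comp)
  moreover have "f ^^ Suc n = f \<circ> f ^^ n" by simp
  ultimately show ?case using Suc f by argo
qed

lemma measure_iter_vimage:
  assumes "A \<in> sets \<mu>"
  shows "(f ^^ n) -` A \<inter> {lo..hi} \<in> sets \<mu>" "measure \<mu> ((f ^^ n) -` A \<inter> {lo..hi}) = measure \<mu> A"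
  using iter_distr[of n] measure_distr[of "f ^^ n" \<mu> \<mu> A] measurable_sets[of "f ^^ n" \<mu> \<mu> A] assms
  by (auto simp: space_mu)

lemma measure_push:
  assumes "A \<in> sets \<mu>" "B \<in> sets \<mu>" "(f ^^ n) ` A \<subseteq> B" shows "measure \<mu> A \<le> measure \<mu> B"
proof -
  have "A \<subseteq> (f ^^ n) -` B \<inter> {lo..hi}" using assms by (auto simp: sets_mu)
  then show ?thesis
    using finite_measure_mono[OF _ measure_iter_vimage(1)[OF assms(2), of n]] measure_iter_vimage(2)[OF assms(2), of n]
    by simp
qed

lemma null_mu: assumes "A \<in> sets borel" "A \<subseteq> {lo..hi}" "A \<in> null_sets lborel" shows "A \<in> null_sets \<mu>"
proof -
  have "A \<in> null_sets (restrict_space lborel {lo..hi})"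
    using assms by (simp add: null_sets_restrict_space)
  then show ?thesis using acip unfolding is_acip_def absolutely_continuous_def by blast
qed

lemma null_finite: "finite A \<Longrightarrow> A \<subseteq> {lo..hi} \<Longrightarrow> A \<in> null_sets \<mu>"
  by (intro null_mu finite_imp_null_set_lborel) (auto intro: finite_imp_closed borel_closed)

text \<open>By invariance no image has less mass than the interval itself. Since the images are
  disjoint and the total mass is 1, the mass is 0; no absence of wandering intervals is
  asserted.\<close>

lemma homterval_null: assumes h: "homterval p q" shows "{p..q} \<in> null_sets \<mu>"
proof -
  have pq: "lo \<le> p" "p < q" "q \<le> hi" using h by (auto simp: homterval_def)
  define I where "I n = (f ^^ n) ` {p<..<q}" for n
  have Im: "I n \<in> sets \<mu>" for n
  proof -
    have "continuous_on {p..q} (f ^^ n)" using pq by (intro continuous_on_subset[OF iter_cont]) auto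
    then have "I n \<in> sets borel" unfolding I_def using smono_image_Ioo[OF homterval_smono[OF h] _ pq(2)] by simp
    moreover have "I n \<subseteq> {lo..hi}" unfolding I_def using pq iter_in by force
    ultimately show ?thesis by (simp add: sets_mu)
  qed
  have H: "{p<..<q} \<in> sets \<mu>" using pq by (auto simp: sets_mu)
  have disj: "disjoint_family I"
    unfolding disjoint_family_on_def I_def using homterval_images_disjoint[OF h] by (metis Int_commute linorder_neqE_nat)
  have le: "real k * measure \<mu> {p<..<q} \<le> 1" for k
  proof -
    have "real k * measure \<mu> {p<..<q} = (\<Sum>n<k. measure \<mu> {p<..<q})" by simp
    also have "\<dots> \<le> (\<Sum>n<k. measure \<mu> (I n))"
      by (intro sum_mono measure_push[OF H Im]) (auto simp: I_def)
    also have "\<dots> = measure \<mu> (\<Union>n<k. I n)"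
      by (rule finite_measure_finite_Union[symmetric])
        (use Im disj in \<open>auto simp: disjoint_family_on_def\<close>)
    also have "\<dots> \<le> 1" by simp
    finally show ?thesis .
  qed
  have "measure \<mu> {p<..<q} = 0"
  proof (rule ccontr)
    assume "measure \<mu> {p<..<q} \<noteq> 0"
    then have "measure \<mu> {p<..<q} > 0" by (simp add: zero_less_measure_iff)
    then obtain k where "1 < real k * measure \<mu> {p<..<q}" using reals_Archimedean3 by blast
    then show False using le[of k] by simp
  qed
  then have "{p<..<q} \<in> null_sets \<mu>" using H by (intro null_setsI) (simp_all add: emeasure_eq_measure)
  moreover have "{p, q} \<in> null_sets \<mu>" using pq by (intro null_finite) auto
  ultimately have "{p<..<q} \<union> {p, q} \<in> null_sets \<mu>" by (rule null_sets.Un)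
  moreover have "{p<..<q} \<union> {p, q} = {p..q}" using pq by auto
  ultimately show ?thesis by simp
qed

text \<open>All homtervals starting, or all ending, at a given r lie in one maximal homterval, which
  is null. A homterval with an end at \<open>x\<close> can be shortened at its other end to a
  rational r, so countably many null sets suffice.\<close>

lemma not_good_null: obtains B where "B \<in> null_sets \<mu>" "\<And>x. x \<in> {lo..hi} \<Longrightarrow> x \<notin> B \<Longrightarrow> good x"
proof -
  have up: "\<exists>N\<in>null_sets \<mu>. {x. homterval r x} \<subseteq> N" for r
  proof (cases "{x. homterval r x} = {}")
    case False
    let ?S = "{x. homterval r x}"
    have bdd: "bdd_above ?S" by (rule bdd_aboveI[of _ hi]) (auto simp: homterval_def)
    obtain w where w: "homterval r w" using False by blast
    have up: "x \<le> Sup ?S" if "homterval r x" for x using that by (intro cSup_upper bdd) simp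
    have "lo \<le> r \<and> r < Sup ?S \<and> Sup ?S \<le> hi \<and> (\<forall>n x. r < x \<longrightarrow> x < Sup ?S \<longrightarrow> (f ^^ n) x \<noteq> c)"
    proof (intro conjI allI impI)
      show "lo \<le> r" "r < Sup ?S" using w up[OF w] by (auto simp: homterval_def)
      show "Sup ?S \<le> hi" using False by (intro cSup_least) (auto simp: homterval_def)
      fix n x assume x: "r < x" "x < Sup ?S"
      obtain v where "v \<in> ?S" "x < v" using less_cSupD[OF False x(2)] by blast
      then show "(f ^^ n) x \<noteq> c" using x by (auto simp: homterval_def)
    qed
    then have "{r..Sup ?S} \<in> null_sets \<mu>"
      by (intro homterval_null homterval_def[of r "Sup ?S", THEN iffD2])
    moreover have "?S \<subseteq> {r..Sup ?S}" using up by (auto simp: homterval_def)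
    ultimately show ?thesis by blast
  qed auto
  have low: "\<exists>N\<in>null_sets \<mu>. {x. homterval x r} \<subseteq> N" for r
  proof (cases "{x. homterval x r} = {}")
    case False
    let ?S = "{x. homterval x r}"
    have bdd: "bdd_below ?S" by (rule bdd_belowI[of _ lo]) (auto simp: homterval_def)
    obtain w where w: "homterval w r" using False by blast
    have low: "Inf ?S \<le> x" if "homterval x r" for x using that by (intro cInf_lower bdd) simp
    have "lo \<le> Inf ?S \<and> Inf ?S < r \<and> r \<le> hi \<and> (\<forall>n x. Inf ?S < x \<longrightarrow> x < r \<longrightarrow> (f ^^ n) x \<noteq> c)"
    proof (intro conjI allI impI)
      show "r \<le> hi" "Inf ?S < r" using w low[OF w] by (auto simp: homterval_def)
      show "lo \<le> Inf ?S" using False by (intro cInf_greatest) (auto simp: homterval_def)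
      fix n x assume x: "Inf ?S < x" "x < r"
      obtain v where "v \<in> ?S" "v < x" using cInf_lessD[OF False x(1)] by blast
      then show "(f ^^ n) x \<noteq> c" using x by (auto simp: homterval_def)
    qed
    then have "{Inf ?S..r} \<in> null_sets \<mu>"
      by (intro homterval_null homterval_def[of "Inf ?S" r, THEN iffD2])
    moreover have "?S \<subseteq> {Inf ?S..r}" using low by (auto simp: homterval_def)
    ultimately show ?thesis by blast
  qed auto
  obtain N1 where N1: "\<And>r. N1 r \<in> null_sets \<mu>" "\<And>r. {x. homterval r x} \<subseteq> N1 r" using up by metis
  obtain N2 where N2: "\<And>r. N2 r \<in> null_sets \<mu>" "\<And>r. {x. homterval x r} \<subseteq> N2 r" using low by metis
  define B where "B = {lo, hi} \<union> (\<Union>n. {x \<in> {lo..hi}. (f ^^ n) x = c}) \<union> (\<Union>r\<in>\<rat>. N1 r \<union> N2 r)"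
  show thesis
  proof
    show "B \<in> null_sets \<mu>"
      unfolding B_def using lo_less_c c_less_hi
      by (intro null_sets.Un null_sets_UN null_sets_UN' null_finite finite_iter_eq_c N1 N2 countable_rat) auto
    fix x assume x: "x \<in> {lo..hi}" "x \<notin> B"
    show "good x"
      unfolding good_def
    proof (intro conjI allI notI)
      show "x \<in> {lo<..<hi}" using x by (auto simp: B_def less_le)
      show "False" if "(f ^^ n) x = c" for n using x that by (auto simp: B_def)
      show "False" if h: "homterval p x" for p
      proof -
        obtain r where r: "r \<in> \<rat>" "p < r" "r < x" using Rats_dense_in_real[of p x] h by (auto simp: homterval_def)
        then have "homterval r x" using h by (auto simp: homterval_def)
        then show False using N1(2) x r by (auto simp: B_def)
      qed
      show "False" if h: "homterval x q" for q
      proof -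
        obtain r where r: "r \<in> \<rat>" "x < r" "r < q" using Rats_dense_in_real[of x q] h by (auto simp: homterval_def)
        then have "homterval x r" using h by (auto simp: homterval_def)
        then show False using N2(2) x r by (auto simp: B_def)
      qed
    qed
  qed
qed

text \<open>The good points of \<open>K\<close> are negligible for Lebesgue measure, hence for
  \<mu>; the other points are \<mu>-null for a different reason, by
  \<open>not_good_null\<close>.\<close>

lemma K_null: "K \<in> null_sets \<mu>"
proof -
  obtain B where B: "B \<in> null_sets \<mu>" "\<And>x. x \<in> {lo..hi} \<Longrightarrow> x \<notin> B \<Longrightarrow> good x"
    using not_good_null by metis
  have Bb: "B \<in> sets borel" using B(1) sets_mu by (auto simp: null_sets_def)
  have "K - B \<subseteq> {x \<in> K. good x}" using B(2) K_subset by auto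
  then have "negligible (K - B)" using negligible_good_K negligible_subset by blast
  moreover have KB: "K - B \<in> sets borel" using closed_K Bb by auto
  ultimately have "K - B \<in> null_sets lborel"
    by (simp add: negligible_iff_null_sets null_sets_completion_iff)
  then have "K - B \<in> null_sets \<mu>" using KB K_subset by (intro null_mu) auto
  then have "(K - B) \<union> B \<in> null_sets \<mu>" using B(1) by blast
  then show ?thesis by (rule null_sets_subset) (use closed_K K_subset in \<open>auto simp: sets_mu\<close>)
qed

end

section \<open>The invariant density is bounded below near the critical point\<close>

context sturmian_map
begin

text \<open>A branch image contains the target interval itself, or else an interval that
  \<open>f\<close> maps onto the one from \<open>f (f c)\<close> to \<open>c\<close>. This is why
  \<open>branch_mass\<close> has to allow the two times \<open>n\<close> and
  \<open>Suc n\<close>.\<close>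

lemma tower_preimage_of_central:
  assumes tower: "tower s t" and y: "f (f c) \<le> y1" "y1 < y2" "y2 \<le> c"
  obtains z1 z2 where "z1 < z2" "{z1..z2} \<subseteq> {s..t}" "y2 - y1 \<le> L * (z2 - z1)"
    "\<And>x. x \<in> {z1..z2} \<Longrightarrow> x \<in> {y1..y2} \<or> f x \<in> {y1..y2}"
  using tower
proof (cases rule: tower_cases)
  case 2
  have "y2 - y1 \<le> L * (y2 - y1)" using L(1) y by (simp add: mult_le_cancel_right1)
  then show thesis using that[of y1 y2] 2 y by auto
next
  case 1
  have sm: "smono x1 (f c) f" by (rule smono_subset[OF smono_right]) (use x1 c1_le_hi in auto)
  have y': "min (f x1) (f (f c)) \<le> y1" "y2 \<le> max (f x1) (f (f c))" using y x1 by auto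
  have lox: "lo \<le> x1" using x1 lo_less_c by simp
  obtain z1 z2 where "x1 \<le> z1" "z1 < z2" "z2 \<le> f c" "f ` {z1..z2} \<subseteq> {y1..y2}" "y2 - y1 \<le> L * (z2 - z1)"
    by (rule interval_preimage[OF sm lox x1(2) c1_le_hi y'(1) y(2) y'(2)]) (rule that; assumption)
  then show thesis using that[of z1 z2] 1 by (auto simp: image_subset_iff)
qed

text \<open>The ends of the branch image belong to \<open>K\<close>, so points mapped to distance at
  least \<open>d\<close> from \<open>K\<close> lie in the part to which
  \<open>branch_proportion\<close> applies.\<close>

lemma branch_mass:
  assumes br: "branch n a b" and n: "n \<ge> 1" and d: "d > 0" and y: "f (f c) \<le> y1" "y1 < y2" "y2 \<le> c"
    and A: "A \<in> sets borel" "A \<subseteq> {a<..<b}" "\<And>x. x \<in> A \<Longrightarrow> infdist ((f ^^ n) x) K \<ge> d"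
  shows "measure lborel A * (y2 - y1) \<le> (2 * (hi - lo)\<^sup>2 / d + (hi - lo)) * L *
    measure lborel ({a<..<b} \<inter> {x \<in> {lo..hi}. (f ^^ n) x \<in> {y1..y2} \<or> (f ^^ Suc n) x \<in> {y1..y2}})"
proof -
  define C where "C = 2 * (hi - lo)\<^sup>2 / d + (hi - lo)"
  define s t where "s = min ((f ^^ n) a) ((f ^^ n) b)" and "t = max ((f ^^ n) a) ((f ^^ n) b)"
  have C: "C \<ge> 0" using d lo_less_c c_less_hi by (simp add: C_def)
  note b = branch_bounds[OF br]
  have cont: "continuous_on {a..b} (f ^^ n)" using b by (intro continuous_on_subset[OF iter_cont]) auto
  have tower: "tower s t" using branch_tower[OF br n] by (simp add: s_def t_def)
  obtain z1 z2 where z: "z1 < z2" "{z1..z2} \<subseteq> {s..t}" "y2 - y1 \<le> L * (z2 - z1)"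
    "\<And>x. x \<in> {z1..z2} \<Longrightarrow> x \<in> {y1..y2} \<or> f x \<in> {y1..y2}"
    by (rule tower_preimage_of_central[OF tower y]) (assumption | rule that)+
  define M where "M = {x \<in> {a..b}. (f ^^ n) x \<in> {s + d..t - d}}"
  define Z where "Z = {x \<in> {a..b}. (f ^^ n) x \<in> {z1..z2}}"
  define G where "G = {a<..<b} \<inter> {x \<in> {lo..hi}. (f ^^ n) x \<in> {y1..y2} \<or> (f ^^ Suc n) x \<in> {y1..y2}}"
  have pre: "{a..b} \<inter> (f ^^ n) -` {v..w} \<in> sets borel" for v w
    by (intro borel_closed continuous_closed_preimage[OF cont]) auto
  have eq: "M = {a..b} \<inter> (f ^^ n) -` {s + d..t - d}" "Z = {a..b} \<inter> (f ^^ n) -` {z1..z2}"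
    by (auto simp: M_def Z_def)
  have M: "M \<in> sets borel" "M \<subseteq> {a..b}" and Z: "Z \<in> sets borel" "Z \<subseteq> {a..b}"
    unfolding eq using pre by auto
  have fin: "S \<in> fmeasurable lborel" if "S \<in> sets borel" "S \<subseteq> {a..b}" for S
    by (rule fmeasurableI2[of "{a..b}"]) (use that in \<open>auto simp: fmeasurable_def emeasure_lborel_Icc_eq\<close>)
  have "A \<subseteq> M"
  proof
    fix x assume x: "x \<in> A"
    then have xab: "x \<in> {a<..<b}" using A by auto
    have "s < (f ^^ n) x" "(f ^^ n) x < t"
      using smono_split[OF branch_smono[OF br], of x] xab by (auto simp: s_def t_def)
    moreover have "d \<le> dist ((f ^^ n) x) s" "d \<le> dist ((f ^^ n) x) t"
      using A(3)[OF x] infdist_le[OF tower_K(1)[OF tower], of "(f ^^ n) x"]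
        infdist_le[OF tower_K(2)[OF tower], of "(f ^^ n) x"] by linarith+
    ultimately show "x \<in> M" using xab by (auto simp: M_def dist_real_def)
  qed
  then have AM: "measure lborel A \<le> measure lborel M"
    using A M by (intro measure_mono_fmeasurable fin) auto
  have le: "measure lborel M * (z2 - z1) \<le> C * measure lborel Z"
    using branch_proportion[OF br d z(1)] z(2) unfolding s_def t_def M_def Z_def C_def by simp
  have Gm: "G \<in> sets borel"
  proof -
    have cl: "{lo..hi} \<inter> (f ^^ k) -` {y1..y2} \<in> sets borel" for k
      by (intro borel_closed continuous_closed_preimage[OF iter_cont]) auto
    have "G = {a<..<b} \<inter> (({lo..hi} \<inter> (f ^^ n) -` {y1..y2}) \<union> ({lo..hi} \<inter> (f ^^ Suc n) -` {y1..y2}))"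
      by (auto simp: G_def)
    then show ?thesis using cl[of n] cl[of "Suc n"] by (simp only: sets.Int sets.Un borel_open open_greaterThanLessThan)
  qed
  \<comment> \<open>\<open>Z\<close> lives on the closed branch and \<open>G\<close> on the open
    one. The open form makes the contributions of different branches disjoint later.\<close>
  have "Z \<subseteq> G \<union> {a, b}"
  proof
    fix x assume x: "x \<in> Z"
    then have "(f ^^ n) x \<in> {y1..y2} \<or> (f ^^ Suc n) x \<in> {y1..y2}" using z(4)[of "(f ^^ n) x"] by (simp add: Z_def)
    moreover have xab: "x \<in> {a..b}" using x by (simp add: Z_def)
    moreover have "x \<in> {lo..hi}" using xab b by auto
    ultimately have "x \<in> {a<..<b} \<Longrightarrow> x \<in> G" unfolding G_def by blast
    moreover have "x \<in> {a<..<b} \<or> x \<in> {a, b}" using xab by auto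
    ultimately show "x \<in> G \<union> {a, b}" by blast
  qed
  moreover have "G \<union> {a, b} \<in> fmeasurable lborel"
  proof (rule fin)
    show "G \<union> {a, b} \<in> sets borel" using Gm by simp
    have "G \<subseteq> {a<..<b}" unfolding G_def by blast
    also have "\<dots> \<subseteq> {a..b}" by auto
    finally show "G \<union> {a, b} \<subseteq> {a..b}" using b by simp
  qed
  ultimately have "measure lborel Z \<le> measure lborel (G \<union> {a, b})"
    using Z by (intro measure_mono_fmeasurable) simp_all
  also have "\<dots> = measure lborel G"
    using Gm by (intro measure_Un_null_set finite_imp_null_set_lborel) auto
  finally have ZG: "measure lborel Z \<le> measure lborel G" .
  have "measure lborel A * (y2 - y1) \<le> measure lborel M * (L * (z2 - z1))"
    using AM z y by (intro mult_mono) auto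
  also have "\<dots> = L * (measure lborel M * (z2 - z1))" by simp
  also have "\<dots> \<le> L * (C * measure lborel G)"
    using ZG C L(1) by (intro mult_left_mono order_trans[OF le] mult_left_mono) auto
  finally show ?thesis by (simp add: C_def G_def mult_ac)
qed

end

context sturmian_acip
begin

text \<open>\<open>P\<close> is a superlevel set of the Radon-Nikodym density without the
  exceptional null set. If all of these were \<mu>-null, \<mu> would vanish, because the zero set of
  the density is null too.\<close>

lemma density_part:
  obtains P t where "P \<in> sets borel" "P \<subseteq> {lo..hi}" "t > 0" "measure lborel P > 0" "\<And>x. x \<in> P \<Longrightarrow> good x"
    "\<And>A. A \<in> sets borel \<Longrightarrow> A \<subseteq> P \<Longrightarrow> t * measure lborel A \<le> measure \<mu> A"
proof -
  define R where "R = restrict_space lborel {lo..hi}"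
  have sR: "sets R = sets \<mu>" using acip by (simp add: is_acip_def R_def sets_restrict_space)
  have spR: "space R = {lo..hi}" by (simp add: R_def space_restrict_space)
  have eR: "emeasure R A = emeasure lborel A" if "A \<subseteq> {lo..hi}" for A
    unfolding R_def using that by (intro emeasure_restrict_space) auto
  interpret R: finite_measure R
    by (rule finite_measureI) (simp add: spR eR emeasure_lborel_Icc_eq)
  define h where "h = RN_deriv R \<mu>"
  have h[measurable]: "h \<in> borel_measurable R" by (simp add: h_def)
  have dens: "density R h = \<mu>"
    unfolding h_def using acip sR by (intro R.density_RN_deriv) (auto simp: is_acip_def R_def)
  have em: "emeasure \<mu> A = (\<integral>\<^sup>+ x. h x * indicator A x \<partial>R)" if "A \<in> sets \<mu>" for A
    using emeasure_density[OF h, of A] that sR dens by simp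
  obtain B where B: "B \<in> null_sets \<mu>" "\<And>x. x \<in> {lo..hi} \<Longrightarrow> x \<notin> B \<Longrightarrow> good x"
    using not_good_null by metis
  have Bs: "B \<in> sets \<mu>" using B(1) by blast
  define P where "P k = {x \<in> {lo..hi}. ennreal (1 / Suc k) \<le> h x} - B" for k :: nat
  define Z where "Z = {x \<in> {lo..hi}. h x = 0}"
  have Ps: "P k \<in> sets \<mu>" for k
  proof -
    have "{x \<in> space R. ennreal (1 / Suc k) \<le> h x} \<in> sets R" by measurable
    then show ?thesis unfolding P_def spR using Bs sR by auto
  qed
  have Zs: "Z \<in> sets \<mu>"
  proof -
    have "{x \<in> space R. h x = 0} \<in> sets R" by measurable
    then show ?thesis unfolding Z_def spR sR .
  qed
  have "emeasure \<mu> Z = (\<integral>\<^sup>+ x. 0 \<partial>R)"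
    unfolding em[OF Zs] by (intro nn_integral_cong) (auto simp: Z_def indicator_def)
  then have Zn: "Z \<in> null_sets \<mu>" using Zs by auto
  have "\<exists>k. P k \<notin> null_sets \<mu>"
  proof (rule ccontr)
    assume "\<not> (\<exists>k. P k \<notin> null_sets \<mu>)"
    then have null: "(\<Union>k. P k) \<union> B \<union> Z \<in> null_sets \<mu>" using B(1) Zn by auto
    have "{lo..hi} \<subseteq> (\<Union>k. P k) \<union> B \<union> Z"
    proof
      fix x assume x: "x \<in> {lo..hi}"
      show "x \<in> (\<Union>k. P k) \<union> B \<union> Z"
      proof (cases "x \<in> B \<or> h x = 0")
        case False
        then have "h x > 0" by (simp add: zero_less_iff_neq_zero)
        then obtain e where e: "e > 0" "ennreal e \<le> h x"
        proof (cases "h x" rule: ennreal_cases)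
          case (real r)
          then show thesis using that[of r] \<open>h x > 0\<close> by auto
        next
          case top
          then show thesis using that[of 1] by auto
        qed
        obtain k where "inverse (real (Suc k)) < e" using reals_Archimedean[OF e(1)] by blast
        then have "ennreal (1 / Suc k) \<le> ennreal e" by (intro ennreal_leI) (simp add: inverse_eq_divide)
        then have "x \<in> P k" using x False e(2) by (auto simp: P_def)
        then show ?thesis by blast
      qed (use x in \<open>auto simp: Z_def\<close>)
    qed
    then have "{lo..hi} \<in> null_sets \<mu>" by (intro null_sets_subset[OF null]) (simp add: sets_mu)
    then show False using emeasure_space_1 by (simp add: space_mu null_sets_def)
  qed
  then obtain k where k: "P k \<notin> null_sets \<mu>" by blast
  have Pb: "P k \<in> sets borel" "P k \<subseteq> {lo..hi}" using Ps[of k] by (auto simp: sets_mu)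
  have fin: "emeasure lborel A < \<infinity>" if "A \<subseteq> {lo..hi}" "A \<in> sets borel" for A
    by (rule le_less_trans[OF emeasure_mono[OF that(1)]]) (auto simp: emeasure_lborel_Icc_eq)
  show thesis
  proof (rule that[of "P k" "1 / Suc k"])
    have "P k \<notin> null_sets lborel" using k null_mu Pb by blast
    then have "emeasure lborel (P k) \<noteq> 0" using Pb by (simp add: null_sets_def)
    then show "measure lborel (P k) > 0"
      using fin[OF Pb(2,1)] by (simp add: measure_def enn2real_positive_iff zero_less_iff_neq_zero less_top)
    show "good x" if "x \<in> P k" for x using that B(2) by (auto simp: P_def)
    fix A assume A: "A \<in> sets borel" "A \<subseteq> P k"
    have As: "A \<in> sets \<mu>" "A \<in> sets R" using A Pb sR by (auto simp: sets_mu)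
    have AX: "A \<subseteq> {lo..hi}" using A Pb by auto
    have "ennreal (1 / Suc k * measure lborel A) = ennreal (1 / Suc k) * emeasure lborel A"
    proof -
      have "A \<in> fmeasurable lborel" using fin[OF AX A(1)] A(1) by (intro fmeasurableI) auto
      then show ?thesis by (simp only: emeasure_eq_measure2) (rule ennreal_mult; simp)
    qed
    also have "\<dots> = ennreal (1 / Suc k) * emeasure R A" using eR[OF AX] by simp
    also have "\<dots> = (\<integral>\<^sup>+ x. ennreal (1 / Suc k) * indicator A x \<partial>R)"
      by (rule nn_integral_cmult_indicator[OF As(2), symmetric])
    also have "\<dots> \<le> (\<integral>\<^sup>+ x. h x * indicator A x \<partial>R)"
      using A(2) by (intro nn_integral_mono) (auto simp: indicator_def P_def)
    also have "\<dots> = ennreal (measure \<mu> A)" using em[OF As(1)] by (simp add: emeasure_eq_measure)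
    finally show "1 / Suc k * measure lborel A \<le> measure \<mu> A" by (simp add: ennreal_le_iff)
  qed (use Pb in auto)
qed

lemma K_neighbourhood_small:
  assumes "e > 0"
  obtains d where "d > 0" "{x \<in> {lo..hi}. infdist x K < d} \<in> sets \<mu>" "measure \<mu> {x \<in> {lo..hi}. infdist x K < d} \<le> e"
proof -
  define N where "N k = {x \<in> {lo..hi}. infdist x K < inverse (Suc k)}" for k :: nat
  have Ns: "N k \<in> sets \<mu>" for k
  proof -
    have "open {x. infdist x K < inverse (Suc k)}" by (intro open_Collect_less continuous_intros)
    then have "{lo..hi} \<inter> {x. infdist x K < inverse (Suc k)} \<in> sets borel" by auto
    moreover have "{lo..hi} \<inter> {x. infdist x K < inverse (Suc k)} = N k" by (auto simp: N_def)
    ultimately show ?thesis by (auto simp: sets_mu N_def)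
  qed
  have "decseq N"
    unfolding decseq_def N_def
  proof (intro allI impI subsetI)
    fix m n x assume mn: "m \<le> n" and x: "x \<in> {x \<in> {lo..hi}. infdist x K < inverse (real (Suc n))}"
    have "infdist x K < inverse (real (Suc n))" using x by simp
    also have "\<dots> \<le> inverse (real (Suc m))" using mn by (intro le_imp_inverse_le) auto
    finally show "x \<in> {x \<in> {lo..hi}. infdist x K < inverse (real (Suc m))}" using x by simp
  qed
  then have lim: "(\<lambda>k. measure \<mu> (N k)) \<longlonglongrightarrow> measure \<mu> (\<Inter>k. N k)"
    using Ns by (intro finite_Lim_measure_decseq) auto
  have Kne: "K \<noteq> {}" using tower_K(1)[of lo "f c"] by (auto simp: tower_def)
  have "(\<Inter>k. N k) \<subseteq> K"
  proof
    fix x assume x: "x \<in> (\<Inter>k. N k)"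
    have "infdist x K = 0"
    proof (rule ccontr)
      assume "infdist x K \<noteq> 0"
      then have "infdist x K > 0" using infdist_nonneg[of x K] by simp
      then obtain k where "inverse (real (Suc k)) < infdist x K" using reals_Archimedean by blast
      moreover have "infdist x K < inverse (real (Suc k))" using x by (auto simp: N_def)
      ultimately show False by simp
    qed
    then show "x \<in> K" using in_closed_iff_infdist_zero[OF closed_K Kne] by blast
  qed
  then have "(\<Inter>k. N k) \<in> null_sets \<mu>"
    using K_null Ns by (intro null_sets_subset[OF K_null]) auto
  then have "measure \<mu> (\<Inter>k. N k) = 0" by (simp add: measure_eq_0_null_sets)
  then have "\<forall>\<^sub>F k in sequentially. measure \<mu> (N k) < e" using order_tendstoD(2)[OF lim] assms by simp
  then obtain k where "measure \<mu> (N k) < e" using eventually_happens by force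
  then show thesis using that[of "inverse (Suc k)"] Ns[of k] by (auto simp: N_def)
qed

text \<open>On \<open>P\<close> Lebesgue measure is at most 1 / t times \<mu>, but the preimages of
  the target found by \<open>branch_mass\<close> may leave \<open>P\<close>. Therefore only branches
  inside an open set \<open>W\<close> around \<open>P\<close> are used, and the measure of
  \<open>W - P\<close> enters as an error \<open>e\<close> that tends to 0. The iterate
  \<open>n\<close> depends on \<open>e\<close>, while \<open>t\<close>, \<open>m\<close>,
  \<open>d\<close> and \<open>C\<close> do not.\<close>

lemma density_bound_central:
  obtains \<kappa> where "\<kappa> > 0"
    "\<And>y1 y2. f (f c) \<le> y1 \<Longrightarrow> y1 < y2 \<Longrightarrow> y2 \<le> c \<Longrightarrow> \<kappa> * (y2 - y1) \<le> measure \<mu> {y1..y2}"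
proof -
  obtain P t where P: "P \<in> sets borel" "P \<subseteq> {lo..hi}" "t > 0" "measure lborel P > 0" "\<And>x. x \<in> P \<Longrightarrow> good x"
    "\<And>A. A \<in> sets borel \<Longrightarrow> A \<subseteq> P \<Longrightarrow> t * measure lborel A \<le> measure \<mu> A"
    using density_part by metis
  define m where "m = measure lborel P"
  have m: "m > 0" using P by (simp add: m_def)
  \<comment> \<open>By invariance the preimages of this neighbourhood have the same mass, so for
    every iterate they meet \<open>P\<close> in Lebesgue measure at most m / 4.\<close>
  obtain d where d: "d > 0" "{x \<in> {lo..hi}. infdist x K < d} \<in> sets \<mu>"
    "measure \<mu> {x \<in> {lo..hi}. infdist x K < d} \<le> t * m / 4"
    using K_neighbourhood_small[of "t * m / 4"] P(3) m by auto
  define N where "N = {x \<in> {lo..hi}. infdist x K < d}"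
  define C where "C = (2 * (hi - lo)\<^sup>2 / d + (hi - lo)) * L"
  have C: "C > 0" using d(1) L(1) lo_less_c c_less_hi by (auto simp: C_def intro!: mult_pos_pos add_nonneg_pos)
  have finX: "S \<in> fmeasurable lborel" if "S \<in> sets borel" "S \<subseteq> {lo..hi}" for S
    by (rule fmeasurableI2[of "{lo..hi}"]) (use that in \<open>auto simp: fmeasurable_def emeasure_lborel_Icc_eq\<close>)
  show thesis
  proof (rule that[of "t * m / (4 * C)"])
    show "t * m / (4 * C) > 0" using P(3) m C by simp
    fix y1 y2 assume y: "f (f c) \<le> y1" "y1 < y2" "y2 \<le> c"
    have c2: "f (f c) \<in> {lo..hi}" using iter_c_in[of 2] by (simp add: numeral_2_eq_2)
    have Js: "{y1..y2} \<in> sets \<mu>" using y c2 c_less_hi by (auto simp: sets_mu)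
    have "m / 2 * (y2 - y1) \<le> C * (2 * measure \<mu> {y1..y2} / t) + e" if e: "e > 0" for e
    proof -
      have "P \<in> sets lebesgue" using P(1) by (intro sets_completionI_sets) simp
      then obtain W where W: "open W" "P \<subseteq> W" "W - P \<in> lmeasurable" "emeasure lebesgue (W - P) < ennreal (e / C)"
        using sets_lebesgue_outer_open[of P "e / C"] e C by auto
      have WPb: "W - P \<in> sets borel" using W(1) P(1) by auto
      have WP: "measure lborel (W - P) \<le> e / C" "W - P \<in> fmeasurable lborel"
      proof -
        have eq: "emeasure lborel (W - P) < ennreal (e / C)"
          using W(4) WPb by (simp add: emeasure_completion)
        then show fm: "W - P \<in> fmeasurable lborel"
          using WPb by (auto simp: fmeasurable_def intro: less_trans ennreal_less_top)
        show "measure lborel (W - P) \<le> e / C"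
          using eq e C unfolding emeasure_eq_measure2[OF fm] by (simp add: ennreal_less_iff)
      qed
      define Br where "Br n = {(a, b). branch n a b \<and> {a<..<b} \<subseteq> W}" for n
      define U where "U n = (\<Union>i\<in>Br n. {fst i<..<snd i})" for n
      have finBr: "finite (Br n)" for n
        by (rule finite_subset[OF _ finite_branches[of n]]) (auto simp: Br_def)
      have Ub: "U n \<in> sets borel" "U n \<subseteq> {lo..hi}" "U n \<subseteq> W" for n
      proof -
        show "U n \<in> sets borel" unfolding U_def by (intro borel_open open_UN) auto
        show "U n \<subseteq> {lo..hi}" unfolding U_def Br_def using branch_bounds by fastforce
        show "U n \<subseteq> W" unfolding U_def Br_def by auto
      qed
      \<comment> \<open>Points whose branches lie in \<open>W\<close> from time \<open>k\<close> on.
        Branches shrink to good points, so these sets increase to \<open>P\<close>.\<close>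
      define PN where "PN k = {x \<in> P. \<forall>n\<ge>k. x \<in> U n}" for k
      have PNb: "PN k \<in> sets borel" for k
      proof -
        have "PN k = P \<inter> (\<Inter>n\<in>{k..}. U n)" by (auto simp: PN_def)
        moreover have "(\<Inter>n\<in>{k..}. U n) \<in> sets borel" using Ub(1) by (intro sets.countable_INT) auto
        ultimately show ?thesis using P(1) by simp
      qed
      have "incseq PN" unfolding incseq_def PN_def by auto
      moreover have "(\<Union>k. PN k) = P"
      proof
        show "P \<subseteq> (\<Union>k. PN k)"
        proof
          fix x assume x: "x \<in> P"
          then obtain r where r: "r > 0" "ball x r \<subseteq> W" using W(1,2) open_contains_ball[of W] by blast
          obtain k where k: "\<And>n a b. n \<ge> k \<Longrightarrow> branch n a b \<Longrightarrow> a < x \<Longrightarrow> x < b \<Longrightarrow> x - r < a \<and> b < x + r"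
            using good_branch_shrinks[OF P(5)[OF x] r(1)] by metis
          have "x \<in> U n" if n: "n \<ge> k" for n
          proof -
            obtain a b where ab: "branch n a b" "a < x" "x < b" using good_branch_exists[OF P(5)[OF x]] by metis
            have "{a<..<b} \<subseteq> ball x r" using k[OF n ab] ab by (auto simp: dist_real_def)
            then have "(a, b) \<in> Br n" using ab r(2) by (auto simp: Br_def)
            then show ?thesis using ab unfolding U_def by (auto intro!: bexI[of _ "(a, b)"])
          qed
          then show "x \<in> (\<Union>k. PN k)" using x by (auto simp: PN_def)
        qed
      qed (auto simp: PN_def)
      moreover have "emeasure lborel P \<noteq> \<infinity>" using finX[OF P(1,2)] by (auto simp: fmeasurable_def)
      ultimately have "(\<lambda>k. measure lborel (PN k)) \<longlonglongrightarrow> m"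
        using Lim_measure_incseq[of PN lborel] PNb by (auto simp: m_def)
      then have "\<forall>\<^sub>F k in sequentially. measure lborel (PN k) > 3 / 4 * m"
        using m by (intro order_tendstoD(1)) auto
      then obtain k where k: "\<And>n. n \<ge> k \<Longrightarrow> measure lborel (PN n) > 3 / 4 * m"
        unfolding eventually_sequentially by blast
      define n where "n = max 1 k"
      have n: "n \<ge> 1" by (simp add: n_def)
      have PNn: "measure lborel (PN n) > 3 / 4 * m" using k[of n] by (simp add: n_def)
      define E where "E = P \<inter> ((f ^^ n) -` N \<inter> {lo..hi})"
      have Ns: "(f ^^ n) -` N \<inter> {lo..hi} \<in> sets \<mu>" "measure \<mu> ((f ^^ n) -` N \<inter> {lo..hi}) \<le> t * m / 4"
        using measure_iter_vimage[OF d(2), of n] d(3) by (auto simp: N_def)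
      have Eb: "E \<in> sets borel" "E \<subseteq> {lo..hi}" using Ns(1) P(1,2) by (auto simp: E_def sets_mu)
      have "t * measure lborel E \<le> measure \<mu> E" using Eb by (intro P(6)) (auto simp: E_def)
      also have "\<dots> \<le> measure \<mu> ((f ^^ n) -` N \<inter> {lo..hi})"
        using Ns(1) by (intro finite_measure_mono) (auto simp: E_def)
      also have "\<dots> \<le> t * m / 4" by (rule Ns(2))
      finally have E: "measure lborel E \<le> m / 4" using P(3) by simp
      define A where "A = PN n - E"
      have Ab: "A \<in> sets borel" "A \<subseteq> P" "A \<subseteq> {lo..hi}" "A \<subseteq> U n"
      proof -
        have "PN n \<subseteq> P" "PN n \<subseteq> U n" by (auto simp: PN_def)
        then show "A \<subseteq> P" "A \<subseteq> {lo..hi}" "A \<subseteq> U n" using P(2) unfolding A_def by blast+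
        show "A \<in> sets borel" unfolding A_def using PNb[of n] Eb by blast
      qed
      have "measure lborel (PN n) \<le> measure lborel (A \<union> E)"
        using Ab Eb by (intro measure_mono_fmeasurable finX PNb) (auto simp: A_def PNb)
      also have "\<dots> \<le> measure lborel A + measure lborel E"
        using Ab Eb by (intro measure_Un_le) auto
      finally have A: "m / 2 \<le> measure lborel A" using PNn E by linarith
      \<comment> \<open>The union over the two times \<open>n\<close> and \<open>Suc n\<close> is
        the source of the factor 2 in \<open>muG\<close>.\<close>
      define G where "G = {x \<in> {lo..hi}. (f ^^ n) x \<in> {y1..y2} \<or> (f ^^ Suc n) x \<in> {y1..y2}}"
      have Geq: "G = ((f ^^ n) -` {y1..y2} \<inter> {lo..hi}) \<union> ((f ^^ Suc n) -` {y1..y2} \<inter> {lo..hi})"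
        by (auto simp: G_def)
      have Gs: "G \<in> sets \<mu>" unfolding Geq by (intro sets.Un measure_iter_vimage Js)
      then have Gb: "G \<in> sets borel" "G \<subseteq> {lo..hi}" by (auto simp: sets_mu)
      have "measure \<mu> G \<le> measure \<mu> ((f ^^ n) -` {y1..y2} \<inter> {lo..hi}) + measure \<mu> ((f ^^ Suc n) -` {y1..y2} \<inter> {lo..hi})"
        unfolding Geq by (intro measure_Un_le measure_iter_vimage Js)
      then have muG: "measure \<mu> G \<le> 2 * measure \<mu> {y1..y2}"
        unfolding measure_iter_vimage(2)[OF Js] by simp
      have disj: "disjoint_family_on (\<lambda>i. {fst i<..<snd i}) (Br n)"
        unfolding disjoint_family_on_def Br_def using branch_unique[of n] by (fastforce simp: disjoint_iff)
      have sum_eq: "measure lborel (S \<inter> U n) = (\<Sum>i\<in>Br n. measure lborel (S \<inter> {fst i<..<snd i}))"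
        if S: "S \<in> sets borel" "S \<subseteq> {lo..hi}" for S
      proof -
        have "S \<inter> U n = (\<Union>i\<in>Br n. S \<inter> {fst i<..<snd i})" by (auto simp: U_def)
        moreover have "measure lborel (\<Union>i\<in>Br n. S \<inter> {fst i<..<snd i}) = (\<Sum>i\<in>Br n. measure lborel (S \<inter> {fst i<..<snd i}))"
        proof (rule measure_finite_Union[OF finBr])
          show "disjoint_family_on (\<lambda>i. S \<inter> {fst i<..<snd i}) (Br n)"
            using disj unfolding disjoint_family_on_def by blast
          show "emeasure lborel (S \<inter> {fst i<..<snd i}) \<noteq> \<infinity>" for i
          proof -
            have "S \<inter> {fst i<..<snd i} \<in> fmeasurable lborel" using S by (intro finX) auto
            then show ?thesis by (auto simp: fmeasurable_def)
          qed
        qed (use S in auto)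
        ultimately show ?thesis by simp
      qed
      have "m / 2 * (y2 - y1) \<le> measure lborel A * (y2 - y1)" using A y by (intro mult_right_mono) auto
      also have "measure lborel A = (\<Sum>i\<in>Br n. measure lborel (A \<inter> {fst i<..<snd i}))"
        using sum_eq[OF Ab(1,3)] Ab(4) by (simp add: Int_absorb2)
      also have "\<dots> * (y2 - y1) \<le> (\<Sum>i\<in>Br n. C * measure lborel (G \<inter> {fst i<..<snd i}))"
        unfolding sum_distrib_right
      proof (rule sum_mono)
        fix i assume "i \<in> Br n"
        then have br: "branch n (fst i) (snd i)" by (auto simp: Br_def)
        have "infdist ((f ^^ n) x) K \<ge> d" if "x \<in> A" for x
        proof -
          have "x \<in> {lo..hi}" "x \<notin> E" "x \<in> P" using that Ab by (auto simp: A_def)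
          then have "(f ^^ n) x \<in> {lo..hi}" "(f ^^ n) x \<notin> N" using iter_in by (auto simp: E_def)
          then show ?thesis by (auto simp: N_def)
        qed
        then show "measure lborel (A \<inter> {fst i<..<snd i}) * (y2 - y1) \<le> C * measure lborel (G \<inter> {fst i<..<snd i})"
          using branch_mass[OF br n d(1) y, of "A \<inter> {fst i<..<snd i}"] Ab(1)
          by (simp add: C_def G_def Int_commute)
      qed
      also have "\<dots> = C * measure lborel (G \<inter> U n)"
        using sum_eq[OF Gb] by (simp add: sum_distrib_left)
      \<comment> \<open>\<open>U n\<close> lies in \<open>W\<close>, so what \<open>G\<close> has
        outside \<open>P\<close> is part of \<open>W - P\<close>.\<close>
      also have "\<dots> \<le> C * (measure lborel (P \<inter> G) + measure lborel (W - P))"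
      proof (rule mult_left_mono)
        have fm: "P \<inter> G \<in> fmeasurable lborel" using P(1) Gb by (intro finX) auto
        have "measure lborel (G \<inter> U n) \<le> measure lborel ((P \<inter> G) \<union> (W - P))"
          using Ub[of n] Gb fm WP(2) by (intro measure_mono_fmeasurable fmeasurable.Un) auto
        also have "\<dots> \<le> measure lborel (P \<inter> G) + measure lborel (W - P)"
          using fm WP(2) by (intro measure_Un_le) auto
        finally show "measure lborel (G \<inter> U n) \<le> measure lborel (P \<inter> G) + measure lborel (W - P)" .
      qed (use C in auto)
      also have "\<dots> \<le> C * (2 * measure \<mu> {y1..y2} / t + e / C)"
      proof (intro mult_left_mono add_mono WP(1))
        have "t * measure lborel (P \<inter> G) \<le> measure \<mu> (P \<inter> G)" using P(1) Gb by (intro P(6)) auto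
        also have "\<dots> \<le> measure \<mu> G" using Gs by (intro finite_measure_mono) auto
        finally have "t * measure lborel (P \<inter> G) \<le> 2 * measure \<mu> {y1..y2}" using muG by linarith
        then show "measure lborel (P \<inter> G) \<le> 2 * measure \<mu> {y1..y2} / t" using P(3) by (simp add: field_simps)
      qed (use C in auto)
      also have "\<dots> = C * (2 * measure \<mu> {y1..y2} / t) + e" using C by (simp add: distrib_left)
      finally show ?thesis .
    qed
    then have "m / 2 * (y2 - y1) \<le> C * (2 * measure \<mu> {y1..y2} / t)" by (rule field_le_epsilon)
    then show "t * m / (4 * C) * (y2 - y1) \<le> measure \<mu> {y1..y2}"
      using P(3) C by (simp add: field_simps)
  qed
qed

text \<open>Under \<open>f\<close> an interval grows in length by at most the factor
  \<open>L\<close>, and by invariance it does not lose mass.\<close>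

lemma density_bound_push:
  assumes sm: "smono a b f" and ab: "lo \<le> a" "a < b" "b \<le> hi" and \<kappa>: "\<kappa> > 0"
    and bound: "\<And>z1 z2. a \<le> z1 \<Longrightarrow> z1 < z2 \<Longrightarrow> z2 \<le> b \<Longrightarrow> \<kappa> * (z2 - z1) \<le> measure \<mu> {z1..z2}"
    and y: "min (f a) (f b) \<le> y1" "y1 < y2" "y2 \<le> max (f a) (f b)"
  shows "\<kappa> / L * (y2 - y1) \<le> measure \<mu> {y1..y2}"
proof -
  obtain z1 z2 where z: "a \<le> z1" "z1 < z2" "z2 \<le> b" "f ` {z1..z2} \<subseteq> {y1..y2}" "y2 - y1 \<le> L * (z2 - z1)"
    by (rule interval_preimage[OF sm ab y]) (rule that; assumption)
  have "f a \<in> {lo..hi}" "f b \<in> {lo..hi}" using f_in[of a] f_in[of b] ab by auto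
  then have sets: "{z1..z2} \<in> sets \<mu>" "{y1..y2} \<in> sets \<mu>" using z ab y by (auto simp: sets_mu)
  have "\<kappa> / L * (y2 - y1) \<le> \<kappa> / L * (L * (z2 - z1))" using z(5) \<kappa> L(1) by (intro mult_left_mono) auto
  also have "\<dots> = \<kappa> * (z2 - z1)" using L(1) by simp
  also have "\<dots> \<le> measure \<mu> {z1..z2}" by (rule bound[OF z(1-3)])
  also have "\<dots> \<le> measure \<mu> {y1..y2}" by (rule measure_push[OF sets, of 1]) (use z(4) in simp)
  finally show ?thesis .
qed

text \<open>The image of [c_2, c] is [c_3, c_1], which is a neighbourhood of \<open>c\<close> if c_3
  < c. Otherwise 3 is not a cutting time, so c_4 > c, and the image [c_2, c_4] of [c_3, c_1] is
  one.\<close>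

lemma density_bound_right:
  obtains \<kappa> d where "\<kappa> > 0" "d > 0"
    "\<And>y. c < y \<Longrightarrow> y \<le> c + d \<Longrightarrow> \<kappa> * (y - c) \<le> measure \<mu> {c..y}"
proof -
  obtain \<kappa> where \<kappa>: "\<kappa> > 0"
    "\<And>y1 y2. f (f c) \<le> y1 \<Longrightarrow> y1 < y2 \<Longrightarrow> y2 \<le> c \<Longrightarrow> \<kappa> * (y2 - y1) \<le> measure \<mu> {y1..y2}"
    using density_bound_central by metis
  have c2: "lo \<le> f (f c)" "f (f c) < c" using iter_c_in[of 2] c2_less by (auto simp: numeral_2_eq_2)
  have c31: "f (f (f c)) < f c" using cs_less_c1[of 2] by (simp add: numeral_2_eq_2)
  have sm: "smono (f (f c)) c f" by (rule smono_subset[OF smono_left c2(1) order_refl])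
  have 1: "\<kappa> / L * (y2 - y1) \<le> measure \<mu> {y1..y2}" if "f (f (f c)) \<le> y1" "y1 < y2" "y2 \<le> f c" for y1 y2
    by (rule density_bound_push[OF sm c2 less_imp_le[OF c_less_hi] \<kappa>]) (use that c31 in auto)
  have \<kappa>L: "\<kappa> / L > 0" using \<kappa>(1) L(1) by simp
  show thesis
  proof (cases "f (f (f c)) < c")
    case True
    then show thesis using 1 by (intro that[of "\<kappa> / L" "f c - c"] \<kappa>L) (use c_less_c1 in auto)
  next
    case False
    then have c3: "c < cs 3" using iter_c_neq_c[of 3] by (simp add: numeral_3_eq_3)
    have "\<not> cut 3" using cs_side_aux(2)[of 3] cut_2 c3 by auto
    then have c4: "f (f (f (f c))) > c" using cut_Suc_greater[of 3] by (simp add: numeral_3_eq_3)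
    have c3': "c \<le> f (f (f c))" using c3 by (simp add: numeral_3_eq_3)
    have sm': "smono (f (f (f c))) (f c) f" by (rule smono_subset[OF smono_right c3' c1_le_hi])
    have "\<kappa> / L / L * (y - c) \<le> measure \<mu> {c..y}" if "c < y" "y \<le> c + (f (f (f (f c))) - c)" for y
      by (rule density_bound_push[OF sm' _ c31 c1_le_hi \<kappa>L 1]) (use that c2 c3' lo_less_c in auto)
    moreover have "\<kappa> / L / L > 0" using L(1) by (intro divide_pos_pos \<kappa>L) auto
    ultimately show thesis using c4 by (intro that[of "\<kappa> / L / L" "f (f (f (f c))) - c"]) simp_all
  qed
qed

end

section \<open>Long escapes from the critical point\<close>

context sturmian_map
begin

text \<open>The visits of the critical orbit to the right of \<open>c\<close> come in pairs: a jump
  of \<open>F\<close> at n puts c_n and c_{n+1} there, and the jump at 0 accounts for the start. So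
  \<open>f ^^ i\<close> reverses orientation exactly if a pair is half completed, that is, if
  \<open>F\<close> jumps at i - 1.\<close>

lemma iter_monotone_right_of_c:
  assumes y: "c \<le> y" "y \<le> hi"
    and side: "\<And>i. 1 \<le> i \<Longrightarrow> i < q \<Longrightarrow> cs i < c \<and> (f ^^ i) y < c \<or> c < cs i \<and> c < (f ^^ i) y"
    and i: "1 \<le> i" "i \<le> q"
  shows "if F (int i - 1) = F (int i - 2) then strict_mono_on {c..y} (f ^^ i) else strict_antimono_on {c..y} (f ^^ i)"
  using i
proof (induction i rule: dec_induct)
  case base
  have "strict_antimono_on {c..y} f" using f_less_right y by (auto simp: monotone_on_def)
  then show ?case by (simp add: F_small)
next
  case (step i)
  let ?S = "{c..y}"
  have in_I: "(f ^^ i) x \<in> {lo..hi}" if "x \<in> ?S" for x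
    using that y lo_less_c by (intro iter_in) auto
  have IH: "if F (int i - 1) = F (int i - 2) then strict_mono_on ?S (f ^^ i) else strict_antimono_on ?S (f ^^ i)"
    using step by simp
  have hull: "(cs i \<le> (f ^^ i) x \<and> (f ^^ i) x \<le> (f ^^ i) y) \<or> ((f ^^ i) y \<le> (f ^^ i) x \<and> (f ^^ i) x \<le> cs i)" if "x \<in> ?S" for x
  proof (cases "F (int i - 1) = F (int i - 2)")
    case True
    then have "mono_on ?S (f ^^ i)" using IH strict_mono_on_imp_mono_on by auto
    then show ?thesis using that y by (auto simp: monotone_on_def)
  next
    case False
    then have "strict_antimono_on ?S (f ^^ i)" using IH by simp
    then show ?thesis using that y by (auto simp: monotone_on_def le_less)
  qed
  have eq: "int (Suc i) - 1 = int i" "int (Suc i) - 2 = int i - 1" by simp_all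
  have "int i - 1 - 1 = int i - 2" by simp
  note Fs = F_step[of "int i"] F_step[of "int i - 1", unfolded this]
  have i1: "1 \<le> i" using step by simp
  consider "cs i < c" "(f ^^ i) y < c" | "c < cs i" "c < (f ^^ i) y" using side[of i] step by auto
  then show ?case
  proof cases
    case 1
    have FF: "F (int i) = F (int i - 2)" using cs_less_iff[OF i1] 1 by simp
    then have "F (int i) = F (int i - 1)" "F (int i - 1) = F (int i - 2)" using Fs by linarith+
    then have "strict_mono_on ?S (f ^^ i)" using IH by simp
    moreover have "(f ^^ i) x \<in> {lo..c}" if "x \<in> ?S" for x using hull[OF that] in_I[OF that] 1 by auto
    ultimately have "(f ^^ Suc i) v < (f ^^ Suc i) w" if "v \<in> ?S" "w \<in> ?S" "v < w" for v w
      using monotone_onD[of ?S "(<)" "(<)" "f ^^ i" v w] monotone_onD[OF f_left, of "(f ^^ i) v" "(f ^^ i) w"] that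
      by simp
    then have "strict_mono_on ?S (f ^^ Suc i)" unfolding monotone_on_def by blast
    then show ?thesis unfolding eq using \<open>F (int i) = F (int i - 1)\<close> by simp
  next
    case 2
    have FF: "F (int i) \<noteq> F (int i - 2)" using cs_less_iff[OF i1] 2 by simp
    have R: "(f ^^ i) x \<in> {c..hi}" if "x \<in> ?S" for x using hull[OF that] in_I[OF that] 2 by auto
    show ?thesis
    proof (cases "F (int i - 1) = F (int i - 2)")
      case True
      then have "strict_mono_on ?S (f ^^ i)" using IH by simp
      then have "strict_antimono_on ?S (f ^^ Suc i)"
        using f_right R unfolding monotone_on_def by auto
      then show ?thesis unfolding eq using True FF by auto
    next
      case False
      then have "strict_antimono_on ?S (f ^^ i)" using IH by simp
      then have "strict_mono_on ?S (f ^^ Suc i)"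
        using f_right R unfolding monotone_on_def by auto
      moreover have "F (int i) = F (int i - 1)" using Fs False FF F_step2[of "int i"] by auto
      ultimately show ?thesis unfolding eq by simp
    qed
  qed
qed

text \<open>The first \<open>q\<close> points of the orbit of the rotation can be moved by \<open>q\<gamma>\<close> up to \<open>A - 1\<close> times without
  crossing an integer. The index \<open>-1\<close> is needed because \<open>F (i - 2)\<close> enters the itinerary of \<open>c\<close>.\<close>

definition near_period :: "nat \<Rightarrow> nat \<Rightarrow> bool" where
  "near_period q A \<longleftrightarrow> q \<ge> 1 \<and> F (int q) \<noteq> F (int q - 2) \<and> F (int q - 1) = F (int q - 2) \<and>
     (\<exists>p. \<forall>i j. - 1 \<le> i \<longrightarrow> i < int q \<longrightarrow> j < A \<longrightarrow> F (int j * int q + i) = int j * p + F i)"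

lemma near_period_greater:
  assumes "near_period q A" shows "c < cs q"
proof -
  have "q \<ge> 1" "\<not> cs q < c" using cs_less_iff[of q] assms by (auto simp: near_period_def)
  then show ?thesis using cs_greater by blast
qed

text \<open>By the shift property and \<open>cs_less_iff\<close>, the orbit of c_{(j+1)q} follows
  that of \<open>c\<close> on the same sides for times 1 to q - 1. Hence \<open>f ^^ q\<close>
  increases up to this point, and applying it to c_{jq} < c_{(j+1)q} gives the next
  inequality.\<close>

lemma monotone_escape:
  assumes np: "near_period q A"
    and j: "j < A"
  shows "c \<le> cs (j * q) \<and> cs (j * q) < cs (Suc j * q) \<and> strict_mono_on {c..cs (j * q)} (f ^^ q)"
  using j
proof (induction j)
  case 0
  show ?case using near_period_greater[OF np] by (simp add: monotone_on_def)
next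
  case (Suc j)
  have q: "q \<ge> 1" and Fq: "F (int q - 1) = F (int q - 2)" using np by (auto simp: near_period_def)
  obtain p where shift: "\<And>i j. - 1 \<le> i \<Longrightarrow> i < int q \<Longrightarrow> j < A \<Longrightarrow> F (int j * int q + i) = int j * p + F i"
    using np unfolding near_period_def by blast
  define y where "y = cs (Suc j * q)"
  have IH: "c \<le> cs (j * q)" "cs (j * q) < y" using Suc by (auto simp: y_def)
  have y: "c \<le> y" "y \<le> hi" using IH iter_c_in[of "Suc j * q"] by (auto simp: y_def)
  have fy: "(f ^^ i) y = cs (Suc j * q + i)" for i
    unfolding y_def using funpow_add[of i "Suc j * q" f] by (simp add: add.commute)
  have "cs i < c \<and> (f ^^ i) y < c \<or> c < cs i \<and> c < (f ^^ i) y" if i: "1 \<le> i" "i < q" for i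
  proof -
    have "F (int (Suc j) * int q + int i) = int (Suc j) * p + F (int i)"
      using shift[of "int i" "Suc j"] i Suc.prems by simp
    \<comment> \<open>For i = 1 this uses the shift property at the index -1.\<close>
    moreover have "F (int (Suc j) * int q + (int i - 2)) = int (Suc j) * p + F (int i - 2)"
      by (rule shift) (use i Suc.prems in auto)
    ultimately have "F (int (Suc j * q + i)) = F (int (Suc j * q + i) - 2) \<longleftrightarrow> F (int i) = F (int i - 2)"
      by (simp only: of_nat_add of_nat_mult add_diff_eq add_left_cancel)
    then have "cs (Suc j * q + i) < c \<longleftrightarrow> cs i < c"
      using cs_less_iff[of "Suc j * q + i"] cs_less_iff[of i] i by simp
    then show ?thesis
      unfolding fy using cs_greater[of i] cs_greater[of "Suc j * q + i"] i by force
  qed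
  from iter_monotone_right_of_c[OF y this q order_refl]
  have mono: "strict_mono_on {c..y} (f ^^ q)" using Fq by simp
  have "(f ^^ q) (cs (j * q)) < (f ^^ q) y"
    using monotone_onD[OF mono, of "cs (j * q)" y] IH y by auto
  moreover have "(f ^^ q) (cs (j * q)) = y"
    unfolding y_def using funpow_add[of q "j * q" f] by simp
  moreover have "(f ^^ q) y = cs (Suc (Suc j) * q)"
    unfolding fy by (simp add: add.commute)
  ultimately show ?case using y mono unfolding y_def by auto
qed

end

context sturmian_acip
begin

lemma escape_measure_bound:
  assumes np: "near_period q A" shows "real A * measure \<mu> {c..cs q} \<le> 1"
proof -
  note esc = monotone_escape[OF np]
  \<comment> \<open>Half-open, so that adjacent intervals are disjoint.\<close>
  define I where "I j = {cs (j * q)..<cs (Suc j * q)}" for j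
  have im: "(f ^^ (j * q)) ` {c..<cs q} \<subseteq> I j" if "j < A" for j
    using that
  proof (induction j)
    case (Suc j)
    have mono: "strict_mono_on {c..cs (Suc j * q)} (f ^^ q)" and ge: "c \<le> cs (j * q)"
      using esc[of "Suc j"] esc[of j] Suc.prems by auto
    show ?case
    proof
      fix w assume "w \<in> (f ^^ (Suc j * q)) ` {c..<cs q}"
      then obtain x where x: "x \<in> {c..<cs q}" "w = (f ^^ (Suc j * q)) x" by blast
      define v where "v = (f ^^ (j * q)) x"
      have v: "v \<in> I j" using Suc x by (auto simp: v_def)
      have w: "w = (f ^^ q) v" unfolding x(2) v_def using funpow_add[of q "j * q" f] by simp
      have e: "(f ^^ q) (cs (j * q)) = cs (Suc j * q)" "(f ^^ q) (cs (Suc j * q)) = cs (Suc (Suc j) * q)"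
        using funpow_add[of q "j * q" f] funpow_add[of q "Suc j * q" f] by simp_all
      have m: "mono_on {c..cs (Suc j * q)} (f ^^ q)" using mono by (rule strict_mono_on_imp_mono_on)
      have "(f ^^ q) (cs (j * q)) \<le> (f ^^ q) v"
        by (rule monotone_onD[OF m]) (use v ge in \<open>auto simp: I_def\<close>)
      moreover have "(f ^^ q) v < (f ^^ q) (cs (Suc j * q))"
        by (rule monotone_onD[OF mono]) (use v ge in \<open>auto simp: I_def\<close>)
      ultimately show "w \<in> I (Suc j)" unfolding w e I_def by simp
    qed
  qed (simp add: I_def)
  have Is: "I j \<in> sets \<mu>" for j
  proof -
    have "cs (j * q) \<in> {lo..hi}" "cs (Suc j * q) \<in> {lo..hi}" by (rule iter_c_in)+
    then show ?thesis by (auto simp: sets_mu I_def)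
  qed
  have Js: "{c..<cs q} \<in> sets \<mu>" using iter_c_in[of q] lo_less_c by (auto simp: sets_mu)
  have le: "cs (Suc i * q) \<le> cs (j * q)" if "i < j" "j < A" for i j
  proof -
    have "Suc i \<le> j" using that by simp
    then show ?thesis
      using that(2)
    proof (induction j rule: dec_induct)
      case (step k)
      then show ?case using esc[of k] by force
    qed simp
  qed
  have disj: "disjoint_family_on I {..<A}"
    unfolding disjoint_family_on_def
  proof (intro ballI impI)
    fix i j assume "i \<in> {..<A}" "j \<in> {..<A}" "i \<noteq> j"
    then consider "cs (Suc i * q) \<le> cs (j * q)" | "cs (Suc j * q) \<le> cs (i * q)"
      using le by (metis lessThan_iff linorder_neqE_nat)
    then show "I i \<inter> I j = {}" unfolding I_def by cases auto
  qed
  have "real A * measure \<mu> {c..<cs q} = (\<Sum>j<A. measure \<mu> {c..<cs q})" by simp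
  also have "\<dots> \<le> (\<Sum>j<A. measure \<mu> (I j))"
    by (intro sum_mono measure_push[OF Js Is im]) simp
  also have "\<dots> = measure \<mu> (\<Union>j<A. I j)"
    using Is disj by (intro finite_measure_finite_Union[symmetric]) auto
  also have "\<dots> \<le> 1" by simp
  finally have "real A * measure \<mu> {c..<cs q} \<le> 1" .
  moreover have "measure \<mu> {c..cs q} \<le> measure \<mu> {c..<cs q}"
  proof -
    have null: "{cs q} \<in> null_sets \<mu>" using iter_c_in[of q] by (intro null_finite) auto
    have "{c..<cs q} \<union> {cs q} \<in> sets \<mu>" using Js null_setsD2[OF null] by (rule sets.Un)
    then have "measure \<mu> {c..cs q} \<le> measure \<mu> ({c..<cs q} \<union> {cs q})"
      by (rule finite_measure_mono[rotated]) auto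
    also have "\<dots> = measure \<mu> {c..<cs q}" by (rule measure_Un_null_set[OF Js null])
    finally show ?thesis .
  qed
  ultimately show ?thesis using mult_left_mono[of "measure \<mu> {c..cs q}" "measure \<mu> {c..<cs q}" "real A"] by simp
qed

lemma exponential_bound:
  obtains C where "C \<ge> 1"
    "\<And>q A. near_period q A \<Longrightarrow> real A \<le> C ^ q"
proof -
  obtain \<kappa> d where \<kappa>: "\<kappa> > 0" "d > 0"
    "\<And>y. c < y \<Longrightarrow> y \<le> c + d \<Longrightarrow> \<kappa> * (y - c) \<le> measure \<mu> {c..y}"
    using density_bound_right by metis
  obtain B where B: "B > 1" "\<And>q. q \<ge> 1 \<Longrightarrow> cs q > c \<Longrightarrow> cs q - c \<ge> 1 / B ^ q"
    using closest_return_bound by metis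
  \<comment> \<open>Collects the constants of the density bound; being at least 1, it is at most its
    power \<open>D ^ q\<close> and can be absorbed into the base.\<close>
  define D where "D = max 1 (1 / (\<kappa> * min 1 d))"
  have D: "D \<ge> 1" "1 \<le> D * (\<kappa> * min 1 d)"
  proof -
    have "\<kappa> * min 1 d \<noteq> 0" using \<kappa> by (auto simp: min_def)
    then have "1 = 1 / (\<kappa> * min 1 d) * (\<kappa> * min 1 d)" by (rule nonzero_divide_eq_eq[THEN iffD1, OF _ refl])
    also have "\<dots> \<le> D * (\<kappa> * min 1 d)"
      using \<kappa> by (intro mult_right_mono) (auto simp: D_def)
    finally show "1 \<le> D * (\<kappa> * min 1 d)" .
  qed (simp add: D_def)
  show thesis
  proof (rule that[of "D * B"])
    show "D * B \<ge> 1" using D B by (intro mult_ge1_I) auto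
    fix q A assume np: "near_period q A"
    have q: "q \<ge> 1" using np by (simp add: near_period_def)
    have cq: "c < cs q" by (rule near_period_greater[OF np])
    \<comment> \<open>The density bound reaches only to \<open>c + d\<close>, while c_q may lie
      further away.\<close>
    define y where "y = min (cs q) (c + d)"
    have y: "c < y" "y \<le> c + d" "y \<le> cs q" using cq \<kappa> by (auto simp: y_def)
    have Bq: "0 < 1 / B ^ q" "1 / B ^ q \<le> 1" using B(1) by auto
    have "min 1 d * (1 / B ^ q) \<le> y - c"
    proof -
      have "min 1 d * (1 / B ^ q) \<le> 1 * (1 / B ^ q)" "min 1 d * (1 / B ^ q) \<le> d * 1"
        using Bq \<kappa> by (intro mult_mono; simp)+
      then show ?thesis using B(2)[OF q cq] by (auto simp: y_def)
    qed
    then have "\<kappa> * (min 1 d * (1 / B ^ q)) \<le> \<kappa> * (y - c)" using \<kappa> by (intro mult_left_mono) auto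
    also have "\<dots> \<le> measure \<mu> {c..y}" by (rule \<kappa>(3)[OF y(1,2)])
    also have "\<dots> \<le> measure \<mu> {c..cs q}"
      using y iter_c_in[of q] lo_less_c by (intro finite_measure_mono) (auto simp: sets_mu)
    finally have "real A * (\<kappa> * (min 1 d * (1 / B ^ q))) \<le> real A * measure \<mu> {c..cs q}"
      by (intro mult_left_mono) auto
    also have "\<dots> \<le> 1" by (rule escape_measure_bound[OF np])
    finally have le: "real A * (\<kappa> * min 1 d) \<le> B ^ q" using B(1) by (simp add: field_simps)
    have "real A * 1 \<le> real A * (D * (\<kappa> * min 1 d))" using D by (intro mult_left_mono) auto
    also have "\<dots> = D * (real A * (\<kappa> * min 1 d))" by simp
    also have "\<dots> \<le> D * B ^ q" using le D by (intro mult_left_mono) auto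
    also have "\<dots> \<le> D ^ q * B ^ q" using D B q self_le_power[of D q] by (intro mult_right_mono) auto
    finally show "real A \<le> (D * B) ^ q" by (simp add: power_mult_distrib)
  qed
qed

end

section \<open>Continued fractions\<close>

lemma cfrac_det:
  "int (cfrac_p a (Suc n)) * int (cfrac_q a n) - int (cfrac_p a n) * int (cfrac_q a (Suc n)) = (- 1) ^ n"
proof (induction n)
  case (Suc n)
  have "int (cfrac_p a (Suc (Suc n))) * int (cfrac_q a (Suc n)) - int (cfrac_p a (Suc n)) * int (cfrac_q a (Suc (Suc n)))
    = - (int (cfrac_p a (Suc n)) * int (cfrac_q a n) - int (cfrac_p a n) * int (cfrac_q a (Suc n)))"
    by (simp add: algebra_simps)
  then show ?case using Suc by simp
qed simp

lemma cfrac_q_even_ge: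
  assumes "\<forall>n\<ge>1. a n \<ge> 1" shows "cfrac_q a (2 * n) \<ge> Suc n"
proof (induction n)
  case (Suc n)
  have "a (Suc (Suc (2 * n))) * cfrac_q a (Suc (2 * n)) \<ge> 1 * 1"
    using assms cfrac_q_pos[OF assms, of "Suc (2 * n)"] by (intro mult_le_mono) (auto simp: Suc_le_eq)
  moreover have "cfrac_q a (2 * Suc n) = a (Suc (Suc (2 * n))) * cfrac_q a (Suc (2 * n)) + cfrac_q a (2 * n)"
    by simp
  ultimately show ?case using Suc by linarith
qed simp

lemma convergents_step:
  assumes a: "\<forall>n\<ge>1. a n \<ge> 1"
  shows "cfrac_finite a (Suc (Suc n)) - cfrac_finite a n
    = real (a (Suc (Suc n))) * (- 1) ^ n / (real (cfrac_q a n) * real (cfrac_q a (Suc (Suc n))))"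
proof -
  have q: "real (cfrac_q a n) > 0" "real (cfrac_q a (Suc (Suc n))) > 0"
    using cfrac_q_pos[OF a, of n] cfrac_q_pos[OF a, of "Suc (Suc n)"]
    by (simp_all del: cfrac_q.simps)
  have det: "real (cfrac_p a (Suc n)) * real (cfrac_q a n) - real (cfrac_p a n) * real (cfrac_q a (Suc n)) = (- 1) ^ n"
    using arg_cong[OF cfrac_det[of a n], of real_of_int] by simp
  have "cfrac_finite a (Suc (Suc n)) - cfrac_finite a n =
     (real (cfrac_p a (Suc (Suc n))) * real (cfrac_q a n) - real (cfrac_p a n) * real (cfrac_q a (Suc (Suc n))))
      / (real (cfrac_q a n) * real (cfrac_q a (Suc (Suc n))))"
    unfolding cfrac_finite_eq_convergent[OF a] using q by (simp add: diff_frac_eq mult.commute del: cfrac_p.simps cfrac_q.simps)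
  also have "real (cfrac_p a (Suc (Suc n))) * real (cfrac_q a n) - real (cfrac_p a n) * real (cfrac_q a (Suc (Suc n)))
     = real (a (Suc (Suc n))) * (real (cfrac_p a (Suc n)) * real (cfrac_q a n) - real (cfrac_p a n) * real (cfrac_q a (Suc n)))"
    by (simp add: algebra_simps)
  finally show ?thesis unfolding det .
qed

text \<open>Even convergents increase strictly and odd ones decrease strictly towards \<gamma>. One
  further convergent of the same parity, compared with the limit, makes the inequality
  strict.\<close>

lemma convergent_bounds:
  assumes e: "has_cfrac_expansion \<gamma> a"
  shows "real (cfrac_p a (2 * n)) < real (cfrac_q a (2 * n)) * \<gamma>"
    and "real (cfrac_q a (Suc (2 * n))) * \<gamma> < real (cfrac_p a (Suc (2 * n)))"
proof -
  have a: "\<forall>n\<ge>1. a n \<ge> 1" and lim: "cfrac_finite a \<longlonglongrightarrow> \<gamma>"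
    using e by (auto simp: has_cfrac_expansion_def)
  have q: "real (cfrac_q a k) > 0" for k using cfrac_q_pos[OF a] by simp
  have ak: "real (a (Suc (Suc k))) > 0" for k using a by (simp add: Suc_le_eq)
  have "cfrac_finite a (2 * k) < cfrac_finite a (2 * Suc k)" for k
    using convergents_step[OF a, of "2 * k"] q ak by (simp add: field_simps) 
      (smt (verit) divide_pos_pos mult_pos_pos q ak)
  then have inc: "strict_mono (\<lambda>k. cfrac_finite a (2 * k))" by (intro strict_monoI_Suc) auto
  have "(\<lambda>k. cfrac_finite a (2 * k)) \<longlonglongrightarrow> \<gamma>"
    using LIMSEQ_subseq_LIMSEQ[OF lim, of "\<lambda>k. 2 * k"] by (simp add: strict_mono_def comp_def)
  then have "cfrac_finite a (2 * Suc n) \<le> \<gamma>"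
    using incseq_le[of "\<lambda>k. cfrac_finite a (2 * k)" \<gamma> "Suc n"] inc strict_mono_mono by blast
  then have "cfrac_finite a (2 * n) < \<gamma>" using strict_monoD[OF inc, of n "Suc n"] by simp
  then show "real (cfrac_p a (2 * n)) < real (cfrac_q a (2 * n)) * \<gamma>"
    unfolding cfrac_finite_eq_convergent[OF a] using q[of "2 * n"] by (simp add: field_simps)
  have "cfrac_finite a (Suc (2 * Suc k)) < cfrac_finite a (Suc (2 * k))" for k
    using convergents_step[OF a, of "Suc (2 * k)"] q ak by (simp add: field_simps)
      (smt (verit) divide_pos_pos mult_pos_pos q ak)
  then have dec: "strict_mono (\<lambda>k. - cfrac_finite a (Suc (2 * k)))" by (intro strict_monoI_Suc) auto
  have "(\<lambda>k. cfrac_finite a (Suc (2 * k))) \<longlonglongrightarrow> \<gamma>"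
    using LIMSEQ_subseq_LIMSEQ[OF lim, of "\<lambda>k. Suc (2 * k)"] by (simp add: strict_mono_def comp_def)
  then have "(\<lambda>k. - cfrac_finite a (Suc (2 * k))) \<longlonglongrightarrow> - \<gamma>" by (rule tendsto_minus)
  then have "- cfrac_finite a (Suc (2 * Suc n)) \<le> - \<gamma>"
    using incseq_le[of "\<lambda>k. - cfrac_finite a (Suc (2 * k))" "- \<gamma>" "Suc n"] dec strict_mono_mono by blast
  then have "\<gamma> < cfrac_finite a (Suc (2 * n))" using strict_monoD[OF dec, of n "Suc n"] by simp
  then show "real (cfrac_q a (Suc (2 * n))) * \<gamma> < real (cfrac_p a (Suc (2 * n)))"
    unfolding cfrac_finite_eq_convergent[OF a] using q[of "Suc (2 * n)"] by (simp add: field_simps del: cfrac_p.simps cfrac_q.simps)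
qed

text \<open>The one-sided best approximation property, by writing \<open>(i, m)\<close> in the basis \<open>(Q, P), (Q', P')\<close>.\<close>

lemma one_sided_best_approximation:
  fixes P Q P' Q' i m :: int and \<gamma> :: real
  assumes det: "P' * Q - P * Q' = 1" and Q: "Q \<ge> 2" "Q' \<ge> 1"
    and pos: "of_int P < of_int Q * \<gamma>" "of_int Q' * \<gamma> < of_int P'"
    and i: "- 1 \<le> i" "i < Q" and m: "of_int i * \<gamma> < of_int m"
  shows "of_int P' - of_int Q' * \<gamma> \<le> of_int m - of_int i * \<gamma>"
proof -
  define s r where "s = i * P' - m * Q'" and "r = m * Q - i * P"
  have im: "i = s * Q + r * Q'" "m = s * P + r * P'"
  proof -
    have "s * Q + r * Q' = i * (P' * Q - P * Q')" "s * P + r * P' = m * (P' * Q - P * Q')"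
      unfolding s_def r_def by (simp_all add: algebra_simps)
    then show "i = s * Q + r * Q'" "m = s * P + r * P'" unfolding det by simp_all
  qed
  define e e' where "e = of_int Q * \<gamma> - of_int P" and "e' = of_int P' - of_int Q' * \<gamma>"
  have e: "e > 0" "e' > 0" using pos by (simp_all add: e_def e'_def)
  have val: "of_int m - of_int i * \<gamma> = of_int r * e' - of_int s * e"
    unfolding im e_def e'_def by (simp add: algebra_simps)
  have v: "of_int r * e' - of_int s * e > 0" using m val by simp
  consider "s \<ge> 1" | "s = 0" | "s \<le> - 1" by linarith
  then have "e' \<le> of_int r * e' - of_int s * e"
  proof cases
    case 1
    have "Q * 1 \<le> Q * s" using 1 Q by (intro mult_left_mono) auto
    then have "r * Q' < 0" using im(1) i by (simp add: mult.commute)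
    then have "r < 0" using Q by (simp add: mult_less_0_iff)
    then have "of_int r * e' < 0" "of_int s * e > 0" using e 1 by (auto simp: mult_less_0_iff)
    then show ?thesis using v by linarith
  next
    case 2
    then have "of_int r * e' > 0" using v by simp
    then have "r \<ge> 1" using e by (simp add: zero_less_mult_iff)
    then have "1 * e' \<le> of_int r * e'" using e by (intro mult_right_mono) auto
    then show ?thesis using 2 by simp
  next
    case 3
    have "Q * s \<le> Q * (- 1)" using 3 Q by (intro mult_left_mono) auto
    then have "r * Q' > 0" using im(1) i Q by (simp add: mult.commute)
    then have "r \<ge> 1" using Q by (simp add: zero_less_mult_iff)
    then have "1 * e' \<le> of_int r * e'" using e by (intro mult_right_mono) auto
    moreover have "of_int s * e \<le> 0" using 3 e by (intro mult_nonpos_nonneg) auto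
    ultimately show ?thesis by linarith
  qed
  then show ?thesis unfolding val e'_def .
qed

text \<open>A shift by q_{2n} moves the rotation forward by \<epsilon> modulo 1. No point with index
  from -1 to q_{2n} - 1 has an integer above it closer than \<epsilon>', the error of the preceding
  odd convergent, and a_{2n+1} shifts add up to less than that.\<close>

lemma (in sturmian_map) near_period_even_convergent:
  assumes e: "has_cfrac_expansion \<gamma> a" and n: "n \<ge> 1"
  shows "near_period (cfrac_q a (2 * n)) (a (2 * n + 1))"
proof -
  have a: "\<forall>n\<ge>1. a n \<ge> 1" using e by (auto simp: has_cfrac_expansion_def)
  obtain k where k: "n = Suc k" using n by (cases n) auto
  define q p where "q = cfrac_q a (2 * n)" and "p = int (cfrac_p a (2 * n))"
  define Q' P' where "Q' = int (cfrac_q a (Suc (2 * k)))" and "P' = int (cfrac_p a (Suc (2 * k)))"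
  define A where "A = a (2 * n + 1)"
  have n2: "2 * n = Suc (Suc (2 * k))" by (simp add: k)
  have det: "P' * int q - p * Q' = 1"
    using cfrac_det[of a "Suc (2 * k)"] unfolding Q'_def P'_def q_def p_def n2 by simp
  have q2: "int q \<ge> 2" using cfrac_q_even_ge[OF a, of n] n by (simp add: q_def)
  have Q1: "Q' \<ge> 1" using cfrac_q_pos[OF a, of "Suc (2 * k)"] by (simp add: Q'_def)
  define \<epsilon> \<epsilon>' where "\<epsilon> = real q * \<gamma> - of_int p" and "\<epsilon>' = of_int P' - of_int Q' * \<gamma>"
  have pos: "\<epsilon> > 0" "\<epsilon>' > 0"
    using convergent_bounds(1)[OF e, of n] convergent_bounds(2)[OF e, of k]
    by (simp_all add: \<epsilon>_def \<epsilon>'_def q_def p_def Q'_def P'_def del: cfrac_p.simps cfrac_q.simps)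
  have best: "\<epsilon>' \<le> of_int m - of_int i * \<gamma>" if "- 1 \<le> i" "i < int q" "of_int i * \<gamma> < of_int m" for i m
    unfolding \<epsilon>'_def
    by (rule one_sided_best_approximation[OF det q2 Q1 _ _ that]) (use pos in \<open>simp_all add: \<epsilon>_def \<epsilon>'_def\<close>)
  \<comment> \<open>By the recursion, \<epsilon>' - A\<epsilon> is the error of the convergent of
    index 2n + 1, which lies above \<gamma>.\<close>
  have A\<epsilon>: "real A * \<epsilon> < \<epsilon>'"
  proof -
    have "cfrac_q a (Suc (2 * n)) = A * cfrac_q a (2 * n) + cfrac_q a (Suc (2 * k))"
      "cfrac_p a (Suc (2 * n)) = A * cfrac_p a (2 * n) + cfrac_p a (Suc (2 * k))"
      unfolding A_def n2 by simp_all
    then show ?thesis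
      using convergent_bounds(2)[OF e, of n]
      by (simp add: \<epsilon>_def \<epsilon>'_def q_def p_def Q'_def P'_def algebra_simps del: cfrac_p.simps cfrac_q.simps)
  qed
  have A1: "real A \<ge> 1" using a by (simp add: A_def)
  \<comment> \<open>The index -1 with the integer 0 as a competitor.\<close>
  have "\<epsilon>' \<le> \<gamma>" using best[of "- 1" 0] q2 \<gamma>_pos by simp
  moreover have "\<epsilon> \<le> real A * \<epsilon>" using A1 pos by (simp add: mult_le_cancel_right1)
  ultimately have \<epsilon>\<gamma>: "\<epsilon> < \<gamma>" using A\<epsilon> by linarith
  have Fsub: "F (int q - s) = p + \<lfloor>\<epsilon> - of_int s * \<gamma>\<rfloor>" for s
  proof -
    have "of_int (int q - s) * \<gamma> = of_int p + (\<epsilon> - of_int s * \<gamma>)" by (simp add: \<epsilon>_def algebra_simps)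
    then show ?thesis unfolding F_def by (simp add: floor_add_int[symmetric] add.commute)
  qed
  \<comment> \<open>These floors place the jump of \<open>F\<close> exactly at q: c_q lies to the
    right of \<open>c\<close>, and \<open>f ^^ q\<close> preserves orientation there.\<close>
  have fl: "\<lfloor>\<epsilon> - of_int 0 * \<gamma>\<rfloor> = 0" "\<lfloor>\<epsilon> - of_int 1 * \<gamma>\<rfloor> = - 1" "\<lfloor>\<epsilon> - of_int 2 * \<gamma>\<rfloor> = - 1"
    using pos \<epsilon>\<gamma> \<gamma>_less by (simp_all add: floor_eq_iff)
  have Fq: "F (int q) \<noteq> F (int q - 2)" "F (int q - 1) = F (int q - 2)"
    using Fsub[of 0] Fsub[of 1] Fsub[of 2] unfolding fl by simp_all
  have shift: "F (int j * int q + i) = int j * p + F i" if i: "- 1 \<le> i" "i < int q" and j: "j < A" for i j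
  proof -
    have "of_int i * \<gamma> < of_int (F i + 1)" unfolding F_def by linarith
    then have b: "\<epsilon>' \<le> of_int (F i + 1) - of_int i * \<gamma>" by (rule best[OF i])
    have "real j * \<epsilon> \<le> real A * \<epsilon>" using j pos by (intro mult_right_mono) auto
    then have up: "of_int i * \<gamma> + real j * \<epsilon> < of_int (F i) + 1" using b A\<epsilon> by simp
    have "of_int (F i) \<le> of_int i * \<gamma>" unfolding F_def by simp
    then have low: "of_int (F i) \<le> of_int i * \<gamma> + real j * \<epsilon>"
      using mult_nonneg_nonneg[of "real j" \<epsilon>] pos by linarith
    have "of_int (int j * int q + i) * \<gamma> = of_int (int j * p) + (of_int i * \<gamma> + real j * \<epsilon>)"
      by (simp add: \<epsilon>_def algebra_simps)
    then have "F (int j * int q + i) = int j * p + \<lfloor>of_int i * \<gamma> + real j * \<epsilon>\<rfloor>"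
      unfolding F_def by (metis add.commute floor_add_int)
    moreover have "\<lfloor>of_int i * \<gamma> + real j * \<epsilon>\<rfloor> = F i" using low up by (simp add: floor_eq_iff)
    ultimately show ?thesis by simp
  qed
  show ?thesis
    unfolding near_period_def q_def[symmetric] A_def[symmetric]
    using q2 Fq shift by (intro conjI exI[of _ p] allI impI) auto
qed

theorem theorem1p3:
  fixes \<gamma> l lo hi c :: real and a :: "nat \<Rightarrow> nat" and f :: "real \<Rightarrow> real"
  assumes "0 < \<gamma>" and "\<gamma> < 1/2" and "\<gamma> \<notin> \<rat>"
    and "has_cfrac_expansion \<gamma> a"
    and "l > 1"
    and "sturmian_S_unimodal \<gamma> l lo hi c f"
  shows "\<exists>\<Lambda>>1.
    filterlim
      (\<lambda>N. \<Sum>n=1..N. real (a (2 * n + 1)) * (real (cfrac_q a (2 * n)) - real (cfrac_p a (2 * n)))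
               * \<Lambda> powr (- real (cfrac_q a (2 * n))))
      at_top sequentially
    \<longrightarrow> \<not> (\<exists>\<mu>. is_acip lo hi f \<mu>)"
proof (cases "\<exists>\<mu>. is_acip lo hi f \<mu>")
  case False
  \<comment> \<open>Without an invariant measure any number above 1 will do.\<close>
  then show ?thesis by (intro exI[of _ 2]) auto
next
  case True
  then obtain \<mu> where \<mu>: "is_acip lo hi f \<mu>" by blast
  interpret sturmian_acip l lo hi c f \<gamma> \<mu>
    using assms \<mu> unfolding sturmian_S_unimodal_def sturmian_unimodal_def by unfold_locales auto
  have a: "\<forall>n\<ge>1. a n \<ge> 1" using assms(4) by (simp add: has_cfrac_expansion_def)
  obtain C where C: "C \<ge> 1"
    "\<And>q A. near_period q A \<Longrightarrow> real A \<le> C ^ q"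
    using exponential_bound by metis
  \<comment> \<open>A factor \<open>C\<close> for the partial quotient, a factor 2 for the crude
    bound of q_{2n} - p_{2n} by 2 to the power q_{2n}, and another factor 2 so that a geometric
    series remains.\<close>
  define \<Lambda> where "\<Lambda> = 4 * C"
  define T where "T n = real (a (2 * n + 1)) * (real (cfrac_q a (2 * n)) - real (cfrac_p a (2 * n)))
               * \<Lambda> powr (- real (cfrac_q a (2 * n)))" for n
  have T: "T n \<le> (1 / 2) ^ n" if n: "n \<ge> 1" for n
  proof -
    define q where "q = cfrac_q a (2 * n)"
    have qn: "Suc n \<le> q" unfolding q_def by (rule cfrac_q_even_ge[OF a])
    have "real (a (2 * n + 1)) \<le> C ^ q"
      unfolding q_def by (rule C(2)[OF near_period_even_convergent[OF assms(4) n]])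
    moreover have "real q - real (cfrac_p a (2 * n)) \<le> 2 ^ q"
      using of_nat_less_two_power[of q, where 'a = real] by linarith
    ultimately have "T n \<le> C ^ q * 2 ^ q * \<Lambda> powr (- real q)"
      unfolding T_def q_def[symmetric] using C(1)
      by (intro mult_right_mono order_trans[OF mult_left_mono mult_right_mono]) auto
    also have "\<Lambda> powr (- real q) = 1 / (4 * C) ^ q"
      using C(1) by (simp add: \<Lambda>_def powr_minus powr_realpow field_simps)
    also have "C ^ q * 2 ^ q * (1 / (4 * C) ^ q) = (1 / 2) ^ q"
    proof -
      have "(4 * C) ^ q = (2 * 2 * C) ^ q" by simp
      also have "\<dots> = 2 ^ q * 2 ^ q * C ^ q" by (simp only: power_mult_distrib)
      finally have "(4 * C) ^ q = 2 ^ q * 2 ^ q * C ^ q" .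
      then show ?thesis using C(1) by (simp add: power_divide)
    qed
    also have "\<dots> \<le> (1 / 2) ^ n" using qn by (intro power_decreasing) auto
    finally show ?thesis .
  qed
  have bound: "(\<Sum>n=1..N. T n) \<le> 2" for N
  proof -
    have "(\<Sum>n=1..N. T n) \<le> (\<Sum>n=1..N. (1 / 2) ^ n)" by (intro sum_mono T) auto
    also have "\<dots> \<le> (\<Sum>n. (1 / 2 :: real) ^ n)" by (intro sum_le_suminf summable_geometric) auto
    also have "\<dots> = 2" by (subst suminf_geometric) auto
    finally show ?thesis .
  qed
  have "\<not> filterlim (\<lambda>N. \<Sum>n=1..N. T n) at_top sequentially"
  proof
    assume "filterlim (\<lambda>N. \<Sum>n=1..N. T n) at_top sequentially"
    then have "\<forall>\<^sub>F N in sequentially. (\<Sum>n=1..N. T n) > 2" unfolding filterlim_at_top_dense by blast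
    then obtain N where "(\<Sum>n=1..N. T n) > 2" using eventually_happens by force
    then show False using bound[of N] by simp
  qed
  moreover have "\<Lambda> > 1" using C(1) by (simp add: \<Lambda>_def)
  ultimately show ?thesis unfolding T_def by blast
qed

end
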